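(* Assume the standing setting below, and let $f\in L^{p'}(\partial\Omega,\nu)$, $p'=p/(p-1)$, with $\int_{\partial\Omega}f\,d\nu=0$. Let $u\in N^{1,p}(\Omega)=N^{1,p}(\overline\Omega)$. Then the following are equivalent: (a) $u$ is a solution of the Neumann problem with data $f$, i.e. for all $\phi\in N^{1,p}(\overline\Omega)$, $\int_\Omega|\nabla u|^{p-2}\nabla u\cdot\nabla\phi\,d\mu=\int_{\partial\Omega}\phi f\,d\nu$; (b) $u$ minimizes $I(v):=\int_{\overline\Omega}|\nabla v|^p\,d\mu-p\int_{\partial\Omega}vf\,d\nu$ among all $v\in N^{1,p}(\overline\Omega)$; (c) $u$ is Cheeger $p$-harmonic in $\Omega$ and, with $\eta_\varepsilon(x)=\min\{1,\operatorname{dist}(x,\partial\Omega)/\varepsilon\}$ on $\overline\Omega$, the signed measures $|\nabla u|^{p-2}\nabla u\cdot\nabla\eta_\varepsilon\,d\mu$ converge weakly to $-f\,d\nu$ as $\varepsilon\to0^+$, in the sense that for every Lipschitz function $\phi$ on $\overline\Omega$, $\lim_{\varepsilon\to0^+}\int_\Omega\phi\,|\nabla u|^{p-2}\nabla u\cdot\nabla\eta_\varepsilon\,d\mu=-\int_{\partial\Omega}\phi f\,d\nu$.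
   Context: Standing setting: $(X,d,\mu)$ is a complete metric measure space with $\mu$ a Radon measure, $1<p<\infty$, and $\Omega\subset X$ is a connected open set, $\partial\Omega=\overline\Omega\setminus\Omega$, such that: (H0) $\Omega$ is a John domain: there are $x_0\in\Omega$ and $C_J\ge1$ such that each $x\in\Omega$ is joined to $x_0$ by a rectifiable curve $\gamma_x$ in $\Omega$ with $\operatorname{dist}(z,X\setminus\Omega)\ge C_J^{-1}\ell(\gamma_x[x,z])$ for all $z$ on $\gamma_x$, where $\gamma_x[x,z]$ is the subarc from $x$ to $z$ (in particular $\Omega$ is bounded); (H1) $\mu|_{\overline\Omega}$ is doubling ($0<\mu(B(x,2r))\le C_d\mu(B(x,r))<\infty$ for all balls of $\overline\Omega$) and $(\overline\Omega,d,\mu)$ supports a $p$-Poincaré inequality: there are $C_P>0,\lambda\ge1$ such that $\fint_B|u-u_B|\,d\mu\le C_Pr(\fint_{\lambda B}g^p\,d\mu)^{1/p}$ for every ball $B$ of radius $r$ in $\overline\Omega$, every function $u$ and every upper gradient $g$ of $u$; (H2) $\partial\Omega$ carries a Radon measure $\nu$ and there are $C\ge1$, $0<\Theta<p$ with $C^{-1}\mu(B(x,r)\cap\Omega)r^{-\Theta}\le\nu(B(x,r))\le C\mu(B(x,r)\cap\Omega)r^{-\Theta}$ for all $x\in\partial\Omega$, $0<r<2\operatorname{diam}(\partial\Omega)$. Balls are balls in $\overline\Omega$; $\nu$ is extended by zero to $\overline\Omega$. A nonnegative Borel $g$ is an upper gradient of $u$ if $|u(x)-u(y)|\le\int_\gamma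 g\,ds$ for every rectifiable curve $\gamma$ with endpoints $x,y$; $N^{1,p}$ is the Newton–Sobolev space of $L^p$ functions with an upper gradient in $L^p$, and $N^{1,p}(\Omega)=N^{1,p}(\overline\Omega)$. There is a bounded linear trace operator $T:N^{1,p}(\Omega)\to B^{1-\Theta/p}_{p,p}(\partial\Omega)$ with $\lim_{r\to0}\fint_{B(x,r)\cap\Omega}|u-Tu(x)|\,d\mu=0$ for $\nu$-a.e. $x\in\partial\Omega$; in integrals over $\partial\Omega$ a Sobolev function means its trace. A Cheeger differential structure on $\overline\Omega$ is fixed: each $u\in N^{1,p}$ has a measurable gradient $\nabla u(x)\in\mathbb R^N$, with measurable inner products $\langle\cdot,\cdot\rangle_x$; we write $\nabla u\cdot\nabla v=\langle\nabla u,\nabla v\rangle_x$ and $|\nabla u|$ for the norm; $u\mapsto\nabla u$ is linear, satisfies the Leibniz rule, and $|\nabla u|$ is comparable (with a fixed constant) to the minimal $p$-weak upper gradient of $u$. A function $u$ is Cheeger $p$-harmonic in an open set $U$ (of $X$ or of $\overline\Omega$) if $\int_U|\nabla u|^{p-2}\nabla u\cdot\nabla\phi\,d\mu=0$ for all $\phi\in N^{1,p}$ with compact support in $U$. *)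

theory Defs
  imports "HOL-Analysis.Analysis"
begin

definition chain_len :: "(real \<Rightarrow> 'a::metric_space) \<Rightarrow> real list \<Rightarrow> real" where
  "chain_len \<gamma> ts = (\<Sum>i<length ts - 1. dist (\<gamma> (ts ! i)) (\<gamma> (ts ! Suc i)))"

definition curve_length :: "(real \<Rightarrow> 'a::metric_space) \<Rightarrow> real \<Rightarrow> real \<Rightarrow> ennreal" where
  "curve_length \<gamma> a b = (SUP ts \<in> {ts. sorted ts \<and> set ts \<subseteq> {a..b}}. ennreal (chain_len \<gamma> ts))"

definition rectifiable_curve :: "(real \<Rightarrow> 'a::metric_space) \<Rightarrow> real \<Rightarrow> real \<Rightarrow> bool" where
  "rectifiable_curve \<gamma> a b \<longleftrightarrow> a \<le> b \<and> continuous_on {a..b} \<gamma> \<and> curve_length \<gamma> a b < \<infinity>"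

definition arclen :: "(real \<Rightarrow> 'a::metric_space) \<Rightarrow> real \<Rightarrow> real \<Rightarrow> real \<Rightarrow> real" where
  "arclen \<gamma> a b t = enn2real (curve_length \<gamma> a (max a (min b t)))"

definition line_integral :: "(real \<Rightarrow> 'a::metric_space) \<Rightarrow> real \<Rightarrow> real \<Rightarrow> ('a \<Rightarrow> ennreal) \<Rightarrow> ennreal" where
  "line_integral \<gamma> a b g = (\<integral>\<^sup>+ t. g (\<gamma> t) * indicator {a..b} t \<partial>(interval_measure (arclen \<gamma> a b)))"

definition enn_powr :: "ennreal \<Rightarrow> real \<Rightarrow> ennreal" where
  "enn_powr x q = (if x = \<infinity> then \<infinity> else ennreal (enn2real x powr q))"

definition upper_gradient :: "'a::metric_space set \<Rightarrow> ('a \<Rightarrow> real) \<Rightarrow> ('a \<Rightarrow> ennreal) \<Rightarrow> bool" where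
  "upper_gradient S u g \<longleftrightarrow> g \<in> borel_measurable borel \<and>
     (\<forall>\<gamma> a b. rectifiable_curve \<gamma> a b \<and> \<gamma> ` {a..b} \<subseteq> S \<longrightarrow>
        ennreal \<bar>u (\<gamma> a) - u (\<gamma> b)\<bar> \<le> line_integral \<gamma> a b g)"

definition p_modulus :: "'a::metric_space measure \<Rightarrow> real \<Rightarrow> 'a set \<Rightarrow> ((real \<Rightarrow> 'a) \<times> real \<times> real) set \<Rightarrow> ennreal" where
  "p_modulus M p S \<Gamma> =
     (INF \<rho> \<in> {\<rho>. \<rho> \<in> borel_measurable borel \<and> (\<forall>(\<gamma>, a, b) \<in> \<Gamma>. 1 \<le> line_integral \<gamma> a b \<rho>)}.
        \<integral>\<^sup>+ x \<in> S. enn_powr (\<rho> x) p \<partial>M)"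

definition pweak_upper_gradient :: "'a::metric_space measure \<Rightarrow> real \<Rightarrow> 'a set \<Rightarrow> ('a \<Rightarrow> real) \<Rightarrow> ('a \<Rightarrow> ennreal) \<Rightarrow> bool" where
  "pweak_upper_gradient M p S u g \<longleftrightarrow> g \<in> borel_measurable borel \<and>
     p_modulus M p S {(\<gamma>, a, b). rectifiable_curve \<gamma> a b \<and> \<gamma> ` {a..b} \<subseteq> S \<and>
        \<not> (ennreal \<bar>u (\<gamma> a) - u (\<gamma> b)\<bar> \<le> line_integral \<gamma> a b g)} = 0"

definition min_pweak_upper_gradient :: "'a::metric_space measure \<Rightarrow> real \<Rightarrow> 'a set \<Rightarrow> ('a \<Rightarrow> real) \<Rightarrow> ('a \<Rightarrow> ennreal) \<Rightarrow> bool" where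
  "min_pweak_upper_gradient M p S u g \<longleftrightarrow>
     pweak_upper_gradient M p S u g \<and> (\<integral>\<^sup>+ x \<in> S. enn_powr (g x) p \<partial>M) < \<infinity> \<and>
     (\<forall>h. pweak_upper_gradient M p S u h \<and> (\<integral>\<^sup>+ x \<in> S. enn_powr (h x) p \<partial>M) < \<infinity> \<longrightarrow>
          (AE x in M. x \<in> S \<longrightarrow> g x \<le> h x))"

definition newton_space :: "'a::metric_space measure \<Rightarrow> real \<Rightarrow> 'a set \<Rightarrow> ('a \<Rightarrow> real) set" where
  "newton_space M p S = {u. set_borel_measurable M S u \<and>
       (\<integral>\<^sup>+ x \<in> S. ennreal (\<bar>u x\<bar> powr p) \<partial>M) < \<infinity> \<and>
       (\<exists>g. upper_gradient S u g \<and> (\<integral>\<^sup>+ x \<in> S. enn_powr (g x) p \<partial>M) < \<infinity>)}"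

definition radon_measure :: "'a::metric_space measure \<Rightarrow> bool" where
  "radon_measure M \<longleftrightarrow> sets M = sets borel \<and>
     (\<forall>K. compact K \<longrightarrow> emeasure M K < \<infinity>) \<and>
     (\<forall>A \<in> sets borel. emeasure M A = (INF U \<in> {U. open U \<and> A \<subseteq> U}. emeasure M U)) \<and>
     (\<forall>U. open U \<longrightarrow> emeasure M U = (SUP K \<in> {K. compact K \<and> K \<subseteq> U}. emeasure M K))"

definition john_domain :: "'a::metric_space set \<Rightarrow> 'a \<Rightarrow> real \<Rightarrow> bool" where
  "john_domain \<Omega> x0 CJ \<longleftrightarrow> x0 \<in> \<Omega> \<and> 1 \<le> CJ \<and>
     (\<forall>x \<in> \<Omega>. \<exists>\<gamma> a b. rectifiable_curve \<gamma> a b \<and> \<gamma> a = x \<and> \<gamma> b = x0 \<and> \<gamma> ` {a..b} \<subseteq> \<Omega> \<and>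
        (\<forall>t \<in> {a..b}. curve_length \<gamma> a t \<le> ennreal CJ * ennreal (infdist (\<gamma> t) (- \<Omega>))))"

definition doubling_on :: "'a::metric_space measure \<Rightarrow> 'a set \<Rightarrow> bool" where
  "doubling_on M S \<longleftrightarrow> (\<exists>Cd. \<forall>x \<in> S. \<forall>r > 0.
      0 < emeasure M (ball x (2 * r) \<inter> S) \<and>
      emeasure M (ball x (2 * r) \<inter> S) \<le> ennreal Cd * emeasure M (ball x r \<inter> S) \<and>
      emeasure M (ball x r \<inter> S) < \<infinity>)"

definition poincare_on :: "'a::metric_space measure \<Rightarrow> real \<Rightarrow> 'a set \<Rightarrow> bool" where
  "poincare_on M p S \<longleftrightarrow> (\<exists>CP > 0. \<exists>lam \<ge> 1. \<forall>x \<in> S. \<forall>r > 0. \<forall>u g.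
      set_borel_measurable M S u \<and> (\<forall>y \<in> S. \<forall>s > 0. set_integrable M (ball y s \<inter> S) u) \<and>
      upper_gradient S u g \<longrightarrow>
      (let B = ball x r \<inter> S; LB = ball x (lam * r) \<inter> S;
           uB = (LINT y:B|M. u y) / measure M B
       in (\<integral>\<^sup>+ y \<in> B. ennreal \<bar>u y - uB\<bar> \<partial>M) / emeasure M B
          \<le> ennreal (CP * r) * enn_powr ((\<integral>\<^sup>+ y \<in> LB. enn_powr (g y) p \<partial>M) / emeasure M LB) (1 / p)))"

definition inner_prod :: "('v::real_vector \<Rightarrow> 'v \<Rightarrow> real) \<Rightarrow> bool" where
  "inner_prod B \<longleftrightarrow> (\<forall>v w. B v w = B w v) \<and> (\<forall>w. linear (\<lambda>v. B v w)) \<and> (\<forall>v. v \<noteq> 0 \<longrightarrow> 0 < B v v)"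

definition cnorm :: "('a \<Rightarrow> real^'n \<Rightarrow> real^'n \<Rightarrow> real) \<Rightarrow> 'a \<Rightarrow> real^'n \<Rightarrow> real" where
  "cnorm ip x v = sqrt (ip x v v)"

definition cheeger_structure :: "'a::metric_space measure \<Rightarrow> real \<Rightarrow> 'a set \<Rightarrow>
    (('a \<Rightarrow> real) \<Rightarrow> 'a \<Rightarrow> real^'n) \<Rightarrow> ('a \<Rightarrow> real^'n \<Rightarrow> real^'n \<Rightarrow> real) \<Rightarrow> bool" where
  "cheeger_structure M p S D ip \<longleftrightarrow>
     (\<forall>x \<in> S. inner_prod (ip x)) \<and>
     (\<forall>v w. set_borel_measurable M S (\<lambda>x. ip x v w)) \<and>
     (\<forall>u \<in> newton_space M p S. set_borel_measurable M S (D u)) \<and>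
     (\<forall>u \<in> newton_space M p S. \<forall>v \<in> newton_space M p S. \<forall>a b::real.
        AE x in M. x \<in> S \<longrightarrow> D (\<lambda>y. a * u y + b * v y) x = a *\<^sub>R D u x + b *\<^sub>R D v x) \<and>
     (\<forall>u \<in> newton_space M p S. \<forall>v \<in> newton_space M p S. (\<lambda>y. u y * v y) \<in> newton_space M p S \<longrightarrow>
        (AE x in M. x \<in> S \<longrightarrow> D (\<lambda>y. u y * v y) x = u x *\<^sub>R D v x + v x *\<^sub>R D u x)) \<and>
     (\<exists>C \<ge> 1. \<forall>u \<in> newton_space M p S. \<exists>g. min_pweak_upper_gradient M p S u g \<and>
        (AE x in M. x \<in> S \<longrightarrow> g x \<le> ennreal C * ennreal (cnorm ip x (D u x)) \<and>
                               ennreal (cnorm ip x (D u x)) \<le> ennreal C * g x))"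

definition pflux :: "(('a \<Rightarrow> real) \<Rightarrow> 'a \<Rightarrow> real^'n) \<Rightarrow> ('a \<Rightarrow> real^'n \<Rightarrow> real^'n \<Rightarrow> real) \<Rightarrow> real \<Rightarrow>
    ('a \<Rightarrow> real) \<Rightarrow> ('a \<Rightarrow> real) \<Rightarrow> 'a \<Rightarrow> real" where
  "pflux D ip p u \<phi> x = cnorm ip x (D u x) powr (p - 2) * ip x (D u x) (D \<phi> x)"

definition cheeger_p_harmonic :: "'a::metric_space measure \<Rightarrow> real \<Rightarrow> 'a set \<Rightarrow>
    (('a \<Rightarrow> real) \<Rightarrow> 'a \<Rightarrow> real^'n) \<Rightarrow> ('a \<Rightarrow> real^'n \<Rightarrow> real^'n \<Rightarrow> real) \<Rightarrow> 'a set \<Rightarrow> ('a \<Rightarrow> real) \<Rightarrow> bool" where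
  "cheeger_p_harmonic M p S D ip U u \<longleftrightarrow>
     (\<forall>\<phi> \<in> newton_space M p S. compact (closure {x \<in> S. \<phi> x \<noteq> 0}) \<and> closure {x \<in> S. \<phi> x \<noteq> 0} \<subseteq> U \<longrightarrow>
        (LINT x:U|M. pflux D ip p u \<phi> x) = 0)"

end

theory Submission
  imports Defs
begin

text \<open>
Write \<open>S\<close> for the closure of \<open>\<Omega>\<close>. The John condition and doubling make \<open>S\<close> compact and, by porosity, the
boundary a null set for \<open>M\<close>. The equivalence of the Neumann problem with the minimization problem is the
convexity of \<open>v \<mapsto> |v|^p\<close>. If \<open>u\<close> solves the Neumann problem and \<open>\<phi>\<close> is Lipschitz, testing with
\<open>\<phi> \<eta>\<^sub>\<epsilon>\<close>, whose trace is zero, and the Leibniz rule give the boundary limit. Conversely, put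
\<open>F \<epsilon> = \<integral> |\<nabla>u|^(p-2) \<nabla>u \<sqdot> \<nabla>(\<phi> \<eta>\<^sub>\<epsilon>)\<close>; as \<open>min \<eta>\<^sub>\<epsilon> \<delta> = \<delta> \<eta>\<^sub>\<delta>\<^sub>\<epsilon>\<close>, harmonicity gives
\<open>F \<epsilon> = \<delta> F (\<delta> \<epsilon>)\<close>, and since \<open>F\<close> converges at \<open>0\<close> it vanishes, which is the Neumann identity for
Lipschitz \<open>\<phi>\<close>. It extends to all test functions by weak density of Lipschitz functions: the discrete
convolutions of a bounded Newton function are Lipschitz, bounded in energy and converge in \<open>L\<^sup>1\<close>, and midpoint
combinations of them with nearly minimal energy converge strongly by uniform convexity.
\<close>

section \<open>Rectifiable curves and line integrals\<close>

text \<open>\<open>D\<close> is only known to be linear, to obey the Leibniz rule and to be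
  comparable to the minimal weak upper gradient, and \<open>newton_space\<close> consists of
  functions, not of classes. So it has to be derived that \<open>D\<close> ignores null sets and
  vanishes away from the support of a cut-off function, and an almost everywhere limit needs a
  representative that satisfies the upper gradient inequality on every curve; a pointwise limsup
  supplies it. The estimates for discrete convolutions give bounded energy, not convergence of
  gradients. The identity to be extended is a linear functional continuous for the Newton norm; it
  still vanishes on midpoint combinations, and these can be made to converge in that norm. The
  scaling relation says that \<open>F\<close> is a multiple of 1/\<epsilon> near zero: harmonicity
  leaves one free constant for each Lipschitz test function, and the existence of a finite limit
  excludes every value except zero.\<close>

lemma chain_len_Cons2: "chain_len \<gamma> (x # y # zs) = dist (\<gamma> x) (\<gamma> y) + chain_len \<gamma> (y # zs)"
proof -
  have "chain_len \<gamma> (x # y # zs) = (\<Sum>i<Suc (length zs). dist (\<gamma> ((x # y # zs) ! i)) (\<gamma> ((y # zs) ! i)))"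
    unfolding chain_len_def by simp
  also have "\<dots> = dist (\<gamma> x) (\<gamma> y) + (\<Sum>i<length zs. dist (\<gamma> ((y # zs) ! i)) (\<gamma> (zs ! i)))"
    by (subst sum.lessThan_Suc_shift) simp
  finally show ?thesis unfolding chain_len_def by simp
qed

lemma chain_len_single [simp]: "chain_len \<gamma> [x] = 0" "chain_len \<gamma> [] = 0"
  unfolding chain_len_def by auto

lemma chain_len_nonneg: "0 \<le> chain_len \<gamma> ts"
  unfolding chain_len_def by (simp add: sum_nonneg)

lemma chain_len_join: "chain_len \<gamma> (xs @ t # ys) = chain_len \<gamma> (xs @ [t]) + chain_len \<gamma> (t # ys)"
proof (induction xs)
  case (Cons x xs)
  then show ?case by (cases xs) (auto simp: chain_len_Cons2)
qed auto

lemma chain_len_le_Cons: "chain_len \<gamma> ts \<le> chain_len \<gamma> (t # ts)"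
  by (cases ts) (auto simp: chain_len_Cons2)

lemma chain_len_le_snoc: "chain_len \<gamma> ts \<le> chain_len \<gamma> (ts @ [t])"
proof (induction ts)
  case (Cons x xs)
  then show ?case by (cases xs) (auto simp: chain_len_Cons2)
qed auto

text \<open>The triangle inequality at the inserted point. Subadditivity of length and its right
  continuity both rest on inserting one break point into a partition.\<close>

lemma chain_len_insert: "chain_len \<gamma> (xs @ ys) \<le> chain_len \<gamma> (xs @ t # ys)"
proof (induction xs)
  case Nil
  then show ?case by (simp add: chain_len_le_Cons)
next
  case (Cons x xs)
  show ?case
  proof (cases xs)
    case Nil
    show ?thesis
    proof (cases ys)
      case Nil then show ?thesis using \<open>xs = []\<close> by (simp add: chain_len_nonneg)
    next
      case (Cons y zs)
      then show ?thesis using \<open>xs = []\<close> dist_triangle[of "\<gamma> x" "\<gamma> y" "\<gamma> t"]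
        by (simp add: chain_len_Cons2)
    qed
  next
    case (Cons y zs)
    then show ?thesis using Cons.IH by (simp add: chain_len_Cons2)
  qed
qed

lemma chain_len_le_curve_length:
  assumes "sorted ts" "set ts \<subseteq> {a..b}"
  shows "ennreal (chain_len \<gamma> ts) \<le> curve_length \<gamma> a b"
  unfolding curve_length_def using assms by (intro SUP_upper) auto

lemma dist_le_curve_length:
  assumes "a \<le> s" "s \<le> t" "t \<le> b"
  shows "ennreal (dist (\<gamma> s) (\<gamma> t)) \<le> curve_length \<gamma> a b"
  using chain_len_le_curve_length[of "[s, t]" a b \<gamma>] assms by (simp add: chain_len_Cons2)

lemma curve_length_mono:
  assumes "a' \<le> a" "b \<le> b'" shows "curve_length \<gamma> a b \<le> curve_length \<gamma> a' b'"
  unfolding curve_length_def using assms by (intro SUP_subset_mono) auto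

lemma curve_length_refl [simp]: "curve_length \<gamma> a a = 0"
proof -
  have "chain_len \<gamma> ts = 0" if "set ts \<subseteq> {a}" for ts
    using that
  proof (induction ts)
    case (Cons x xs)
    then show ?case by (cases xs) (auto simp: chain_len_Cons2)
  qed auto
  then show ?thesis unfolding curve_length_def
    by (intro antisym SUP_least) auto
qed

lemma curve_length_subadd:
  assumes "a \<le> t" "t \<le> b"
  shows "curve_length \<gamma> a b \<le> curve_length \<gamma> a t + curve_length \<gamma> t b"
  unfolding curve_length_def[of \<gamma> a b]
proof (rule SUP_least)
  fix ts assume "ts \<in> {ts. sorted ts \<and> set ts \<subseteq> {a..b}}"
  then have ts: "sorted ts" "set ts \<subseteq> {a..b}" by auto
  define xs where "xs = takeWhile (\<lambda>x. x \<le> t) ts"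
  define ys where "ys = dropWhile (\<lambda>x. x \<le> t) ts"
  have eq: "ts = xs @ ys" by (simp add: xs_def ys_def)
  have xs: "\<forall>x\<in>set xs. x \<le> t" unfolding xs_def by (meson set_takeWhileD)
  have ys: "\<forall>y\<in>set ys. t \<le> y"
  proof (cases ys)
    case (Cons y zs)
    then have "\<not> y \<le> t" unfolding ys_def by (metis dropWhile_eq_Cons_conv)
    moreover have "sorted ys" using ts(1) by (simp add: eq sorted_append)
    ultimately show ?thesis using Cons by fastforce
  qed simp
  have s1: "sorted (xs @ [t])" "set (xs @ [t]) \<subseteq> {a..t}"
    using ts eq xs assms by (auto simp: sorted_append)
  have s2: "sorted (t # ys)" "set (t # ys) \<subseteq> {t..b}"
    using ts eq ys assms by (auto simp: sorted_append)
  have "chain_len \<gamma> ts \<le> chain_len \<gamma> (xs @ [t]) + chain_len \<gamma> (t # ys)"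
    using chain_len_insert[of \<gamma> xs ys t] chain_len_join[of \<gamma> xs t ys] eq by simp
  then have "ennreal (chain_len \<gamma> ts) \<le> ennreal (chain_len \<gamma> (xs @ [t])) + ennreal (chain_len \<gamma> (t # ys))"
    by (metis chain_len_nonneg ennreal_leI ennreal_plus)
  also have "\<dots> \<le> curve_length \<gamma> a t + curve_length \<gamma> t b"
    by (intro add_mono chain_len_le_curve_length s1 s2)
  finally show "ennreal (chain_len \<gamma> ts) \<le> curve_length \<gamma> a t + curve_length \<gamma> t b" .
qed

text \<open>The half of superadditivity in which the second chain stays fixed and only the first
  supremum is taken; the suprema are handled one at a time because each passes through a sum with a
  constant in \<open>ennreal\<close>.\<close>

lemma curve_length_add_chain:
  assumes "a \<le> t" "t \<le> b" "sorted ys" "set ys \<subseteq> {t..b}"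
  shows "curve_length \<gamma> a t + ennreal (chain_len \<gamma> ys) \<le> curve_length \<gamma> a b"
proof -
  have "ennreal (chain_len \<gamma> xs) + ennreal (chain_len \<gamma> ys) \<le> curve_length \<gamma> a b"
    if xs: "sorted xs" "set xs \<subseteq> {a..t}" for xs
  proof -
    have "chain_len \<gamma> xs + chain_len \<gamma> ys \<le> chain_len \<gamma> (xs @ t # ys)"
      using chain_len_join[of \<gamma> xs t ys] chain_len_le_snoc[of \<gamma> xs t] chain_len_le_Cons[of \<gamma> ys t] by linarith
    then have "ennreal (chain_len \<gamma> xs) + ennreal (chain_len \<gamma> ys) \<le> ennreal (chain_len \<gamma> (xs @ t # ys))"
      by (metis chain_len_nonneg ennreal_leI ennreal_plus)
    also have "\<dots> \<le> curve_length \<gamma> a b"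
      using xs assms by (intro chain_len_le_curve_length) (force simp: sorted_append)+
    finally show ?thesis .
  qed
  then have "(SUP xs \<in> {xs. sorted xs \<and> set xs \<subseteq> {a..t}}. ennreal (chain_len \<gamma> xs) + ennreal (chain_len \<gamma> ys)) \<le> curve_length \<gamma> a b"
    by (intro SUP_least) auto
  moreover have ne: "{xs. sorted xs \<and> set xs \<subseteq> {a..t}} \<noteq> {}"
    by (metis (mono_tags, lifting) empty_iff empty_subsetI list.set(1) mem_Collect_eq sorted_wrt.simps(1))
  ultimately show ?thesis unfolding curve_length_def[of \<gamma> a t]
    by (simp add: ennreal_SUP_add_left[OF ne])
qed

lemma curve_length_superadd:
  assumes "a \<le> t" "t \<le> b"
  shows "curve_length \<gamma> a t + curve_length \<gamma> t b \<le> curve_length \<gamma> a b"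
proof -
  have "(SUP ys \<in> {ys. sorted ys \<and> set ys \<subseteq> {t..b}}. curve_length \<gamma> a t + ennreal (chain_len \<gamma> ys)) \<le> curve_length \<gamma> a b"
    using assms by (intro SUP_least curve_length_add_chain) auto
  moreover have ne: "{ys. sorted ys \<and> set ys \<subseteq> {t..b}} \<noteq> {}"
    by (metis (mono_tags, lifting) empty_iff empty_subsetI list.set(1) mem_Collect_eq sorted_wrt.simps(1))
  ultimately show ?thesis unfolding curve_length_def[of \<gamma> t b]
    by (simp add: ennreal_SUP_add_right[OF ne])
qed

text \<open>Right continuity makes \<open>arclen\<close> a legitimate distribution function for
  \<open>interval_measure\<close>. A chain that nearly realizes the length of the curve beyond
  \<open>t0\<close> is fixed. If \<open>t1\<close> lies before its first point beyond
  \<open>t0\<close>, the piece from \<open>t0\<close> to \<open>t1\<close> contributes a single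
  small distance to the chain, so that piece can carry only little length.\<close>

lemma curve_length_right_continuous:
  assumes cont: "continuous_on {a..b} \<gamma>" and fin: "curve_length \<gamma> a b < \<infinity>"
    and t0: "a \<le> t0" "t0 < b" and e: "0 < e"
  shows "\<exists>t1. t0 < t1 \<and> t1 \<le> b \<and> curve_length \<gamma> a t1 \<le> curve_length \<gamma> a t0 + ennreal e"
proof -
  have fin0: "curve_length \<gamma> t0 b < \<infinity>"
    using curve_length_mono[of a t0 b b \<gamma>] fin t0 by (auto simp: top.not_eq_extremum dest: order.strict_trans1)
  have "\<exists>ts. sorted ts \<and> set ts \<subseteq> {t0..b} \<and> curve_length \<gamma> t0 b \<le> ennreal (chain_len \<gamma> ts) + ennreal (e/2)"
  proof (cases "curve_length \<gamma> t0 b = 0")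
    case True then show ?thesis by (intro exI[of _ "[]"]) auto
  next
    case False
    then have "curve_length \<gamma> t0 b - ennreal (e/2) < curve_length \<gamma> t0 b"
      using fin0 e by (intro ennreal_between) (auto simp: zero_less_iff_neq_zero)
    then have "\<exists>ts\<in>{ts. sorted ts \<and> set ts \<subseteq> {t0..b}}. curve_length \<gamma> t0 b - ennreal (e/2) < ennreal (chain_len \<gamma> ts)"
      unfolding curve_length_def[of \<gamma> t0 b] less_SUP_iff .
    then show ?thesis
      by (auto simp: ennreal_minus_le_iff add.commute dest!: less_imp_le)
  qed
  then obtain ts where ts: "sorted ts" "set ts \<subseteq> {t0..b}"
    and len: "curve_length \<gamma> t0 b \<le> ennreal (chain_len \<gamma> ts) + ennreal (e/2)" by auto
  from cont t0 have "continuous (at t0 within {a..b}) \<gamma>"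
    by (auto simp: continuous_on_eq_continuous_within)
  then obtain d where d: "d > 0" "\<And>t. t \<in> {a..b} \<Longrightarrow> dist t t0 < d \<Longrightarrow> dist (\<gamma> t) (\<gamma> t0) < e/2"
    unfolding continuous_within_eps_delta using e by (metis half_gt_zero)
  \<comment> \<open>Inserting \<open>b\<close> makes the minimum exist even when the chain has no
    point beyond \<open>t0\<close>.\<close>
  define A where "A = insert b (set ts - {t0})"
  have A: "finite A" "A \<noteq> {}" "\<And>x. x \<in> A \<Longrightarrow> t0 < x" using ts t0 by (force simp: A_def)+
  then have m: "t0 < Min A" "Min A \<le> b" by (auto simp: A_def)
  define t1 where "t1 = min (Min A) (t0 + d/2)"
  have t1: "t0 < t1" "t1 \<le> b" "dist t1 t0 < d" "t1 \<le> Min A"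
    using m d by (auto simp: t1_def dist_real_def min_def)
  \<comment> \<open>The chain may repeat \<open>t0\<close>; these entries are split off, since they
    have no length of their own and \<open>t1\<close> has to be inserted right after them.\<close>
  define xs where "xs = takeWhile (\<lambda>x. x = t0) ts"
  define ys where "ys = dropWhile (\<lambda>x. x = t0) ts"
  have eq: "ts = xs @ ys" by (simp add: xs_def ys_def)
  have xs: "\<forall>x\<in>set xs. x = t0" unfolding xs_def by (meson set_takeWhileD)
  have ys: "\<forall>y\<in>set ys. t1 \<le> y"
  proof (cases ys)
    case (Cons y zs)
    then have "y \<noteq> t0" using hd_dropWhile[of "\<lambda>x. x = t0" ts] by (simp add: ys_def)
    then have "y \<in> A" using Cons eq by (auto simp: A_def)
    then have "t1 \<le> y" using t1(4) Min_le[OF A(1), of y] by linarith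
    moreover have "sorted ys" using ts(1) by (simp add: eq sorted_append)
    ultimately show ?thesis using Cons by fastforce
  qed simp
  have cx: "chain_len \<gamma> (xs @ [t1]) \<le> dist (\<gamma> t0) (\<gamma> t1)" using xs
  proof (induction xs)
    case (Cons x xs)
    then show ?case by (cases xs) (auto simp: chain_len_Cons2)
  qed auto
  have "chain_len \<gamma> ts \<le> chain_len \<gamma> (xs @ [t1]) + chain_len \<gamma> (t1 # ys)"
    using chain_len_insert[of \<gamma> xs ys t1] chain_len_join[of \<gamma> xs t1 ys] eq by simp
  also have "\<dots> \<le> e/2 + chain_len \<gamma> (t1 # ys)"
    using cx d(2)[of t1] t1 t0 by (auto simp: dist_commute)
  finally have c1: "ennreal (chain_len \<gamma> ts) \<le> ennreal (e/2) + ennreal (chain_len \<gamma> (t1 # ys))"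
    using e by (metis chain_len_nonneg ennreal_leI ennreal_plus half_gt_zero less_imp_le)
  have "curve_length \<gamma> t0 t1 + curve_length \<gamma> t1 b \<le> curve_length \<gamma> t0 b"
    using t1 by (intro curve_length_superadd) auto
  also have "\<dots> \<le> ennreal (e/2) + ennreal (chain_len \<gamma> (t1 # ys)) + ennreal (e/2)"
    using len c1 by (meson add_right_mono order.trans)
  also have "\<dots> = ennreal e + ennreal (chain_len \<gamma> (t1 # ys))"
    using e by (simp add: add.commute add.left_commute ennreal_plus[symmetric] chain_len_nonneg del: ennreal_plus)
  also have "\<dots> \<le> ennreal e + curve_length \<gamma> t1 b"
    using ts eq ys t1 by (intro add_left_mono chain_len_le_curve_length) (auto simp: sorted_append)
  finally have *: "curve_length \<gamma> t0 t1 + curve_length \<gamma> t1 b \<le> ennreal e + curve_length \<gamma> t1 b" .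
  have "curve_length \<gamma> t1 b \<noteq> \<infinity>"
    using curve_length_mono[of t0 t1 b b \<gamma>] fin0 t1 by (auto simp: top_unique)
  then have "curve_length \<gamma> t0 t1 \<le> ennreal e"
    using * by (metis add.commute ennreal_add_left_cancel_le infinity_ennreal_def)
  moreover have "curve_length \<gamma> a t1 \<le> curve_length \<gamma> a t0 + curve_length \<gamma> t0 t1"
    using t0 t1 by (intro curve_length_subadd) auto
  ultimately show ?thesis using t1 by (meson add_left_mono order.trans)
qed

lemma arclen_mono:
  assumes "rectifiable_curve \<gamma> a b" "s \<le> t"
  shows "arclen \<gamma> a b s \<le> arclen \<gamma> a b t"
proof -
  have "curve_length \<gamma> a (max a (min b t)) \<le> curve_length \<gamma> a b"
    using assms by (intro curve_length_mono) (auto simp: rectifiable_curve_def)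
  then have "curve_length \<gamma> a (max a (min b t)) < \<infinity>"
    using assms unfolding rectifiable_curve_def by (meson order.strict_trans1)
  moreover have "curve_length \<gamma> a (max a (min b s)) \<le> curve_length \<gamma> a (max a (min b t))"
    using assms by (intro curve_length_mono) auto
  ultimately show ?thesis unfolding arclen_def by (auto intro: enn2real_mono)
qed

lemma arclen_right_continuous:
  assumes rect: "rectifiable_curve \<gamma> a b"
  shows "continuous (at_right t0) (arclen \<gamma> a b)"
proof -
  have ab: "a \<le> b" and fin: "curve_length \<gamma> a b < \<infinity>" and cont: "continuous_on {a..b} \<gamma>"
    using rect by (auto simp: rectifiable_curve_def)
  have fint: "curve_length \<gamma> a t < \<infinity>" if "t \<le> b" for t
    using curve_length_mono[of a a t b \<gamma>] fin that by (meson order.refl order.strict_trans1)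
  have "\<exists>t1>t0. arclen \<gamma> a b t1 \<le> arclen \<gamma> a b t0 + e" if e: "e > 0" for e
  proof (cases "a \<le> t0 \<and> t0 < b")
    case True
    then obtain t1 where t1: "t0 < t1" "t1 \<le> b" "curve_length \<gamma> a t1 \<le> curve_length \<gamma> a t0 + ennreal e"
      using curve_length_right_continuous[OF cont fin, of t0 e] e by auto
    have "enn2real (curve_length \<gamma> a t1) \<le> enn2real (curve_length \<gamma> a t0 + ennreal e)"
      using t1 fint[of t0] True by (intro enn2real_mono) (auto simp: less_top)
    also have "\<dots> = enn2real (curve_length \<gamma> a t0) + e"
      using fint[of t0] True e by (subst enn2real_plus) (auto simp: less_top)
    finally show ?thesis using t1 True ab by (intro exI[of _ t1]) (auto simp: arclen_def max_def min_def)
  next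
    case False
    then consider "t0 < a" | "b \<le> t0" by linarith
    then show ?thesis
    proof cases
      case 1 then show ?thesis using e ab by (intro exI[of _ a]) (auto simp: arclen_def max_def min_def)
    next
      case 2 then show ?thesis using e ab by (intro exI[of _ "t0+1"]) (auto simp: arclen_def max_def min_def)
    qed
  qed
  note ex = this
  have "((arclen \<gamma> a b) \<longlongrightarrow> arclen \<gamma> a b t0) (at_right t0)"
  proof (rule order_tendstoI)
    fix y assume "y < arclen \<gamma> a b t0"
    then show "\<forall>\<^sub>F x in at_right t0. y < arclen \<gamma> a b x"
      using arclen_mono[OF rect, of t0]
      by (auto simp: eventually_at_filter intro!: always_eventually) (meson less_imp_le less_le_trans)
  next
    fix y assume y: "arclen \<gamma> a b t0 < y"
    then obtain t1 where t1: "t1 > t0" "arclen \<gamma> a b t1 \<le> arclen \<gamma> a b t0 + (y - arclen \<gamma> a b t0)/2"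
      using ex[of "(y - arclen \<gamma> a b t0)/2"] by auto
    then have "arclen \<gamma> a b t1 < y" using y by (simp add: field_simps)
    then show "\<forall>\<^sub>F x in at_right t0. arclen \<gamma> a b x < y"
      unfolding eventually_at_right[OF t1(1)] using t1 arclen_mono[OF rect]
      by (meson le_less_trans less_imp_le)
  qed
  then show ?thesis by (simp add: continuous_within)
qed

lemma line_integral_measurable:
  fixes g :: "'a::metric_space \<Rightarrow> ennreal"
  assumes "rectifiable_curve \<gamma> a b" "g \<in> borel_measurable borel"
  shows "(\<lambda>t. g (\<gamma> t) * indicator {a..b} t) \<in> borel_measurable borel"
proof -
  have "\<gamma> \<in> borel_measurable (restrict_space borel {a..b})"
    using assms by (intro borel_measurable_continuous_on_restrict) (auto simp: rectifiable_curve_def)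
  then have "(\<lambda>t. g (\<gamma> t)) \<in> borel_measurable (restrict_space borel {a..b})"
    using assms(2) by (rule measurable_compose)
  then show ?thesis
    using borel_measurable_restrict_space_iff_ennreal[of "{a..b}" borel "\<lambda>t. g (\<gamma> t)"] by simp
qed

text \<open>The distance of the end points is at most the length, which is the mass of the half-open
  parameter interval. This is the link between distances and line integrals through which Lipschitz
  constants become upper gradients.\<close>

lemma dist_le_line_integral_1:
  assumes rect: "rectifiable_curve \<gamma> a b"
  shows "ennreal (dist (\<gamma> a) (\<gamma> b)) \<le> line_integral \<gamma> a b (\<lambda>_. 1)"
proof -
  let ?F = "arclen \<gamma> a b"
  have ab: "a \<le> b" and fin: "curve_length \<gamma> a b < \<infinity>" using rect by (auto simp: rectifiable_curve_def)
  have "ennreal (dist (\<gamma> a) (\<gamma> b)) \<le> curve_length \<gamma> a b"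
    using ab by (intro dist_le_curve_length) auto
  also have "\<dots> = ennreal (?F b - ?F a)"
    using ab fin by (simp add: arclen_def max_def less_top)
  also have "\<dots> = emeasure (interval_measure ?F) {a<..b}"
    using ab arclen_mono[OF rect] arclen_right_continuous[OF rect]
    by (intro emeasure_interval_measure_Ioc[symmetric]) auto
  also have "\<dots> \<le> emeasure (interval_measure ?F) {a..b}"
    by (intro emeasure_mono) auto
  also have "\<dots> = line_integral \<gamma> a b (\<lambda>_. 1)"
    unfolding line_integral_def by simp
  finally show ?thesis .
qed

lemma line_integral_mono:
  assumes "\<And>x. x \<in> \<gamma> ` {a..b} \<Longrightarrow> g x \<le> h x"
  shows "line_integral \<gamma> a b g \<le> line_integral \<gamma> a b h"
  unfolding line_integral_def using assms
  by (intro nn_integral_mono) (auto simp: indicator_def)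

lemma line_integral_add:
  assumes "rectifiable_curve \<gamma> a b" "g \<in> borel_measurable borel" "h \<in> borel_measurable borel"
  shows "line_integral \<gamma> a b (\<lambda>x. g x + h x) = line_integral \<gamma> a b g + line_integral \<gamma> a b h"
  unfolding line_integral_def distrib_right
  using assms by (intro nn_integral_add) (auto intro: line_integral_measurable simp: measurable_cong_sets[OF sets_interval_measure refl])

lemma line_integral_cmult:
  assumes "rectifiable_curve \<gamma> a b" "g \<in> borel_measurable borel"
  shows "line_integral \<gamma> a b (\<lambda>x. c * g x) = c * line_integral \<gamma> a b g"
  unfolding line_integral_def mult.assoc
  using assms by (intro nn_integral_cmult) (auto intro: line_integral_measurable simp: measurable_cong_sets[OF sets_interval_measure refl])

section \<open>Upper gradients and the Newton space\<close>

lemma enn_powr_ennreal: "0 \<le> x \<Longrightarrow> enn_powr (ennreal x) q = ennreal (x powr q)"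
  by (simp add: enn_powr_def)

lemma enn_powr_top [simp]: "enn_powr \<infinity> q = \<infinity>" "enn_powr top q = top"
  by (simp_all add: enn_powr_def)

lemma enn_powr_zero [simp]: "enn_powr 0 q = 0"
  by (simp add: enn_powr_def)

lemma enn_powr_mono:
  assumes "0 \<le> q" "x \<le> y" shows "enn_powr x q \<le> enn_powr y q"
proof (cases "y = \<infinity>")
  case False
  then have "x \<noteq> \<infinity>" using assms by (auto simp: top_unique)
  then show ?thesis using False assms unfolding enn_powr_def
    by (auto intro!: ennreal_leI powr_mono2 enn2real_mono simp: less_top)
qed simp

lemma enn_powr_powr: "enn_powr (enn_powr x a) b = enn_powr x (a * b)"
  by (auto simp: enn_powr_def powr_powr)

lemma enn_powr_one [simp]: "enn_powr x 1 = x"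
  by (cases x) (auto simp: enn_powr_def)

lemma enn_powr_cmult:
  assumes "0 \<le> c" "0 < q"
  shows "enn_powr (ennreal c * x) q = ennreal (c powr q) * enn_powr x q"
proof (cases x)
  case (real r)
  then show ?thesis using assms
    by (simp add: enn_powr_ennreal ennreal_mult[symmetric] powr_mult)
next
  case top
  then show ?thesis using assms
    by (cases "c = 0") (auto simp: ennreal_mult_top)
qed

lemma enn_powr_add_le:
  assumes "0 < q"
  shows "enn_powr (x + y) q \<le> ennreal (2 powr q) * (enn_powr x q + enn_powr y q)"
proof -
  have "x + y \<le> ennreal 2 * max x y"
    by (simp add: mult_2 add_mono)
  then have "enn_powr (x + y) q \<le> ennreal (2 powr q) * enn_powr (max x y) q"
    using enn_powr_mono[of q] enn_powr_cmult[of 2 q] assms by (metis less_imp_le zero_le_numeral)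
  also have "enn_powr (max x y) q \<le> enn_powr x q + enn_powr y q"
    by (simp add: max_def)
  finally show ?thesis by (simp add: mult_left_mono)
qed

lemma measurable_enn_powr [measurable (raw)]:
  assumes [measurable]: "f \<in> borel_measurable N"
  shows "(\<lambda>x. enn_powr (f x) q) \<in> borel_measurable N"
  unfolding enn_powr_def by measurable

text \<open>Every term is below the \<open>1/q\<close>-th power of the whole series. Through suprema
  a countable family of functions is merged into one at the price of the sum of the energies, with
  no triangle inequality for norms.\<close>

lemma enn_powr_SUP_le:
  fixes f :: "nat \<Rightarrow> ennreal"
  assumes "0 < q"
  shows "enn_powr (SUP n. f n) q \<le> (\<Sum>n. enn_powr (f n) q)" (is "_ \<le> ?s")
proof -
  have "f n \<le> enn_powr ?s (1/q)" for n
  proof -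
    have "enn_powr (f n) q = (\<Sum>i\<in>{n}. enn_powr (f i) q)" by simp
    also have "\<dots> \<le> ?s" by (rule sum_le_suminf) auto
    finally have "enn_powr (enn_powr (f n) q) (1/q) \<le> enn_powr ?s (1/q)"
      using assms by (intro enn_powr_mono) auto
    then show ?thesis using assms by (simp add: enn_powr_powr)
  qed
  then have "(SUP n. f n) \<le> enn_powr ?s (1/q)" by (intro SUP_least)
  then have "enn_powr (SUP n. f n) q \<le> enn_powr (enn_powr ?s (1/q)) q"
    using assms by (intro enn_powr_mono) auto
  then show ?thesis using assms by (simp add: enn_powr_powr)
qed

lemma powr_abs_add_le:
  fixes x y :: real
  assumes "0 < q"
  shows "\<bar>x + y\<bar> powr q \<le> 2 powr q * (\<bar>x\<bar> powr q + \<bar>y\<bar> powr q)"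
proof -
  have "\<bar>x + y\<bar> powr q \<le> (2 * max \<bar>x\<bar> \<bar>y\<bar>) powr q"
    using assms by (intro powr_mono2) auto
  also have "\<dots> = 2 powr q * (max \<bar>x\<bar> \<bar>y\<bar>) powr q" by (simp add: powr_mult)
  also have "\<dots> \<le> 2 powr q * (\<bar>x\<bar> powr q + \<bar>y\<bar> powr q)"
    by (intro mult_left_mono) (auto simp: max_def)
  finally show ?thesis .
qed

lemma upper_gradient_measurable: "upper_gradient S u g \<Longrightarrow> g \<in> borel_measurable borel"
  by (simp add: upper_gradient_def)

lemma upper_gradientD:
  "upper_gradient S u g \<Longrightarrow> rectifiable_curve \<gamma> a b \<Longrightarrow> \<gamma> ` {a..b} \<subseteq> S \<Longrightarrow>
    ennreal \<bar>u (\<gamma> a) - u (\<gamma> b)\<bar> \<le> line_integral \<gamma> a b g"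
  by (auto simp: upper_gradient_def)

lemma curve_ends: "rectifiable_curve \<gamma> a b \<Longrightarrow> \<gamma> ` {a..b} \<subseteq> S \<Longrightarrow> \<gamma> a \<in> S \<and> \<gamma> b \<in> S"
  by (auto simp: rectifiable_curve_def)

lemma upper_gradient_lipschitz:
  assumes "L-lipschitz_on S u"
  shows "upper_gradient S u (\<lambda>_. ennreal L)"
  unfolding upper_gradient_def
proof (intro conjI allI impI; (elim conjE)?)
  fix \<gamma> a b assume r: "rectifiable_curve \<gamma> a b" "\<gamma> ` {a..b} \<subseteq> S"
  have L: "0 \<le> L" using assms by (rule lipschitz_on_nonneg)
  have "\<bar>u (\<gamma> a) - u (\<gamma> b)\<bar> \<le> L * dist (\<gamma> a) (\<gamma> b)"
    using lipschitz_onD[OF assms, of "\<gamma> a" "\<gamma> b"] curve_ends[OF r] by (simp add: dist_real_def)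
  then have "ennreal \<bar>u (\<gamma> a) - u (\<gamma> b)\<bar> \<le> ennreal L * ennreal (dist (\<gamma> a) (\<gamma> b))"
    using L by (simp add: ennreal_mult[symmetric])
  also have "\<dots> \<le> ennreal L * line_integral \<gamma> a b (\<lambda>_. 1)"
    using r by (intro mult_left_mono dist_le_line_integral_1) auto
  also have "\<dots> = line_integral \<gamma> a b (\<lambda>_. ennreal L)"
    using line_integral_cmult[OF r(1), of "\<lambda>_. 1" "ennreal L"] by simp
  finally show "ennreal \<bar>u (\<gamma> a) - u (\<gamma> b)\<bar> \<le> line_integral \<gamma> a b (\<lambda>_. ennreal L)" .
qed simp

text \<open>The common mechanism behind scalar multiples, truncations and bounded transforms of a
  Newton function.\<close>

lemma upper_gradient_contract:
  assumes "upper_gradient S u g" "0 \<le> c" "\<And>x y. x \<in> S \<Longrightarrow> y \<in> S \<Longrightarrow> \<bar>v x - v y\<bar> \<le> c * \<bar>u x - u y\<bar>"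
  shows "upper_gradient S v (\<lambda>x. ennreal c * g x)"
  unfolding upper_gradient_def
proof (intro conjI allI impI; (elim conjE)?)
  note [measurable] = upper_gradient_measurable[OF assms(1)]
  show "(\<lambda>x. ennreal c * g x) \<in> borel_measurable borel" by measurable
  fix \<gamma> a b assume r: "rectifiable_curve \<gamma> a b" "\<gamma> ` {a..b} \<subseteq> S"
  have "ennreal \<bar>v (\<gamma> a) - v (\<gamma> b)\<bar> \<le> ennreal c * ennreal \<bar>u (\<gamma> a) - u (\<gamma> b)\<bar>"
    using assms(2,3) curve_ends[OF r] by (simp add: ennreal_mult[symmetric])
  also have "\<dots> \<le> ennreal c * line_integral \<gamma> a b g"
    by (intro mult_left_mono upper_gradientD[OF assms(1) r]) auto
  also have "\<dots> = line_integral \<gamma> a b (\<lambda>x. ennreal c * g x)"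
    by (subst line_integral_cmult[OF r(1)]) auto
  finally show "ennreal \<bar>v (\<gamma> a) - v (\<gamma> b)\<bar> \<le> line_integral \<gamma> a b (\<lambda>x. ennreal c * g x)" .
qed

lemma upper_gradient_add:
  assumes "upper_gradient S u g" "upper_gradient S v h"
  shows "upper_gradient S (\<lambda>x. u x + v x) (\<lambda>x. g x + h x)"
  unfolding upper_gradient_def
proof (intro conjI allI impI; (elim conjE)?)
  note [measurable] = upper_gradient_measurable[OF assms(1)] upper_gradient_measurable[OF assms(2)]
  show "(\<lambda>x. g x + h x) \<in> borel_measurable borel" by measurable
  fix \<gamma> a b assume r: "rectifiable_curve \<gamma> a b" "\<gamma> ` {a..b} \<subseteq> S"
  have "ennreal \<bar>u (\<gamma> a) + v (\<gamma> a) - (u (\<gamma> b) + v (\<gamma> b))\<bar>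
      \<le> ennreal \<bar>u (\<gamma> a) - u (\<gamma> b)\<bar> + ennreal \<bar>v (\<gamma> a) - v (\<gamma> b)\<bar>"
    by (subst ennreal_plus[symmetric]) (auto intro!: ennreal_leI simp del: ennreal_plus)
  also have "\<dots> \<le> line_integral \<gamma> a b g + line_integral \<gamma> a b h"
    by (intro add_mono upper_gradientD[OF assms(1) r] upper_gradientD[OF assms(2) r])
  also have "\<dots> = line_integral \<gamma> a b (\<lambda>x. g x + h x)"
    by (subst line_integral_add[OF r(1)]) auto
  finally show "ennreal \<bar>u (\<gamma> a) + v (\<gamma> a) - (u (\<gamma> b) + v (\<gamma> b))\<bar> \<le> line_integral \<gamma> a b (\<lambda>x. g x + h x)" .
qed

lemma upper_gradient_lincomb:
  assumes "upper_gradient S u g" "upper_gradient S v h"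
  shows "upper_gradient S (\<lambda>x. a * u x + b * v x) (\<lambda>x. ennreal \<bar>a\<bar> * g x + ennreal \<bar>b\<bar> * h x)"
  by (intro upper_gradient_add upper_gradient_contract[OF assms(1)] upper_gradient_contract[OF assms(2)])
     (auto simp: abs_mult[symmetric] right_diff_distrib)

section \<open>The Newton space on a compact set of finite measure\<close>

locale newton_setting =
  fixes M :: "'a::metric_space measure" and p :: real and S :: "'a set"
  assumes p: "1 < p" and sets_M: "sets M = sets borel" and compact_S: "compact S"
    and fin: "emeasure M S < \<infinity>"
begin

lemma p_pos: "0 < p" "0 \<le> p" "p \<noteq> 0" using p by auto

text \<open>Turns set integrals over \<open>S\<close> into integrals over a finite measure, where
  bounded functions are integrable.\<close>

definition mu :: "'a measure" where "mu = restrict_space M S"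

lemma space_M: "space M = UNIV"
  using sets_eq_imp_space_eq[OF sets_M] by simp

lemma S_sets [measurable]: "S \<in> sets M" "S \<in> sets borel"
  using compact_S by (auto simp: sets_M borel_compact)

lemma space_mu [simp]: "space mu = S"
  by (simp add: mu_def space_restrict_space space_M)

lemma sets_mu: "sets mu = sets (restrict_space borel S)"
  unfolding mu_def by (intro sets_restrict_space_cong sets_M)

lemma emeasure_mu: "A \<in> sets borel \<Longrightarrow> emeasure mu (A \<inter> S) = emeasure M (A \<inter> S)"
  unfolding mu_def by (subst emeasure_restrict_space) (auto simp: space_M sets_M)

sublocale finite_measure mu
  by (intro finite_measureI) (use fin emeasure_mu[of UNIV] in \<open>auto simp: less_top\<close>)

lemma nn_integral_mu: "(\<integral>\<^sup>+ x\<in>S. F x \<partial>M) = (\<integral>\<^sup>+ x. F x \<partial>mu)"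
  unfolding mu_def by (subst nn_integral_restrict_space) (auto simp: space_M)

lemma AE_mu: "(AE x in M. x \<in> S \<longrightarrow> P x) \<longleftrightarrow> (AE x in mu. P x)"
  unfolding mu_def by (subst AE_restrict_space_iff) (auto simp: space_M)

lemma borel_mu: "set_borel_measurable M S u \<longleftrightarrow> u \<in> borel_measurable mu"
  for u :: "'a \<Rightarrow> 'b::real_normed_vector"
  unfolding set_borel_measurable_def mu_def
  by (subst borel_measurable_restrict_space_iff) (auto simp: space_M mult.commute)

lemma set_integral_mu: "(LINT x:S|M. F x) = (\<integral>x. F x \<partial>mu)"
  for F :: "'a \<Rightarrow> real"
  unfolding set_lebesgue_integral_def mu_def
  by (subst integral_restrict_space) (auto simp: space_M)

lemma borel_imp_mu: "h \<in> borel_measurable borel \<Longrightarrow> h \<in> borel_measurable mu"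
  unfolding mu_def by (intro measurable_restrict_space1) (simp add: measurable_cong_sets[OF sets_M refl])

lemma continuous_on_imp_mu:
  fixes u :: "'a \<Rightarrow> real"
  assumes "continuous_on S u" shows "u \<in> borel_measurable mu"
  using borel_measurable_continuous_on_restrict[OF assms]
  by (simp add: measurable_cong_sets[OF sets_mu refl])

text \<open>The \<open>p\<close>-th power of the norm on \<open>S\<close>. Without the root, suprema
  of countable families are controlled by plain sums.\<close>

definition pen :: "('a \<Rightarrow> ennreal) \<Rightarrow> ennreal" where
  "pen h = (\<integral>\<^sup>+ x. enn_powr (h x) p \<partial>mu)"

lemma pen_cmult:
  assumes "0 \<le> c" "g \<in> borel_measurable borel"
  shows "pen (\<lambda>x. ennreal c * g x) = ennreal (c powr p) * pen g"
  unfolding pen_def enn_powr_cmult[OF assms(1) p_pos(1)]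
  using borel_imp_mu[OF assms(2)] by (intro nn_integral_cmult) measurable

lemma pen_add:
  assumes "g \<in> borel_measurable borel" "h \<in> borel_measurable borel"
  shows "pen (\<lambda>x. g x + h x) \<le> ennreal (2 powr p) * (pen g + pen h)"
proof -
  note [measurable] = borel_imp_mu[OF assms(1)] borel_imp_mu[OF assms(2)]
  have "pen (\<lambda>x. g x + h x) \<le> (\<integral>\<^sup>+ x. ennreal (2 powr p) * (enn_powr (g x) p + enn_powr (h x) p) \<partial>mu)"
    unfolding pen_def by (intro nn_integral_mono enn_powr_add_le p_pos)
  also have "\<dots> = ennreal (2 powr p) * (pen g + pen h)"
    unfolding pen_def by (simp add: nn_integral_cmult nn_integral_add)
  finally show ?thesis .
qed

lemma pen_SUP:
  fixes f :: "nat \<Rightarrow> 'a \<Rightarrow> ennreal"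
  assumes "\<And>n. f n \<in> borel_measurable borel"
  shows "pen (\<lambda>x. SUP n. f n x) \<le> (\<Sum>n. pen (f n))"
proof -
  note [measurable] = borel_imp_mu[OF assms]
  have "pen (\<lambda>x. SUP n. f n x) \<le> (\<integral>\<^sup>+ x. (\<Sum>n. enn_powr (f n x) p) \<partial>mu)"
    unfolding pen_def by (intro nn_integral_mono enn_powr_SUP_le p_pos)
  also have "\<dots> = (\<Sum>n. pen (f n))"
    unfolding pen_def by (intro nn_integral_suminf) measurable
  finally show ?thesis .
qed

lemma newton_iff:
  "u \<in> newton_space M p S \<longleftrightarrow> u \<in> borel_measurable mu \<and>
     (\<integral>\<^sup>+ x. ennreal (\<bar>u x\<bar> powr p) \<partial>mu) < \<infinity> \<and> (\<exists>g. upper_gradient S u g \<and> pen g < \<infinity>)"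
  unfolding newton_space_def pen_def by (simp add: borel_mu nn_integral_mu)

lemma newtonI:
  assumes "u \<in> borel_measurable mu" "integrable mu (\<lambda>x. \<bar>u x\<bar> powr p)" "upper_gradient S u g" "pen g < \<infinity>"
  shows "u \<in> newton_space M p S"
  unfolding newton_iff using assms by (auto simp: integrable_iff_bounded)

lemma newtonE:
  assumes "u \<in> newton_space M p S"
  obtains g where "upper_gradient S u g" "pen g < \<infinity>"
  using assms unfolding newton_iff by auto

lemma newton_measurable: "u \<in> newton_space M p S \<Longrightarrow> u \<in> borel_measurable mu"
  by (simp add: newton_iff)

lemma newton_Lp: "u \<in> newton_space M p S \<Longrightarrow> integrable mu (\<lambda>x. \<bar>u x\<bar> powr p)"
  unfolding newton_iff by (intro integrableI_bounded) auto

lemma integrable_bounded: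
  fixes v :: "'a \<Rightarrow> real"
  assumes [measurable]: "v \<in> borel_measurable mu" and "\<And>x. x \<in> S \<Longrightarrow> \<bar>v x\<bar> \<le> K"
  shows "integrable mu v"
  using assms by (intro integrable_const_bound[where B=K]) auto

lemma Lp_bounded:
  fixes v :: "'a \<Rightarrow> real"
  assumes [measurable]: "v \<in> borel_measurable mu" and "\<And>x. x \<in> S \<Longrightarrow> \<bar>v x\<bar> \<le> K"
  shows "integrable mu (\<lambda>x. \<bar>v x\<bar> powr p)"
  by (intro integrable_bounded[of _ "K powr p"]) (use assms p_pos in \<open>auto intro: powr_mono2\<close>)

lemma newton_lincomb:
  assumes u: "u \<in> newton_space M p S" and v: "v \<in> newton_space M p S"
  shows "(\<lambda>x. a * u x + b * v x) \<in> newton_space M p S"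
proof -
  from u obtain g where g: "upper_gradient S u g" "pen g < \<infinity>" by (rule newtonE)
  from v obtain h where h: "upper_gradient S v h" "pen h < \<infinity>" by (rule newtonE)
  note [measurable] = newton_measurable[OF u] newton_measurable[OF v]
    upper_gradient_measurable[OF g(1)] upper_gradient_measurable[OF h(1)]
  show ?thesis
  proof (rule newtonI)
    show "integrable mu (\<lambda>x. \<bar>a * u x + b * v x\<bar> powr p)"
    proof (rule Bochner_Integration.integrable_bound)
      show "integrable mu (\<lambda>x. 2 powr p * (\<bar>a\<bar> powr p * \<bar>u x\<bar> powr p + \<bar>b\<bar> powr p * \<bar>v x\<bar> powr p))"
        using newton_Lp[OF u] newton_Lp[OF v] by auto
      show "AE x in mu. norm (\<bar>a * u x + b * v x\<bar> powr p) \<le> norm (2 powr p * (\<bar>a\<bar> powr p * \<bar>u x\<bar> powr p + \<bar>b\<bar> powr p * \<bar>v x\<bar> powr p))"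
      proof (rule AE_I2)
        fix x
        show "norm (\<bar>a * u x + b * v x\<bar> powr p) \<le> norm (2 powr p * (\<bar>a\<bar> powr p * \<bar>u x\<bar> powr p + \<bar>b\<bar> powr p * \<bar>v x\<bar> powr p))"
          using powr_abs_add_le[OF p_pos(1), of "a * u x" "b * v x"] by (simp add: abs_mult powr_mult)
      qed
    qed measurable
    show "upper_gradient S (\<lambda>x. a * u x + b * v x) (\<lambda>x. ennreal \<bar>a\<bar> * g x + ennreal \<bar>b\<bar> * h x)"
      by (rule upper_gradient_lincomb[OF g(1) h(1)])
    have "pen (\<lambda>x. ennreal \<bar>a\<bar> * g x + ennreal \<bar>b\<bar> * h x)
        \<le> ennreal (2 powr p) * (ennreal (\<bar>a\<bar> powr p) * pen g + ennreal (\<bar>b\<bar> powr p) * pen h)"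
      using pen_add[of "\<lambda>x. ennreal \<bar>a\<bar> * g x" "\<lambda>x. ennreal \<bar>b\<bar> * h x"] by (simp add: pen_cmult)
    also have "\<dots> < \<infinity>" using g h by (simp add: ennreal_mult_less_top less_top)
    finally show "pen (\<lambda>x. ennreal \<bar>a\<bar> * g x + ennreal \<bar>b\<bar> * h x) < \<infinity>" .
  qed measurable
qed

lemma newton_diff: "u \<in> newton_space M p S \<Longrightarrow> v \<in> newton_space M p S \<Longrightarrow> (\<lambda>x. u x - v x) \<in> newton_space M p S"
  using newton_lincomb[of u v 1 "-1"] by simp

lemma newton_contract:
  assumes u: "u \<in> newton_space M p S" and v: "v \<in> borel_measurable mu" "integrable mu (\<lambda>x. \<bar>v x\<bar> powr p)"
    and c: "0 \<le> c" "\<And>x y. x \<in> S \<Longrightarrow> y \<in> S \<Longrightarrow> \<bar>v x - v y\<bar> \<le> c * \<bar>u x - u y\<bar>"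
  shows "v \<in> newton_space M p S"
proof -
  from u obtain g where g: "upper_gradient S u g" "pen g < \<infinity>" by (rule newtonE)
  have "pen (\<lambda>x. ennreal c * g x) < \<infinity>"
    using g pen_cmult[OF c(1) upper_gradient_measurable[OF g(1)]] by (simp add: ennreal_mult_less_top)
  then show ?thesis using v upper_gradient_contract[OF g(1) c] by (intro newtonI)
qed

lemma lipschitz_bounded:
  fixes u :: "'a \<Rightarrow> real"
  assumes "L-lipschitz_on S u" obtains K where "\<And>x. x \<in> S \<Longrightarrow> \<bar>u x\<bar> \<le> K"
proof -
  have "bounded (u ` S)"
    using compact_continuous_image[OF lipschitz_on_continuous_on[OF assms] compact_S] by (rule compact_imp_bounded)
  then show ?thesis using that unfolding bounded_iff by (metis imageI real_norm_def)
qed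

lemma pen_const: "pen (\<lambda>_. ennreal L) < \<infinity>"
proof -
  have "enn_powr (ennreal L) p < \<infinity>" by (auto simp: enn_powr_def)
  then show ?thesis
    unfolding pen_def by (simp add: ennreal_mult_eq_top_iff less_top[symmetric])
qed

lemma newton_lipschitz:
  fixes u :: "'a \<Rightarrow> real"
  assumes "L-lipschitz_on S u" shows "u \<in> newton_space M p S"
proof -
  have [measurable]: "u \<in> borel_measurable mu"
    using lipschitz_on_continuous_on[OF assms] by (rule continuous_on_imp_mu)
  obtain K where "\<And>x. x \<in> S \<Longrightarrow> \<bar>u x\<bar> \<le> K" using lipschitz_bounded[OF assms] by blast
  then show ?thesis
    by (intro newtonI[OF _ _ upper_gradient_lipschitz[OF assms] pen_const] Lp_bounded) auto
qed

lemma newton_const: "(\<lambda>_. c) \<in> newton_space M p S"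
  by (rule newton_lipschitz[of 0]) (auto simp: lipschitz_on_def)

text \<open>Combining functions of small energy into one function whose line integral is infinite
  wherever each of them has line integral bounded below.\<close>

lemma energy_blowup:
  assumes "\<And>e::real. 0 < e \<Longrightarrow> \<exists>\<rho>. Q \<rho> \<and> \<rho> \<in> borel_measurable borel \<and> pen \<rho> \<le> ennreal e"
    and e: "0 < (e::real)"
  shows "\<exists>R. R \<in> borel_measurable borel \<and> pen R \<le> ennreal e \<and>
     (\<forall>k::nat. \<exists>\<rho>. Q \<rho> \<and> \<rho> \<in> borel_measurable borel \<and> (\<forall>x. ennreal (real k) * \<rho> x \<le> R x))"
proof -
  \<comment> \<open>The denominator absorbs the dilation by \<open>k\<close> in the supremum, the
    powers of 1/2 make the energies add up to \<open>e\<close>, and the summand 1 covers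
    \<open>k = 0\<close>.\<close>
  define \<epsilon> where "\<epsilon> k = e * (1/2) ^ Suc k / (real k powr p + 1)" for k :: nat
  have \<epsilon>: "0 < \<epsilon> k" for k using e unfolding \<epsilon>_def
    by (intro divide_pos_pos mult_pos_pos) (auto intro: add_nonneg_pos)
  obtain \<rho> where \<rho>: "\<And>k. Q (\<rho> k)" "\<And>k. \<rho> k \<in> borel_measurable borel" "\<And>k. pen (\<rho> k) \<le> ennreal (\<epsilon> k)"
    using assms(1)[OF \<epsilon>] by metis
  note [measurable] = \<rho>(2)
  define R where "R x = (SUP k. ennreal (real k) * \<rho> k x)" for x
  have "pen R \<le> (\<Sum>k. pen (\<lambda>x. ennreal (real k) * \<rho> k x))"
    unfolding R_def by (rule pen_SUP) measurable
  also have "\<dots> \<le> (\<Sum>k. ennreal (e * (1/2) ^ Suc k))"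
  proof (intro suminf_le summableI)
    fix k
    have "pen (\<lambda>x. ennreal (real k) * \<rho> k x) = ennreal (real k powr p) * pen (\<rho> k)"
      by (rule pen_cmult) auto
    also have "\<dots> \<le> ennreal (real k powr p) * ennreal (\<epsilon> k)"
      by (intro mult_left_mono \<rho>) auto
    also have "\<dots> = ennreal (real k powr p * \<epsilon> k)" using \<epsilon>[of k] by (simp add: ennreal_mult)
    also have "real k powr p * \<epsilon> k = (real k powr p / (real k powr p + 1)) * (e * (1/2) ^ Suc k)"
      by (simp add: \<epsilon>_def)
    also have "\<dots> \<le> 1 * (e * (1/2) ^ Suc k)"
      using e by (intro mult_right_mono) (auto simp: divide_le_eq add_nonneg_pos)
    finally show "pen (\<lambda>x. ennreal (real k) * \<rho> k x) \<le> ennreal (e * (1/2) ^ Suc k)" by (simp add: ennreal_leI)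
  qed
  also have "\<dots> = ennreal e"
  proof -
    have "(\<lambda>k. e * (1/2) ^ Suc k) sums (e * 1)" by (intro sums_mult power_half_series)
    then show ?thesis using e by (intro suminf_ennreal_eq) auto
  qed
  finally have "pen R \<le> ennreal e" .
  moreover have "R \<in> borel_measurable borel" unfolding R_def by measurable
  moreover have "ennreal (real k) * \<rho> k x \<le> R x" for k x unfolding R_def by (intro SUP_upper) auto
  ultimately show ?thesis using \<rho> by blast
qed

lemma ennreal_unbounded_imp_top:
  fixes x y :: ennreal
  assumes "\<And>k::nat. ennreal (real k) * y \<le> x" "0 < y" shows "x = \<infinity>"
proof (rule ccontr)
  assume "x \<noteq> \<infinity>"
  then obtain r where r: "x = ennreal r" "0 \<le> r" by (cases x) auto
  have "y \<noteq> \<infinity>" using assms(1)[of 1] r by (auto simp: top_unique)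
  then obtain s where s: "y = ennreal s" "0 < s" using assms(2) by (cases y) auto
  obtain k where "r < real k * s" using s(2) by (metis ex_less_of_nat_mult)
  moreover have "real k * s \<le> r"
    using assms(1)[of k] r s by (simp add: ennreal_mult[symmetric])
  ultimately show False by simp
qed

text \<open>The exceptional curves have modulus zero, so \<open>energy_blowup\<close> yields a
  function of small energy with infinite line integral along all of them; adding it to
  \<open>g\<close> repairs the inequality there. The factor \<open>2 powr p\<close> is the price of
  \<open>pen_add\<close>.\<close>

lemma pweak_imp_upper_gradient:
  assumes "pweak_upper_gradient M p S u g" and e: "0 < (e::real)"
  shows "\<exists>h. upper_gradient S u h \<and> pen h \<le> ennreal (2 powr p) * pen g + ennreal e"
proof -
  define \<Gamma> where "\<Gamma> = {(\<gamma>, a, b). rectifiable_curve \<gamma> a b \<and> \<gamma> ` {a..b} \<subseteq> S \<and>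
        \<not> (ennreal \<bar>u (\<gamma> a) - u (\<gamma> b)\<bar> \<le> line_integral \<gamma> a b g)}"
  have g[measurable]: "g \<in> borel_measurable borel" and mod: "p_modulus M p S \<Gamma> = 0"
    using assms(1) unfolding pweak_upper_gradient_def \<Gamma>_def by auto
  let ?Q = "\<lambda>\<rho>. \<forall>(\<gamma>, a, b) \<in> \<Gamma>. 1 \<le> line_integral \<gamma> a b \<rho>"
  have ex: "\<exists>\<rho>. ?Q \<rho> \<and> \<rho> \<in> borel_measurable borel \<and> pen \<rho> \<le> ennreal d" if "0 < d" for d
  proof -
    have "p_modulus M p S \<Gamma> < ennreal d" using mod that by simp
    then show ?thesis unfolding p_modulus_def INF_less_iff nn_integral_mu pen_def[symmetric]
      by (auto dest: less_imp_le)
  qed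
  have "0 < e / 2 powr p" using e by simp
  from energy_blowup[of ?Q, OF ex this] obtain R where R[measurable]: "R \<in> borel_measurable borel"
    and Re: "pen R \<le> ennreal (e / 2 powr p)"
    and Rk: "\<And>k::nat. \<exists>\<rho>. ?Q \<rho> \<and> \<rho> \<in> borel_measurable borel \<and> (\<forall>x. ennreal (real k) * \<rho> x \<le> R x)"
    by auto
  have top: "line_integral \<gamma> a b R = \<infinity>" if "(\<gamma>, a, b) \<in> \<Gamma>" for \<gamma> a b
  proof (rule ennreal_unbounded_imp_top[where y=1])
    fix k :: nat
    obtain \<rho> where \<rho>: "?Q \<rho>" "\<rho> \<in> borel_measurable borel" "\<And>x. ennreal (real k) * \<rho> x \<le> R x"
      using Rk[of k] by blast
    have r: "rectifiable_curve \<gamma> a b" using that by (auto simp: \<Gamma>_def)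
    have "ennreal (real k) * 1 \<le> ennreal (real k) * line_integral \<gamma> a b \<rho>"
      using \<rho>(1) that by (intro mult_left_mono) auto
    also have "\<dots> = line_integral \<gamma> a b (\<lambda>x. ennreal (real k) * \<rho> x)"
      using line_integral_cmult[OF r \<rho>(2)] by simp
    also have "\<dots> \<le> line_integral \<gamma> a b R" by (intro line_integral_mono \<rho>)
    finally show "ennreal (real k) * 1 \<le> line_integral \<gamma> a b R" .
  qed simp
  have "upper_gradient S u (\<lambda>x. g x + R x)"
    unfolding upper_gradient_def
  proof (intro conjI allI impI; (elim conjE)?)
    fix \<gamma> a b assume r: "rectifiable_curve \<gamma> a b" "\<gamma> ` {a..b} \<subseteq> S"
    show "ennreal \<bar>u (\<gamma> a) - u (\<gamma> b)\<bar> \<le> line_integral \<gamma> a b (\<lambda>x. g x + R x)"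
    proof (cases "(\<gamma>, a, b) \<in> \<Gamma>")
      case True
      then show ?thesis using top r by (simp add: line_integral_add)
    next
      case False
      then have "ennreal \<bar>u (\<gamma> a) - u (\<gamma> b)\<bar> \<le> line_integral \<gamma> a b g" using r by (auto simp: \<Gamma>_def)
      also have "\<dots> \<le> line_integral \<gamma> a b (\<lambda>x. g x + R x)" by (intro line_integral_mono) auto
      finally show ?thesis .
    qed
  qed measurable
  moreover have "pen (\<lambda>x. g x + R x) \<le> ennreal (2 powr p) * (pen g + ennreal (e / 2 powr p))"
    using pen_add[OF g R] Re by (meson add_left_mono mult_left_mono order.trans zero_le)
  moreover have "\<dots> = ennreal (2 powr p) * pen g + ennreal e"
    using e by (simp add: distrib_left ennreal_mult[symmetric])
  ultimately show ?thesis by metis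
qed

lemma upper_gradient_imp_pweak:
  assumes "upper_gradient S u g" shows "pweak_upper_gradient M p S u g"
proof -
  have eq: "{(\<gamma>, a, b). rectifiable_curve \<gamma> a b \<and> \<gamma> ` {a..b} \<subseteq> S \<and>
        \<not> (ennreal \<bar>u (\<gamma> a) - u (\<gamma> b)\<bar> \<le> line_integral \<gamma> a b g)} = {}"
    using upper_gradientD[OF assms] by auto
  have "p_modulus M p S {} \<le> (\<integral>\<^sup>+ x\<in>S. enn_powr ((\<lambda>_. 0) x) p \<partial>M)"
    unfolding p_modulus_def by (intro INF_lower) auto
  then show ?thesis using assms unfolding pweak_upper_gradient_def eq
    by (simp add: upper_gradient_measurable)
qed

text \<open>On a curve whose ends have different values of \<open>u\<close>, every upper gradient
  has line integral at least the gap. As \<open>R\<close> dominates the \<open>k\<close>-fold of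
  some upper gradient for every \<open>k\<close>, its line integral exceeds every multiple of the
  gap.\<close>

lemma small_upper_gradients_imp_small_energy_barrier:
  assumes "\<And>e::real. 0 < e \<Longrightarrow> \<exists>h. upper_gradient S u h \<and> pen h \<le> ennreal e"
    and e: "0 < (e::real)"
  shows "\<exists>R. R \<in> borel_measurable borel \<and> pen R \<le> ennreal e \<and>
    (\<forall>\<gamma> a b. rectifiable_curve \<gamma> a b \<and> \<gamma> ` {a..b} \<subseteq> S \<and> u (\<gamma> a) \<noteq> u (\<gamma> b) \<longrightarrow> line_integral \<gamma> a b R = \<infinity>)"
proof -
  have "\<exists>h. upper_gradient S u h \<and> h \<in> borel_measurable borel \<and> pen h \<le> ennreal d" if "0 < d" for d
    using assms(1)[OF that] upper_gradient_measurable by blast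
  from energy_blowup[OF this e] obtain R where R: "R \<in> borel_measurable borel" "pen R \<le> ennreal e"
    and Rk: "\<And>k::nat. \<exists>\<rho>. upper_gradient S u \<rho> \<and> \<rho> \<in> borel_measurable borel \<and> (\<forall>x. ennreal (real k) * \<rho> x \<le> R x)"
    by auto
  have "line_integral \<gamma> a b R = \<infinity>"
    if r: "rectifiable_curve \<gamma> a b" "\<gamma> ` {a..b} \<subseteq> S" and ne: "u (\<gamma> a) \<noteq> u (\<gamma> b)" for \<gamma> a b
  proof (rule ennreal_unbounded_imp_top[where y="ennreal \<bar>u (\<gamma> a) - u (\<gamma> b)\<bar>"])
    fix k :: nat
    obtain \<rho> where \<rho>: "upper_gradient S u \<rho>" "\<rho> \<in> borel_measurable borel" "\<And>x. ennreal (real k) * \<rho> x \<le> R x"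
      using Rk[of k] by blast
    have "ennreal (real k) * ennreal \<bar>u (\<gamma> a) - u (\<gamma> b)\<bar> \<le> ennreal (real k) * line_integral \<gamma> a b \<rho>"
      by (intro mult_left_mono upper_gradientD[OF \<rho>(1) r]) auto
    also have "\<dots> = line_integral \<gamma> a b (\<lambda>x. ennreal (real k) * \<rho> x)"
      using line_integral_cmult[OF r(1) \<rho>(2)] by simp
    also have "\<dots> \<le> line_integral \<gamma> a b R" by (intro line_integral_mono \<rho>)
    finally show "ennreal (real k) * ennreal \<bar>u (\<gamma> a) - u (\<gamma> b)\<bar> \<le> line_integral \<gamma> a b R" .
  qed (use ne in simp)
  then show ?thesis using R by blast
qed

end

section \<open>Uniform convexity\<close>

text \<open>The mean value theorem with the strictly increasing derivative. The case
  \<open>t = 0\<close> is separate because the derivative of \<open>powr\<close> is used at positive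
  points only.\<close>

lemma powr_tangent_strict:
  fixes s t p :: real
  assumes p: "1 < p" and "0 < s" "0 \<le> t" "s \<noteq> t"
  shows "s powr p + p * s powr (p - 1) * (t - s) < t powr p"
proof (cases "t = 0")
  case True
  have "s powr (p - 1) * s = s powr p"
    using powr_mult_base[of s "p - 1"] assms by (simp add: mult.commute)
  then have "p * s powr (p - 1) * s = p * s powr p"
    by (metis mult.assoc)
  then have "p * s powr (p - 1) * (t - s) = - (p * s powr p)"
    using True by simp
  moreover have "s powr p < p * s powr p" using p assms by simp
  moreover have "t powr p = 0" using True by simp
  ultimately show ?thesis by linarith
next
  case False
  with assms have t: "0 < t" by simp
  have der: "((\<lambda>x. x powr p) has_real_derivative p * x powr (p - 1)) (at x)" if "0 < x" for x
    using has_real_derivative_powr[OF that, of p] .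
  show ?thesis
  proof (cases "s < t")
    case True
    obtain z where z: "s < z" "z < t" "t powr p - s powr p = (t - s) * (p * z powr (p - 1))"
      using MVT2[OF True, of "\<lambda>x. x powr p" "\<lambda>x. p * x powr (p - 1)"] der assms by auto
    have "s powr (p - 1) < z powr (p - 1)" using z assms by (intro powr_less_mono2) auto
    then have "(t - s) * (p * s powr (p - 1)) < (t - s) * (p * z powr (p - 1))" using True p
      by (intro mult_strict_left_mono) auto
    moreover have "p * s powr (p - 1) * (t - s) = (t - s) * (p * s powr (p - 1))" by (rule mult.commute)
    ultimately show ?thesis using z by linarith
  next
    case False
    then have ts: "t < s" using assms by simp
    obtain z where z: "t < z" "z < s" "s powr p - t powr p = (s - t) * (p * z powr (p - 1))"
      using MVT2[OF ts, of "\<lambda>x. x powr p" "\<lambda>x. p * x powr (p - 1)"] der t by auto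
    have "z powr (p - 1) < s powr (p - 1)" using z t p by (intro powr_less_mono2) auto
    then have "(s - t) * (p * z powr (p - 1)) < (s - t) * (p * s powr (p - 1))" using ts p by simp
    then show ?thesis using z by (simp add: algebra_simps)
  qed
qed

lemma powr_tangent:
  fixes s t p :: real
  assumes "1 < p" "0 \<le> s" "0 \<le> t"
  shows "s powr p + p * s powr (p - 1) * (t - s) \<le> t powr p"
  using powr_tangent_strict[of p s t] assms by (cases "s = 0 \<or> s = t") (auto intro: less_imp_le)

text \<open>The tangent inequality at the midpoint is applied to both ends, and the linear terms
  cancel.\<close>

lemma powr_midpoint_strict:
  fixes x y p :: real
  assumes p: "1 < p" and "0 \<le> x" "0 \<le> y" "x \<noteq> y"
  shows "((x + y) / 2) powr p < (x powr p + y powr p) / 2"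
proof -
  let ?m = "(x + y) / 2"
  have m: "0 < ?m" using assms by simp
  have "?m powr p + p * ?m powr (p - 1) * (x - ?m) < x powr p"
    "?m powr p + p * ?m powr (p - 1) * (y - ?m) < y powr p"
    using assms m by (intro powr_tangent_strict; simp)+
  moreover have "p * ?m powr (p - 1) * (x - ?m) + p * ?m powr (p - 1) * (y - ?m) = 0"
    by (simp add: distrib_left[symmetric])
  ultimately show ?thesis by simp
qed

lemma powr_midpoint_le:
  fixes x y p :: real
  assumes "1 < p" "0 \<le> x" "0 \<le> y"
  shows "((x + y) / 2) powr p \<le> (x powr p + y powr p) / 2"
  using powr_midpoint_strict[of p x y] assms by (cases "x = y") (auto intro: less_imp_le)

text \<open>Young's inequality with both constants replaced by 1: depending on whether
  \<open>y\<close> is below \<open>x powr (p - 1)\<close>, one of the two terms alone bounds the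
  product.\<close>

lemma young_weak:
  fixes x y p :: real
  assumes p: "1 < p" and "0 \<le> x" "0 \<le> y"
  shows "x * y \<le> x powr p + y powr (p / (p - 1))"
proof (cases "y \<le> x powr (p - 1)")
  case True
  then have "x * y \<le> x * x powr (p - 1)" using assms by (intro mult_left_mono) auto
  also have "\<dots> = x powr p" using powr_mult_base[of x "p - 1"] assms by simp
  finally show ?thesis by (smt (verit) powr_ge_zero)
next
  case False
  then have "x \<le> y powr (1 / (p - 1))"
  proof -
    have "(x powr (p - 1)) powr (1 / (p - 1)) \<le> y powr (1 / (p - 1))"
      using False p by (intro powr_mono2) auto
    then show ?thesis using assms by (simp add: powr_powr)
  qed
  then have "x * y \<le> y powr (1 / (p - 1)) * y" using assms by (intro mult_right_mono) auto
  also have "\<dots> = y powr (1 + 1 / (p - 1))" using powr_mult_base[of y "1 / (p - 1)"] assms by (simp add: mult.commute)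
  also have "1 + 1 / (p - 1) = p / (p - 1)" using p by (simp add: field_simps)
  finally show ?thesis by (smt (verit) powr_ge_zero)
qed

section \<open>Convexity and flux estimates in a single inner product space\<close>

locale inner_form =
  fixes B :: "'v::real_vector \<Rightarrow> 'v \<Rightarrow> real"
  assumes inner_prod: "inner_prod B"
begin

definition nm :: "'v \<Rightarrow> real" where "nm v = sqrt (B v v)"

lemma sym: "B v w = B w v" using inner_prod by (simp add: inner_prod_def)

lemma lin: "linear (\<lambda>v. B v w)" using inner_prod by (simp add: inner_prod_def)

lemma add_left: "B (v + w) z = B v z + B w z" using linear_add[OF lin] .
lemma scale_left: "B (a *\<^sub>R v) z = a * B v z" using linear_scale[OF lin] by simp
lemma add_right: "B z (v + w) = B z v + B z w" using add_left sym by metis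
lemma scale_right: "B z (a *\<^sub>R v) = a * B z v" using scale_left sym by metis
lemma diff_left: "B (v - w) z = B v z - B w z" using linear_diff[OF lin] .
lemma diff_right: "B z (v - w) = B z v - B z w" using diff_left sym by metis
lemma zero_left [simp]: "B 0 z = 0" using linear_0[OF lin] .
lemma zero_right [simp]: "B z 0 = 0" using zero_left sym by metis
lemma nonneg: "0 \<le> B v v" using inner_prod by (cases "v = 0") (auto simp: inner_prod_def less_imp_le)
lemma pos: "v \<noteq> 0 \<Longrightarrow> 0 < B v v" using inner_prod by (auto simp: inner_prod_def)

lemmas bil = add_left add_right scale_left scale_right diff_left diff_right

lemma nm_nonneg [simp]: "0 \<le> nm v" by (simp add: nm_def nonneg)
lemma nm_sq: "(nm v)\<^sup>2 = B v v" by (simp add: nm_def nonneg)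
lemma nm_zero_iff [simp]: "nm v = 0 \<longleftrightarrow> v = 0" using pos[of v] by (cases "v = 0") (auto simp: nm_def)
lemma nm_0 [simp]: "nm 0 = 0" by simp
lemma nm_scale: "nm (a *\<^sub>R v) = \<bar>a\<bar> * nm v"
  by (simp add: nm_def bil mult.assoc[symmetric] real_sqrt_mult power2_eq_square[symmetric])

lemma cauchy_schwarz_sq: "(B v w)\<^sup>2 \<le> B v v * B w w"
proof (cases "w = 0")
  case False
  then have w: "0 < B w w" by (rule pos)
  have "0 \<le> B (B w w *\<^sub>R v - B v w *\<^sub>R w) (B w w *\<^sub>R v - B v w *\<^sub>R w)" by (rule nonneg)
  also have "\<dots> = B w w * (B v v * B w w - (B v w)\<^sup>2)"
    by (simp add: bil sym[of w v] algebra_simps power2_eq_square)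
  finally show ?thesis using w by (simp add: zero_le_mult_iff)
qed simp

lemma cauchy_schwarz: "\<bar>B v w\<bar> \<le> nm v * nm w"
proof -
  have "\<bar>B v w\<bar> = sqrt ((B v w)\<^sup>2)" by simp
  also have "\<dots> \<le> sqrt (B v v * B w w)" by (intro real_sqrt_le_mono cauchy_schwarz_sq)
  finally show ?thesis by (simp add: nm_def real_sqrt_mult)
qed

lemma nm_triangle: "nm (v + w) \<le> nm v + nm w"
proof (rule power2_le_imp_le)
  have "(nm (v + w))\<^sup>2 = B v v + 2 * B v w + B w w" by (simp add: nm_sq bil sym[of w v])
  also have "\<dots> \<le> (nm v + nm w)\<^sup>2"
    using cauchy_schwarz[of v w] by (simp add: power2_sum nm_sq)
  finally show "(nm (v + w))\<^sup>2 \<le> (nm v + nm w)\<^sup>2" .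
qed simp

lemma nm_minus: "nm (- v) = nm v" using nm_scale[of "-1" v] by simp

lemma nm_triangle_diff: "nm (v - w) \<le> nm v + nm w"
  using nm_triangle[of v "- w"] by (simp add: nm_minus)

lemma flux_le:
  assumes "1 < p" shows "\<bar>nm v powr (p - 2) * B v w\<bar> \<le> nm v powr (p - 1) * nm w"
proof (cases "v = 0")
  case False
  then have "0 < nm v" by (simp add: less_le)
  have "\<bar>nm v powr (p - 2) * B v w\<bar> \<le> nm v powr (p - 2) * (nm v * nm w)"
    unfolding abs_mult using cauchy_schwarz by (intro mult_mono) auto
  also have "\<dots> = nm v powr (p - 1) * nm w"
    using powr_mult_base[of "nm v" "p - 2"] by (simp add: mult.assoc[symmetric] mult.commute)
  finally show ?thesis .
qed simp

text \<open>By Cauchy-Schwarz the linear term only grows when \<open>B v w\<close> is replaced by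
  the product of the norms, and what remains is the tangent line of \<open>t powr p\<close> at
  \<open>nm v\<close>. It carries both directions between weak solutions and minimizers.\<close>

lemma gradient_inequality:
  assumes p: "1 < p"
  shows "nm v powr p + p * (nm v powr (p - 2) * B v (w - v)) \<le> nm w powr p"
proof (cases "v = 0")
  case False
  then have v: "0 < nm v" by (simp add: less_le)
  have "nm v powr (p - 2) * B v (w - v) = nm v powr (p - 2) * B v w - nm v powr (p - 2) * (nm v * nm v)"
    by (simp add: bil nm_sq[symmetric] power2_eq_square right_diff_distrib)
  also have "\<dots> \<le> nm v powr (p - 1) * nm w - nm v powr (p - 1) * nm v"
  proof (intro diff_mono)
    show "nm v powr (p - 2) * B v w \<le> nm v powr (p - 1) * nm w"
      using flux_le[OF p, of v w] by linarith
    have "nm v * nm v powr (p - 2) = nm v powr (p - 1)" using powr_mult_base[of "nm v" "p - 2"] by simp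
    then show "nm v powr (p - 1) * nm v \<le> nm v powr (p - 2) * (nm v * nm v)"
      by (metis mult.assoc mult.commute order_refl)
  qed
  finally have "p * (nm v powr (p - 2) * B v (w - v)) \<le> p * (nm v powr (p - 1) * (nm w - nm v))"
    using p by (intro mult_left_mono) (auto simp: algebra_simps)
  then show ?thesis using powr_tangent[OF p, of "nm v" "nm w"] by (simp add: mult.assoc)
qed (use p in simp)

lemma nm_midpoint_powr:
  assumes "1 < p"
  shows "nm ((1/2) *\<^sub>R v + (1/2) *\<^sub>R w) powr p \<le> (nm v powr p + nm w powr p) / 2"
proof -
  have "nm ((1/2) *\<^sub>R v + (1/2) *\<^sub>R w) \<le> (nm v + nm w) / 2"
    using nm_triangle[of "(1/2) *\<^sub>R v" "(1/2) *\<^sub>R w"] by (simp add: nm_scale)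
  then have "nm ((1/2) *\<^sub>R v + (1/2) *\<^sub>R w) powr p \<le> ((nm v + nm w) / 2) powr p"
    using assms by (intro powr_mono2) auto
  also have "\<dots> \<le> (nm v powr p + nm w powr p) / 2" using assms by (intro powr_midpoint_le) auto
  finally show ?thesis .
qed

text \<open>At \<open>v = 0\<close> the exponent \<open>p - 2\<close> may be negative, so the
  factors cannot be treated separately; there the whole flux is bounded by a multiple of
  \<open>\<bar>t\<bar> powr (p - 1)\<close>. Elsewhere each factor is continuous.\<close>

lemma flux_perturbation_tendsto:
  assumes p: "1 < p"
  shows "((\<lambda>t. nm (v + t *\<^sub>R w) powr (p - 2) * B (v + t *\<^sub>R w) w) \<longlongrightarrow> nm v powr (p - 2) * B v w) (at 0)"
proof (cases "v = 0")
  case True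
  have "((\<lambda>t. (\<bar>t\<bar> * nm w) powr (p - 1) * nm w) \<longlongrightarrow> (\<bar>0\<bar> * nm w) powr (p - 1) * nm w) (at 0)"
    using p by (intro tendsto_intros) auto
  then have lim0: "((\<lambda>t. (\<bar>t\<bar> * nm w) powr (p - 1) * nm w) \<longlongrightarrow> 0) (at 0)" using p by simp
  have "\<forall>\<^sub>F t in at 0. norm (nm (v + t *\<^sub>R w) powr (p - 2) * B (v + t *\<^sub>R w) w) \<le> (\<bar>t\<bar> * nm w) powr (p - 1) * nm w"
    using flux_le[OF p, of "v + _ *\<^sub>R w" w] by (intro always_eventually) (simp add: True nm_scale)
  from Lim_null_comparison[OF this lim0] show ?thesis using True by simp
next
  case False
  then have v: "nm v > 0" by (simp add: less_le)
  have e: "nm (v + t *\<^sub>R w) = sqrt (B v v + 2 * t * B v w + t * t * B w w)" for t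
    by (simp add: nm_def bil sym[of w v] algebra_simps)
  have "((\<lambda>t. sqrt (B v v + 2 * t * B v w + t * t * B w w)) \<longlongrightarrow> sqrt (B v v + 2 * 0 * B v w + 0 * 0 * B w w)) (at 0)"
    by (intro tendsto_intros)
  then have 1: "((\<lambda>t. nm (v + t *\<^sub>R w)) \<longlongrightarrow> nm v) (at 0)" unfolding e by (simp add: nm_def)
  have "((\<lambda>t. B v w + t * B w w) \<longlongrightarrow> B v w + 0 * B w w) (at 0)" by (intro tendsto_intros)
  then have 2: "((\<lambda>t. B (v + t *\<^sub>R w) w) \<longlongrightarrow> B v w) (at 0)" by (simp add: bil)
  show ?thesis using v by (intro tendsto_intros 1 2) auto
qed

end

text \<open>A pair of vectors enters only through its Gram entries: \<open>a\<close> and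
  \<open>b\<close> are the squared norms, \<open>e\<close> is the inner product, and homogeneity
  allows \<open>a + b = 1\<close>. The admissible entries form a compact set on which the convexity
  defect is continuous and positive, and \<open>c\<close> is its minimum. It depends neither on the
  space nor on the inner product.\<close>

lemma uniform_convexity_constant:
  fixes p d :: real
  assumes p: "1 < p" and d: "0 < d"
  shows "\<exists>c>0. \<forall>a b e :: real. 0 \<le> a \<and> 0 \<le> b \<and> a + b = 1 \<and> e\<^sup>2 \<le> a * b \<and> d \<le> a + b - 2 * e \<longrightarrow>
     c \<le> (a powr (p/2) + b powr (p/2)) / 2 - ((a + b + 2 * e) / 4) powr (p/2)"
proof -
  define K :: "(real \<times> real \<times> real) set" where
    "K = {(a, b, e). 0 \<le> a \<and> 0 \<le> b \<and> a + b = 1 \<and> e\<^sup>2 \<le> a * b \<and> d \<le> a + b - 2 * e}"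
  define \<Psi> :: "real \<times> real \<times> real \<Rightarrow> real" where
    "\<Psi> x = (fst x powr (p/2) + fst (snd x) powr (p/2)) / 2 - ((fst x + fst (snd x) + 2 * snd (snd x)) / 4) powr (p/2)" for x
  have bnd: "\<bar>e\<bar> \<le> sqrt a * sqrt b" "sqrt a * sqrt b \<le> (a + b) / 2"
    if "0 \<le> a" "0 \<le> b" "e\<^sup>2 \<le> a * b" for a b e :: real
  proof -
    show "\<bar>e\<bar> \<le> sqrt a * sqrt b"
      using real_sqrt_le_mono[OF that(3)] by (simp add: real_sqrt_mult)
    show "sqrt a * sqrt b \<le> (a + b) / 2"
      using arith_geo_mean_sqrt[OF that(1,2)] by (simp add: real_sqrt_mult)
  qed
  have Kbox: "K \<subseteq> {0..1} \<times> {0..1} \<times> {-1..1}"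
  proof
    fix x assume "x \<in> K"
    moreover obtain a b e where x: "x = (a, b, e)" by (cases x)
    ultimately have "0 \<le> a" "0 \<le> b" "e\<^sup>2 \<le> a * b" "a + b = 1" by (auto simp: K_def)
    with bnd[of a b e] show "x \<in> {0..1} \<times> {0..1} \<times> {-1..1}" by (auto simp: x)
  qed
  have "closed K"
  proof -
    have "K = {x. 0 \<le> fst x} \<inter> {x. 0 \<le> fst (snd x)} \<inter> {x. fst x + fst (snd x) = 1}
       \<inter> {x. (snd (snd x))\<^sup>2 \<le> fst x * fst (snd x)} \<inter> {x. d \<le> fst x + fst (snd x) - 2 * snd (snd x)}"
      by (auto simp: K_def)
    also have "closed \<dots>" by (intro closed_Int closed_Collect_le closed_Collect_eq continuous_intros)
    finally show ?thesis .
  qed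
  moreover have "compact ({0..1::real} \<times> {0..1::real} \<times> {-1..1::real})"
    by (intro compact_Times compact_Icc)
  ultimately have "compact K" using Kbox by (metis compact_Int_closed inf.absorb_iff2)
  have cont: "continuous_on K \<Psi>"
  proof -
    have "0 \<le> fst x + fst (snd x) + 2 * snd (snd x)" if "x \<in> K" for x
      using that bnd[of "fst x" "fst (snd x)" "snd (snd x)"] by (auto simp: K_def)
    then show ?thesis
      unfolding \<Psi>_def using p
      by (intro continuous_intros continuous_on_powr' ballI conjI impI) (auto simp: K_def)
  qed
  have pos: "0 < \<Psi> x" if "x \<in> K" for x
  proof -
    obtain a b e where x: "x = (a, b, e)" by (cases x)
    have ab: "0 \<le> a" "0 \<le> b" "a + b = 1" "e\<^sup>2 \<le> a * b" "d \<le> a + b - 2 * e" using that x by (auto simp: K_def)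
    note bn = bnd[OF ab(1,2,4)]
    have pw: "y powr (p/2) = sqrt y powr p" if "0 \<le> y" for y
      using that by (simp add: powr_half_sqrt[symmetric] powr_powr)
    have sq: "((sqrt a + sqrt b) / 2)\<^sup>2 = (a + b + 2 * (sqrt a * sqrt b)) / 4"
      using ab by (simp add: power2_eq_square field_simps)
    have le: "sqrt ((a + b + 2 * e) / 4) \<le> (sqrt a + sqrt b) / 2"
      using bn ab by (intro real_le_lsqrt) (auto simp: sq)
    have "((a + b + 2 * e) / 4) powr (p/2) < (a powr (p/2) + b powr (p/2)) / 2"
    \<comment> \<open>For different norms the gap comes from strict convexity of the power; for
      equal norms it comes from \<open>d\<close>, which forces \<open>e < a\<close>.\<close>
    proof (cases "a = b")
      case False
      have "((a + b + 2 * e) / 4) powr (p/2) = sqrt ((a + b + 2 * e) / 4) powr p"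
        using bn ab by (intro pw) auto
      also have "\<dots> \<le> ((sqrt a + sqrt b) / 2) powr p"
        using le p bn ab by (intro powr_mono2) auto
      also have "\<dots> < (sqrt a powr p + sqrt b powr p) / 2"
        using False ab p by (intro powr_midpoint_strict) auto
      finally show ?thesis using ab by (simp add: pw)
    next
      case True
      then have "(a + b + 2 * e) / 4 < a" using ab d by (simp add: field_simps)
      then have "((a + b + 2 * e) / 4) powr (p/2) < a powr (p/2)"
        using bn ab p by (intro powr_less_mono2) auto
      then show ?thesis using True by simp
    qed
    then show ?thesis unfolding \<Psi>_def x by simp
  qed
  show ?thesis
  proof (cases "K = {}")
    case True
    then show ?thesis by (intro exI[of _ 1]) (auto simp: K_def)
  next
    case False
    obtain x where x: "x \<in> K" "\<And>y. y \<in> K \<Longrightarrow> \<Psi> x \<le> \<Psi> y"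
      using continuous_attains_inf[OF \<open>compact K\<close> False cont] by auto
    show ?thesis
    proof (intro exI[of _ "\<Psi> x"] conjI allI impI)
      fix a b e :: real
      assume "0 \<le> a \<and> 0 \<le> b \<and> a + b = 1 \<and> e\<^sup>2 \<le> a * b \<and> d \<le> a + b - 2 * e"
      then have "(a, b, e) \<in> K" by (auto simp: K_def)
      from x(2)[OF this] show "\<Psi> x \<le> (a powr (p/2) + b powr (p/2)) / 2 - ((a + b + 2 * e) / 4) powr (p/2)"
        by (simp add: \<Psi>_def)
    qed (rule pos[OF x(1)])
  qed
qed

text \<open>Either \<open>v - w\<close> is small compared with the norms, which gives the first
  term, or the normalized Gram entries lie in the compact set above and the norms themselves are
  bounded by the convexity defect. The inequality is linear in all the powers, so it can be
  integrated, and \<open>K\<close> is uniform in \<open>B\<close>, so it applies to inner products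
  varying with the point.\<close>

lemma uniform_convexity:
  fixes p \<epsilon> :: real
  assumes p: "1 < p" and \<epsilon>: "0 < \<epsilon>"
  shows "\<exists>K\<ge>0. \<forall>(B :: 'v::real_vector \<Rightarrow> 'v \<Rightarrow> real) v w. inner_prod B \<longrightarrow>
     sqrt (B (v - w) (v - w)) powr p \<le> \<epsilon> * (sqrt (B v v) powr p + sqrt (B w w) powr p)
       + K * ((sqrt (B v v) powr p + sqrt (B w w) powr p) / 2
              - sqrt (B ((1/2) *\<^sub>R v + (1/2) *\<^sub>R w) ((1/2) *\<^sub>R v + (1/2) *\<^sub>R w)) powr p)"
proof -
  \<comment> \<open>Chosen so that \<open>d powr (p/2)\<close> times the constant
    \<open>2 powr p\<close> from \<open>sP\<close> equals \<epsilon>.\<close>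
  define d where "d = (\<epsilon> / 2 powr p) powr (2/p)"
  have d: "0 < d" "d powr (p/2) = \<epsilon> / 2 powr p" using p \<epsilon> by (auto simp: d_def powr_powr)
  obtain c where c: "0 < c" and cc: "\<And>a b e :: real. 0 \<le> a \<Longrightarrow> 0 \<le> b \<Longrightarrow> a + b = 1 \<Longrightarrow> e\<^sup>2 \<le> a * b \<Longrightarrow> d \<le> a + b - 2 * e \<Longrightarrow>
     c \<le> (a powr (p/2) + b powr (p/2)) / 2 - ((a + b + 2 * e) / 4) powr (p/2)"
    using uniform_convexity_constant[OF p d(1)] by blast
  show ?thesis
  proof (intro exI[of _ "2 * 2 powr p / c"] conjI allI impI)
    show "0 \<le> 2 * 2 powr p / c" using c by simp
    fix B :: "'v \<Rightarrow> 'v \<Rightarrow> real" and v w assume "inner_prod B"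
    then interpret inner_form B by unfold_locales
    let ?q = "p / 2"
    define s where "s = B v v + B w w"
    let ?P = "nm v powr p + nm w powr p"
    let ?U = "?P / 2 - nm ((1/2) *\<^sub>R v + (1/2) *\<^sub>R w) powr p"
    have U0: "0 \<le> ?U" using nm_midpoint_powr[OF p, of v w] by simp
    have pw: "nm z powr p = B z z powr ?q" for z
      by (simp add: nm_def powr_half_sqrt[symmetric] powr_powr nonneg)
    have sP: "s powr ?q \<le> 2 powr p * ?P"
    proof -
      have "s \<le> 2 * max (B v v) (B w w)" by (simp add: s_def)
      \<comment> \<open>The factor 4 instead of 2 makes the resulting constant exactly
        \<open>2 powr p\<close>.\<close>
      also have "\<dots> \<le> 4 * max (B v v) (B w w)" using nonneg[of v] by (auto simp: max_def)
      finally have "s powr ?q \<le> (4 * max (B v v) (B w w)) powr ?q"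
        using p nonneg by (intro powr_mono2) (auto simp: s_def)
      also have "\<dots> = 4 powr ?q * max (B v v) (B w w) powr ?q"
        using nonneg[of v] by (simp add: powr_mult)
      also have "(4::real) powr ?q = 2 powr p"
        using powr_powr[of 2 2 ?q] by simp
      also have "max (B v v) (B w w) powr ?q \<le> ?P" by (auto simp: pw max_def)
      finally show ?thesis by simp
    qed
    have "nm (v - w) powr p \<le> \<epsilon> * ?P + 2 * 2 powr p / c * ?U"
    proof (cases "B (v - w) (v - w) \<le> d * s")
      case True
      have "nm (v - w) powr p \<le> (d * s) powr ?q"
        unfolding pw using True p nonneg by (intro powr_mono2) auto
      also have "\<dots> = d powr ?q * s powr ?q" using d nonneg by (simp add: powr_mult s_def)
      also have "\<dots> \<le> d powr ?q * (2 powr p * ?P)" by (intro mult_left_mono sP) auto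
      also have "\<dots> = \<epsilon> * ?P" by (simp add: d)
      also have "\<dots> \<le> \<epsilon> * ?P + 2 * 2 powr p / c * ?U" using U0 c by simp
      finally show ?thesis .
    next
      case False
      then have s0: "0 < s"
      proof -
        have "v = 0 \<and> w = 0" if "s = 0"
          using that nonneg[of v] nonneg[of w] pos[of v] pos[of w] unfolding s_def by fastforce
        then have "s \<noteq> 0" using False by auto
        moreover have "0 \<le> s" using nonneg[of v] nonneg[of w] by (simp add: s_def)
        ultimately show ?thesis by simp
      qed
      define a where "a = B v v / s"
      define b where "b = B w w / s"
      define e where "e = B v w / s"
      have ab: "0 \<le> a" "0 \<le> b" "a + b = 1" "e\<^sup>2 \<le> a * b" "d \<le> a + b - 2 * e"
      proof -
        show "0 \<le> a" "0 \<le> b" using s0 nonneg by (auto simp: a_def b_def)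
        have "a + b = s / s" unfolding a_def b_def add_divide_distrib[symmetric] by (simp add: s_def)
        then show "a + b = 1" using s0 by simp
        show "e\<^sup>2 \<le> a * b" using cauchy_schwarz_sq[of v w] s0
          by (simp add: a_def b_def e_def power2_eq_square divide_right_mono)
        have "B (v - w) (v - w) = s - 2 * B v w" by (simp add: s_def bil sym[of w v])
        then have "d * s \<le> s - 2 * B v w" using False by simp
        then have "d \<le> (s - 2 * B v w) / s" using s0 by (simp add: le_divide_eq)
        also have "\<dots> = a + b - 2 * e" unfolding \<open>a + b = 1\<close> using s0 by (simp add: e_def diff_divide_distrib)
        finally show "d \<le> a + b - 2 * e" .
      qed
      have m: "B ((1/2) *\<^sub>R v + (1/2) *\<^sub>R w) ((1/2) *\<^sub>R v + (1/2) *\<^sub>R w) = s * ((a + b + 2 * e) / 4)"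
        using s0 by (simp add: a_def b_def e_def bil sym[of w v] field_simps)
      have nn: "0 \<le> (a + b + 2 * e) / 4"
        using nonneg[of "(1/2) *\<^sub>R v + (1/2) *\<^sub>R w"] s0 unfolding m by (simp add: zero_le_mult_iff)
      have "?U = s powr ?q * ((a powr ?q + b powr ?q) / 2 - ((a + b + 2 * e) / 4) powr ?q)"
      proof -
        have Bv: "B v v = s * a" and Bw: "B w w = s * b" using s0 by (auto simp: a_def b_def)
        have 1: "nm v powr p = s powr ?q * a powr ?q" "nm w powr p = s powr ?q * b powr ?q"
          unfolding pw Bv Bw by (rule powr_mult)+
        have 2: "nm ((1/2) *\<^sub>R v + (1/2) *\<^sub>R w) powr p = s powr ?q * ((a + b + 2 * e) / 4) powr ?q"
          unfolding pw m by (rule powr_mult)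
        have "(X * y + X * z) / 2 - X * w = X * ((y + z) / 2 - w)" for X y z w :: real
          by (simp add: field_simps)
        then show ?thesis unfolding 1 2 .
      qed
      then have "s powr ?q * c \<le> ?U" using cc[OF ab] by (simp add: mult_left_mono)
      then have "s powr ?q \<le> ?U / c" using c by (simp only: pos_le_divide_eq)
      moreover have "?P \<le> 2 * s powr ?q"
      proof -
        have "B v v powr ?q \<le> s powr ?q" "B w w powr ?q \<le> s powr ?q"
          using p nonneg by (auto intro!: powr_mono2 simp: s_def)
        then show ?thesis by (simp add: pw)
      qed
      ultimately have "?P \<le> 2 * (?U / c)" by linarith
      have "nm (v - w) powr p \<le> (nm v + nm w) powr p"
        using nm_triangle_diff p by (intro powr_mono2) auto
      also have "\<dots> \<le> 2 powr p * ?P"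
        using powr_abs_add_le[of p "nm v" "nm w"] p by simp
      also have "\<dots> \<le> 2 powr p * (2 * (?U / c))"
        using \<open>?P \<le> 2 * (?U / c)\<close> by (intro mult_left_mono) auto
      also have "\<dots> = 2 * 2 powr p / c * ?U" by simp
      also have "\<dots> \<le> \<epsilon> * ?P + 2 * 2 powr p / c * ?U" using \<epsilon> by simp
      finally show ?thesis .
    qed
    then show "sqrt (B (v - w) (v - w)) powr p \<le> \<epsilon> * (sqrt (B v v) powr p + sqrt (B w w) powr p)
       + 2 * 2 powr p / c * ((sqrt (B v v) powr p + sqrt (B w w) powr p) / 2
              - sqrt (B ((1/2) *\<^sub>R v + (1/2) *\<^sub>R w) ((1/2) *\<^sub>R v + (1/2) *\<^sub>R w)) powr p)"
      by (simp only: nm_def)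
  qed
qed

section \<open>The Cheeger gradient\<close>

locale cheeger_space = newton_setting M p S
  for M :: "'a::metric_space measure" and p S +
  fixes D :: "('a \<Rightarrow> real) \<Rightarrow> 'a \<Rightarrow> real^'n" and ip :: "'a \<Rightarrow> real^'n \<Rightarrow> real^'n \<Rightarrow> real"
  assumes cheeger: "cheeger_structure M p S D ip"
begin

abbreviation NN :: "('a \<Rightarrow> real) set" where "NN \<equiv> newton_space M p S"

definition G :: "('a \<Rightarrow> real) \<Rightarrow> 'a \<Rightarrow> real" where "G u x = cnorm ip x (D u x)"

definition en :: "('a \<Rightarrow> real) \<Rightarrow> real" where "en u = (\<integral>x. G u x powr p \<partial>mu)"

lemma inner: "x \<in> S \<Longrightarrow> inner_form (ip x)"
  using cheeger unfolding cheeger_structure_def inner_form_def by blast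

lemma cnorm_nm: "x \<in> S \<Longrightarrow> cnorm ip x v = inner_form.nm (ip x) v"
  by (simp add: inner_form.nm_def[OF inner] cnorm_def)

lemma cnorm_nonneg [simp]: "x \<in> S \<Longrightarrow> 0 \<le> cnorm ip x v"
  by (simp add: cnorm_nm inner_form.nm_nonneg inner)

lemma G_nonneg [simp]: "x \<in> S \<Longrightarrow> 0 \<le> G u x"
  by (simp add: G_def)

lemma cnorm_triangle: "x \<in> S \<Longrightarrow> cnorm ip x (v + w) \<le> cnorm ip x v + cnorm ip x w"
  by (simp add: cnorm_nm inner_form.nm_triangle inner)

lemma cnorm_scale: "x \<in> S \<Longrightarrow> cnorm ip x (a *\<^sub>R v) = \<bar>a\<bar> * cnorm ip x v"
  by (simp add: cnorm_nm inner_form.nm_scale inner)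

lemma cnorm_zero [simp]: "x \<in> S \<Longrightarrow> cnorm ip x 0 = 0"
  by (simp add: cnorm_nm inner_form.nm_0 inner)

lemma cnorm_eq_0: "x \<in> S \<Longrightarrow> cnorm ip x v = 0 \<longleftrightarrow> v = 0"
  by (simp add: cnorm_nm inner_form.nm_zero_iff inner)

lemma cnorm_sum:
  assumes "finite A" "x \<in> S" shows "cnorm ip x (\<Sum>i\<in>A. v i) \<le> (\<Sum>i\<in>A. cnorm ip x (v i))"
  using assms(1)
proof (induction A rule: finite_induct)
  case (insert a F)
  then show ?case using cnorm_triangle[of x "v a" "\<Sum>i\<in>F. v i"] assms(2) by simp
qed (simp add: assms(2))

lemma D_measurable [measurable]: "u \<in> NN \<Longrightarrow> D u \<in> borel_measurable mu"
  using cheeger unfolding cheeger_structure_def borel_mu by blast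

lemma ip_const_measurable [measurable]: "(\<lambda>x. ip x v w) \<in> borel_measurable mu"
  using cheeger unfolding cheeger_structure_def borel_mu by blast

text \<open>The structure provides measurability of \<open>ip x v w\<close> for constant vectors;
  bilinearity reduces measurable vector fields to this by expansion in the standard basis.\<close>

lemma ip_measurable [measurable]:
  assumes [measurable]: "a \<in> borel_measurable mu" "b \<in> borel_measurable mu"
  shows "(\<lambda>x. ip x (a x) (b x)) \<in> borel_measurable mu"
proof -
  have "ip x (a x) (b x) = (\<Sum>i\<in>Basis. \<Sum>j\<in>Basis. (a x \<bullet> i) * ((b x \<bullet> j) * ip x i j))" if "x \<in> S" for x
  proof -
    interpret inner_form "ip x" using that by (rule inner)
    have lin2: "linear (ip x z)" for z
      by (rule linearI) (simp_all add: bil)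
    have "ip x (a x) (b x) = ip x (\<Sum>i\<in>Basis. (a x \<bullet> i) *\<^sub>R i) (\<Sum>j\<in>Basis. (b x \<bullet> j) *\<^sub>R j)"
      by (simp add: euclidean_representation)
    also have "\<dots> = (\<Sum>i\<in>Basis. (a x \<bullet> i) * ip x i (\<Sum>j\<in>Basis. (b x \<bullet> j) *\<^sub>R j))"
      by (simp add: linear_sum[OF lin] scale_left)
    also have "\<dots> = (\<Sum>i\<in>Basis. \<Sum>j\<in>Basis. (a x \<bullet> i) * ((b x \<bullet> j) * ip x i j))"
      by (simp add: linear_sum[OF lin2] scale_right sum_distrib_left)
    finally show ?thesis .
  qed
  then show ?thesis
    by (subst measurable_cong[where g="\<lambda>x. \<Sum>i\<in>Basis. \<Sum>j\<in>Basis. (a x \<bullet> i) * ((b x \<bullet> j) * ip x i j)"]) auto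
qed

lemma G_measurable [measurable]: "u \<in> NN \<Longrightarrow> G u \<in> borel_measurable mu"
  unfolding G_def[abs_def] cnorm_def by measurable

lemma pflux_measurable [measurable]: "u \<in> NN \<Longrightarrow> \<phi> \<in> NN \<Longrightarrow> pflux D ip p u \<phi> \<in> borel_measurable mu"
  unfolding pflux_def[abs_def] cnorm_def by measurable

lemma D_lincomb:
  assumes "u \<in> NN" "v \<in> NN"
  shows "AE x in mu. D (\<lambda>y. a * u y + b * v y) x = a *\<^sub>R D u x + b *\<^sub>R D v x"
  using cheeger assms unfolding cheeger_structure_def AE_mu by blast

lemma D_diff: "u \<in> NN \<Longrightarrow> v \<in> NN \<Longrightarrow> AE x in mu. D (\<lambda>y. u y - v y) x = D u x - D v x"
  using D_lincomb[of u v 1 "-1"] by simp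

lemma D_leibniz:
  assumes "u \<in> NN" "v \<in> NN" "(\<lambda>y. u y * v y) \<in> NN"
  shows "AE x in mu. D (\<lambda>y. u y * v y) x = u x *\<^sub>R D v x + v x *\<^sub>R D u x"
  using cheeger assms unfolding cheeger_structure_def AE_mu by blast

text \<open>Rewrites the comparison with the minimal weak upper gradient in terms of genuine upper
  gradients, which is the form in which limits and barriers are built. The slack \<open>e\<close> is
  the cost of passing from weak to genuine upper gradients.\<close>

lemma cheeger_const:
  "\<exists>C\<ge>1. \<forall>u\<in>NN. (\<forall>e>0. \<exists>h. upper_gradient S u h \<and>
        pen h \<le> ennreal C * (\<integral>\<^sup>+x. ennreal (G u x powr p) \<partial>mu) + ennreal e)
     \<and> (\<forall>h. upper_gradient S u h \<and> pen h < \<infinity> \<longrightarrow> (AE x in mu. ennreal (G u x) \<le> ennreal C * h x))"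
proof -
  obtain C where C1: "C \<ge> 1" and C: "\<And>u. u \<in> NN \<Longrightarrow> \<exists>g. min_pweak_upper_gradient M p S u g \<and>
        (AE x in mu. g x \<le> ennreal C * ennreal (G u x) \<and> ennreal (G u x) \<le> ennreal C * g x)"
    using cheeger unfolding cheeger_structure_def AE_mu G_def by blast
  let ?C = "2 powr p * C powr p"
  have CC: "C \<le> ?C" "1 \<le> ?C"
  proof -
    have "C powr 1 \<le> C powr p" using C1 p by (intro powr_mono) auto
    moreover have "(2::real) powr 0 \<le> 2 powr p" using p by (intro powr_mono) auto
    ultimately show "C \<le> ?C" using C1 mult_mono[of 1 "2 powr p" C "C powr p"] by simp
    then show "1 \<le> ?C" using C1 by linarith
  qed
  show ?thesis
  proof (intro exI[of _ ?C] conjI ballI allI impI CC; (elim conjE)?)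
    fix u and e :: real assume u: "u \<in> NN" and e: "0 < e"
    note [measurable] = u
    obtain g where g: "min_pweak_upper_gradient M p S u g"
      "AE x in mu. g x \<le> ennreal C * ennreal (G u x) \<and> ennreal (G u x) \<le> ennreal C * g x"
      using C[OF u] by blast
    have "pen g \<le> (\<integral>\<^sup>+x. ennreal (C powr p) * ennreal (G u x powr p) \<partial>mu)"
      unfolding pen_def
    proof (rule nn_integral_mono_AE)
      show "AE x in mu. enn_powr (g x) p \<le> ennreal (C powr p) * ennreal (G u x powr p)"
        using g(2) AE_space
      proof eventually_elim
        case (elim x)
        then have "enn_powr (g x) p \<le> enn_powr (ennreal C * ennreal (G u x)) p"
          using p by (intro enn_powr_mono) auto
        then show ?case using elim C1 p_pos by (simp add: enn_powr_cmult enn_powr_ennreal)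
      qed
    qed
    also have "\<dots> = ennreal (C powr p) * (\<integral>\<^sup>+x. ennreal (G u x powr p) \<partial>mu)"
      by (rule nn_integral_cmult) measurable
    finally have pg: "pen g \<le> ennreal (C powr p) * (\<integral>\<^sup>+x. ennreal (G u x powr p) \<partial>mu)" .
    obtain h where h: "upper_gradient S u h" "pen h \<le> ennreal (2 powr p) * pen g + ennreal e"
      using pweak_imp_upper_gradient[OF _ e] g(1) unfolding min_pweak_upper_gradient_def by blast
    have "pen h \<le> ennreal (2 powr p) * (ennreal (C powr p) * (\<integral>\<^sup>+x. ennreal (G u x powr p) \<partial>mu)) + ennreal e"
      using h(2) pg by (meson add_right_mono mult_left_mono order.trans zero_le)
    then have "pen h \<le> ennreal ?C * (\<integral>\<^sup>+x. ennreal (G u x powr p) \<partial>mu) + ennreal e"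
      by (simp add: ennreal_mult mult.assoc)
    then show "\<exists>h. upper_gradient S u h \<and> pen h \<le> ennreal ?C * (\<integral>\<^sup>+x. ennreal (G u x powr p) \<partial>mu) + ennreal e"
      using h(1) by blast
  next
    fix u h assume u: "u \<in> NN" and h: "upper_gradient S u h" "pen h < \<infinity>"
    obtain g where g: "min_pweak_upper_gradient M p S u g"
      "AE x in mu. g x \<le> ennreal C * ennreal (G u x) \<and> ennreal (G u x) \<le> ennreal C * g x"
      using C[OF u] by blast
    have "AE x in mu. g x \<le> h x"
      using g(1) upper_gradient_imp_pweak[OF h(1)] h(2)
      unfolding min_pweak_upper_gradient_def pen_def nn_integral_mu AE_mu by blast
    with g(2) show "AE x in mu. ennreal (G u x) \<le> ennreal ?C * h x"
    proof eventually_elim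
      case (elim x)
      then have "ennreal (G u x) \<le> ennreal C * h x" by (meson mult_left_mono order.trans zero_le)
      also have "\<dots> \<le> ennreal ?C * h x" using CC by (intro mult_right_mono ennreal_leI) auto
      finally show ?case .
    qed
  qed
qed

definition CC :: real where
  "CC = (SOME C. C\<ge>1 \<and> (\<forall>u\<in>NN. (\<forall>e>0. \<exists>h. upper_gradient S u h \<and>
        pen h \<le> ennreal C * (\<integral>\<^sup>+x. ennreal (G u x powr p) \<partial>mu) + ennreal e)
     \<and> (\<forall>h. upper_gradient S u h \<and> pen h < \<infinity> \<longrightarrow> (AE x in mu. ennreal (G u x) \<le> ennreal C * h x))))"

lemma CC_spec: "CC\<ge>1 \<and> (\<forall>u\<in>NN. (\<forall>e>0. \<exists>h. upper_gradient S u h \<and>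
        pen h \<le> ennreal CC * (\<integral>\<^sup>+x. ennreal (G u x powr p) \<partial>mu) + ennreal e)
     \<and> (\<forall>h. upper_gradient S u h \<and> pen h < \<infinity> \<longrightarrow> (AE x in mu. ennreal (G u x) \<le> ennreal CC * h x)))"
  unfolding CC_def by (rule someI_ex[OF cheeger_const])

lemma CC_ge_1: "1 \<le> CC" using CC_spec by blast

lemma G_le_upper_gradient:
  "u \<in> NN \<Longrightarrow> upper_gradient S u h \<Longrightarrow> pen h < \<infinity> \<Longrightarrow> AE x in mu. ennreal (G u x) \<le> ennreal CC * h x"
  using CC_spec by blast

lemma nn_energy_le:
  assumes u: "u \<in> NN" and h: "upper_gradient S u h" "pen h < \<infinity>"
  shows "(\<integral>\<^sup>+x. ennreal (G u x powr p) \<partial>mu) \<le> ennreal (CC powr p) * pen h"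
proof -
  note [measurable] = borel_imp_mu[OF upper_gradient_measurable[OF h(1)]]
  have "(\<integral>\<^sup>+x. ennreal (G u x powr p) \<partial>mu) \<le> (\<integral>\<^sup>+x. ennreal (CC powr p) * enn_powr (h x) p \<partial>mu)"
  proof (rule nn_integral_mono_AE)
    show "AE x in mu. ennreal (G u x powr p) \<le> ennreal (CC powr p) * enn_powr (h x) p"
      using G_le_upper_gradient[OF u h] AE_space
    proof eventually_elim
      case (elim x)
      have "enn_powr (ennreal (G u x)) p \<le> enn_powr (ennreal CC * h x) p"
        using elim p by (intro enn_powr_mono) auto
      then show ?case using elim CC_ge_1 p_pos by (simp add: enn_powr_cmult enn_powr_ennreal)
    qed
  qed
  also have "\<dots> = ennreal (CC powr p) * pen h" unfolding pen_def by (rule nn_integral_cmult) measurable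
  finally show ?thesis .
qed

lemma G_integrable: assumes u: "u \<in> NN" shows "integrable mu (\<lambda>x. G u x powr p)"
proof (rule integrableI_bounded)
  note [measurable] = u
  show "(\<lambda>x. G u x powr p) \<in> borel_measurable mu" by measurable
  obtain h where h: "upper_gradient S u h" "pen h < \<infinity>" using u by (rule newtonE)
  have "ennreal (CC powr p) * pen h < \<infinity>" using h by (simp add: ennreal_mult_less_top)
  then show "(\<integral>\<^sup>+x. ennreal (norm (G u x powr p)) \<partial>mu) < \<infinity>"
    using nn_energy_le[OF u h] by (simp add: le_less_trans)
qed

lemma en_nonneg: "0 \<le> en u"
  unfolding en_def by (rule integral_nonneg_AE) simp

lemma nn_energy_eq: "u \<in> NN \<Longrightarrow> (\<integral>\<^sup>+x. ennreal (G u x powr p) \<partial>mu) = ennreal (en u)"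
  unfolding en_def by (intro nn_integral_eq_integral G_integrable) auto

lemma en_le_pen: "u \<in> NN \<Longrightarrow> upper_gradient S u h \<Longrightarrow> pen h < \<infinity> \<Longrightarrow> ennreal (en u) \<le> ennreal (CC powr p) * pen h"
  using nn_energy_le nn_energy_eq by simp

lemma upper_gradient_energy:
  assumes "u \<in> NN" "0 < e"
  obtains h where "upper_gradient S u h" "pen h \<le> ennreal (CC * en u + e)"
proof -
  obtain h where h: "upper_gradient S u h" "pen h \<le> ennreal CC * ennreal (en u) + ennreal e"
    using CC_spec assms nn_energy_eq[OF assms(1)] by metis
  have "ennreal CC * ennreal (en u) + ennreal e = ennreal (CC * en u + e)"
    using CC_ge_1 en_nonneg[of u] assms by (simp add: ennreal_mult ennreal_plus)
  with h that show ?thesis by metis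
qed

lemma en_eq_0_iff: "u \<in> NN \<Longrightarrow> en u = 0 \<longleftrightarrow> (AE x in mu. D u x = 0)"
proof -
  assume u: "u \<in> NN"
  have "en u = 0 \<longleftrightarrow> (AE x in mu. G u x powr p = 0)"
    unfolding en_def by (intro integral_nonneg_eq_0_iff_AE G_integrable u) auto
  also have "\<dots> \<longleftrightarrow> (AE x in mu. D u x = 0)"
    by (intro AE_cong) (auto simp: G_def cnorm_eq_0)
  finally show ?thesis .
qed

lemma en_cong_AE:
  assumes "u \<in> NN" "v \<in> NN" "AE x in mu. D u x = D v x" shows "en u = en v"
proof -
  note [measurable] = assms(1,2)
  have "AE x in mu. G u x powr p = G v x powr p"
    using assms(3) by eventually_elim (simp add: G_def)
  then show ?thesis unfolding en_def by (intro integral_cong_AE) measurable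
qed

section \<open>The gradient depends only on the almost everywhere class\<close>

lemma energy_zero_barrier:
  assumes z: "z \<in> NN" and z0: "AE x in mu. z x = 0" and e: "0 < (e::real)"
  shows "\<exists>R. R \<in> borel_measurable borel \<and> pen R \<le> ennreal e \<and>
    (\<forall>\<gamma> a b. rectifiable_curve \<gamma> a b \<and> \<gamma> ` {a..b} \<subseteq> S \<and> max 0 (z (\<gamma> a)) \<noteq> max 0 (z (\<gamma> b)) \<longrightarrow> line_integral \<gamma> a b R = \<infinity>)"
proof -
  note [measurable] = newton_measurable[OF z]
  \<comment> \<open>The map \<open>s / (1 + s)\<close> is bounded, contracting and injective on
    nonnegative numbers: \<open>y\<close> is a bounded Newton function, hence so is its square, and
    \<open>y\<close> still determines \<open>max 0 (z x)\<close>.\<close>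
  define y where "y x = max 0 (z x) / (1 + max 0 (z x))" for x
  have ybd: "0 \<le> y x" "y x \<le> 1" for x by (auto simp: y_def divide_le_eq)
  have ym[measurable]: "y \<in> borel_measurable mu" unfolding y_def by measurable
  have th: "\<bar>s / (1 + s) - t / (1 + t)\<bar> \<le> \<bar>s - t\<bar>" if "0 \<le> s" "0 \<le> t" for s t :: real
  proof -
    have eq: "s / (1 + s) - t / (1 + t) = (s - t) / ((1 + s) * (1 + t))"
      using that by (simp add: diff_frac_eq algebra_simps)
    have "1 \<le> (1 + s) * (1 + t)" using that by (simp add: algebra_simps)
    then have "\<bar>s / (1 + s) - t / (1 + t)\<bar> * 1 \<le> \<bar>s / (1 + s) - t / (1 + t)\<bar> * ((1 + s) * (1 + t))"
      by (intro mult_left_mono) auto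
    also have "\<dots> = \<bar>s - t\<bar>" using that eq by (simp add: abs_mult)
    finally show ?thesis by simp
  qed
  have inj: "s = t" if "0 \<le> s" "0 \<le> t" "s / (1 + s) = t / (1 + t)" for s t :: real
  proof -
    have "s * (1 + t) = t * (1 + s)" using that by (simp add: frac_eq_eq)
    then show ?thesis by (simp add: algebra_simps)
  qed
  have lip: "\<bar>y a - y b\<bar> \<le> 1 * \<bar>z a - z b\<bar>" for a b
    using th[of "max 0 (z a)" "max 0 (z b)"] unfolding y_def by (auto simp: max_def split: if_splits)
  have y: "y \<in> NN"
    using lip ybd by (intro newton_contract[OF z ym Lp_bounded[OF ym, of 1], of 1]) auto
  have y2: "(\<lambda>x. y x * y x) \<in> NN"
  proof (rule newton_contract[OF y _ Lp_bounded[of _ 1], of _ 2])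
    fix a b
    have "\<bar>y a * y a - y b * y b\<bar> = (y a + y b) * \<bar>y a - y b\<bar>"
      using ybd[of a] ybd[of b] by (simp add: square_diff_square_factored abs_mult)
    also have "\<dots> \<le> 2 * \<bar>y a - y b\<bar>" using ybd[of a] ybd[of b] by (intro mult_right_mono) auto
    finally show "\<bar>y a * y a - y b * y b\<bar> \<le> 2 * \<bar>y a - y b\<bar>" .
  qed (use ybd in \<open>auto simp: abs_mult mult_le_one\<close>)
  \<comment> \<open>Both Leibniz terms carry the factor \<open>y\<close>, which is zero almost
    everywhere, whatever \<open>D y\<close> may be.\<close>
  have "AE x in mu. D (\<lambda>x. y x * y x) x = 0"
    using D_leibniz[OF y y y2] z0 by eventually_elim (simp add: y_def)
  then have "en (\<lambda>x. y x * y x) = 0" using en_eq_0_iff[OF y2] by simp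
  then have "\<exists>h. upper_gradient S (\<lambda>x. y x * y x) h \<and> pen h \<le> ennreal d" if "0 < d" for d
    using upper_gradient_energy[OF y2 that] by auto
  from small_upper_gradients_imp_small_energy_barrier[OF this e]
  obtain R where R: "R \<in> borel_measurable borel" "pen R \<le> ennreal e"
    "\<And>\<gamma> a b. rectifiable_curve \<gamma> a b \<Longrightarrow> \<gamma> ` {a..b} \<subseteq> S \<Longrightarrow> y (\<gamma> a) * y (\<gamma> a) \<noteq> y (\<gamma> b) * y (\<gamma> b) \<Longrightarrow> line_integral \<gamma> a b R = \<infinity>"
    by blast
  have "max 0 (z a) = max 0 (z b)" if "y a * y a = y b * y b" for a b
  proof -
    have "y a = y b" using that ybd by (metis power2_eq_square power2_eq_iff_nonneg)
    then show ?thesis unfolding y_def using inj[of "max 0 (z a)" "max 0 (z b)"] by simp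
  qed
  then show ?thesis using R by blast
qed

text \<open>By the Leibniz rule \<open>D (y\<^sup>2) = 2 y D y = 0\<close> for \<open>y\<close> a bounded function of \<open>z\<^sup>+\<close> (or \<open>z\<^sup>-\<close>); so
  \<open>y\<^sup>2\<close>, and with it \<open>z\<close>, is constant along almost every curve. This replaces the usual argument
  through absolute continuity along curves.\<close>

lemma D_eq_0_if_AE_0:
  assumes z: "z \<in> NN" and z0: "AE x in mu. z x = 0"
  shows "AE x in mu. D z x = 0"
proof -
  have z': "(\<lambda>x. - z x) \<in> NN" using newton_lincomb[OF z z, of "-1" 0] by simp
  have z0': "AE x in mu. - z x = 0" using z0 by eventually_elim simp
  have "en z \<le> e" if e: "0 < e" for e
  proof -
    \<comment> \<open>The factors compensate \<open>CC powr p\<close> from \<open>en_le_pen\<close>,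
      \<open>2 powr p\<close> from \<open>pen_add\<close> and the presence of two barriers.\<close>
    define d where "d = e / (CC powr p * 2 powr p * 2)"
    have d: "0 < d" using e CC_ge_1 by (auto simp: d_def)
    obtain R1 where R1: "R1 \<in> borel_measurable borel" "pen R1 \<le> ennreal d"
      "\<And>\<gamma> a b. rectifiable_curve \<gamma> a b \<Longrightarrow> \<gamma> ` {a..b} \<subseteq> S \<Longrightarrow> max 0 (z (\<gamma> a)) \<noteq> max 0 (z (\<gamma> b)) \<Longrightarrow> line_integral \<gamma> a b R1 = \<infinity>"
      using energy_zero_barrier[OF z z0 d] by blast
    obtain R2 where R2: "R2 \<in> borel_measurable borel" "pen R2 \<le> ennreal d"
      "\<And>\<gamma> a b. rectifiable_curve \<gamma> a b \<Longrightarrow> \<gamma> ` {a..b} \<subseteq> S \<Longrightarrow> max 0 (- z (\<gamma> a)) \<noteq> max 0 (- z (\<gamma> b)) \<Longrightarrow> line_integral \<gamma> a b R2 = \<infinity>"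
      using energy_zero_barrier[OF z' z0' d] by blast
    have ug: "upper_gradient S z (\<lambda>x. R1 x + R2 x)"
      unfolding upper_gradient_def
    proof (intro conjI allI impI; (elim conjE)?)
      show "(\<lambda>x. R1 x + R2 x) \<in> borel_measurable borel" using R1(1) R2(1) by measurable
      fix \<gamma> a b assume r: "rectifiable_curve \<gamma> a b" "\<gamma> ` {a..b} \<subseteq> S"
      show "ennreal \<bar>z (\<gamma> a) - z (\<gamma> b)\<bar> \<le> line_integral \<gamma> a b (\<lambda>x. R1 x + R2 x)"
      proof (cases "z (\<gamma> a) = z (\<gamma> b)")
        case False
        then have "max 0 (z (\<gamma> a)) \<noteq> max 0 (z (\<gamma> b)) \<or> max 0 (- z (\<gamma> a)) \<noteq> max 0 (- z (\<gamma> b))"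
          by (auto simp: max_def split: if_splits)
        then have "line_integral \<gamma> a b R1 = \<infinity> \<or> line_integral \<gamma> a b R2 = \<infinity>" using R1(3) R2(3) r by blast
        then show ?thesis using line_integral_add[OF r(1) R1(1) R2(1)] by auto
      qed simp
    qed
    have "pen (\<lambda>x. R1 x + R2 x) \<le> ennreal (2 powr p) * (ennreal d + ennreal d)"
      using pen_add[OF R1(1) R2(1)] R1(2) R2(2) by (meson add_mono mult_left_mono order.trans zero_le)
    also have "\<dots> = ennreal (2 powr p * (d + d))"
      using d by (simp add: ennreal_mult ennreal_plus[symmetric] del: ennreal_plus)
    finally have pR: "pen (\<lambda>x. R1 x + R2 x) \<le> ennreal (2 powr p * (d + d))" .
    then have "pen (\<lambda>x. R1 x + R2 x) < \<infinity>" by (simp add: le_less_trans)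
    from en_le_pen[OF z ug this] pR
    have "ennreal (en z) \<le> ennreal (CC powr p) * ennreal (2 powr p * (d + d))"
      by (meson mult_left_mono order.trans zero_le)
    also have "\<dots> = ennreal (CC powr p * (2 powr p * (d + d)))" using d by (simp add: ennreal_mult)
    also have "CC powr p * (2 powr p * (d + d)) = e" using CC_ge_1 by (simp add: d_def field_simps)
    finally show "en z \<le> e" using e by simp
  qed
  then have "en z = 0" using en_nonneg[of z] field_le_epsilon[of "en z" 0] by auto
  then show ?thesis using en_eq_0_iff[OF z] by simp
qed

lemma D_cong_AE:
  assumes "u \<in> NN" "v \<in> NN" "AE x in mu. u x = v x"
  shows "AE x in mu. D u x = D v x"
proof -
  have "AE x in mu. D (\<lambda>y. u y - v y) x = 0"
  proof (rule D_eq_0_if_AE_0[OF newton_diff[OF assms(1,2)]])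
    show "AE x in mu. u x - v x = 0" using assms(3) by eventually_elim simp
  qed
  with D_diff[OF assms(1,2)] show ?thesis by eventually_elim simp
qed

section \<open>Flux integrals\<close>

lemma pflux_le:
  "x \<in> S \<Longrightarrow> \<bar>pflux D ip p u \<phi> x\<bar> \<le> G u x powr (p - 1) * G \<phi> x"
  unfolding pflux_def G_def by (simp only: cnorm_nm inner_form.flux_le[OF inner p])

text \<open>The free weight \<open>s\<close> does the work of Hoelder's inequality: it can be fixed
  before the energy of \<phi> is sent to zero, see \<open>tendsto_zero_from_young\<close>.\<close>

lemma pflux_young:
  assumes x: "x \<in> S" and s: "0 < s"
  shows "\<bar>pflux D ip p u \<phi> x\<bar> \<le> s powr (- p) * G \<phi> x powr p + s powr (p / (p - 1)) * G u x powr p"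
proof -
  have "\<bar>pflux D ip p u \<phi> x\<bar> \<le> (G \<phi> x / s) * (s * G u x powr (p - 1))"
    using pflux_le[OF x, of u \<phi>] s by (simp add: mult.commute)
  also have "\<dots> \<le> (G \<phi> x / s) powr p + (s * G u x powr (p - 1)) powr (p / (p - 1))"
    using s x p by (intro young_weak) auto
  also have "\<dots> = s powr (- p) * G \<phi> x powr p + s powr (p / (p - 1)) * G u x powr p"
  proof -
    have "(p - 1) * (p / (p - 1)) = p" using p by simp
    moreover have "(G \<phi> x / s) powr p = s powr (- p) * G \<phi> x powr p"
      using s x by (simp add: powr_divide powr_minus_divide)
    ultimately show ?thesis using s by (simp add: powr_mult powr_powr)
  qed
  finally show ?thesis .
qed

lemma pflux_integrable:
  assumes u: "u \<in> NN" and \<phi>: "\<phi> \<in> NN" shows "integrable mu (pflux D ip p u \<phi>)"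
proof (rule Bochner_Integration.integrable_bound)
  show "integrable mu (\<lambda>x. G \<phi> x powr p + G u x powr p)"
    using G_integrable[OF u] G_integrable[OF \<phi>] by simp
  show "AE x in mu. norm (pflux D ip p u \<phi> x) \<le> norm (G \<phi> x powr p + G u x powr p)"
    using pflux_young[of _ 1 u \<phi>] by (intro AE_I2) (simp add: abs_of_nonneg)
qed (use u \<phi> in measurable)

lemma pflux_integral_le:
  assumes u: "u \<in> NN" and \<phi>: "\<phi> \<in> NN" and s: "0 < s"
  shows "\<bar>\<integral>x. pflux D ip p u \<phi> x \<partial>mu\<bar> \<le> s powr (- p) * en \<phi> + s powr (p / (p - 1)) * en u"
proof -
  have "\<bar>\<integral>x. pflux D ip p u \<phi> x \<partial>mu\<bar> \<le> (\<integral>x. \<bar>pflux D ip p u \<phi> x\<bar> \<partial>mu)"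
    by (rule integral_abs_bound)
  also have "\<dots> \<le> (\<integral>x. s powr (- p) * G \<phi> x powr p + s powr (p / (p - 1)) * G u x powr p \<partial>mu)"
    using pflux_integrable[OF u \<phi>] G_integrable[OF u] G_integrable[OF \<phi>] pflux_young[OF _ s]
    by (intro integral_mono) auto
  also have "\<dots> = s powr (- p) * en \<phi> + s powr (p / (p - 1)) * en u"
    unfolding en_def using G_integrable[OF u] G_integrable[OF \<phi>] by simp
  finally show ?thesis .
qed

lemma pflux_AE_linear:
  assumes "x \<in> S" "D \<psi> x = a *\<^sub>R D \<phi> x + b *\<^sub>R D \<theta> x"
  shows "pflux D ip p u \<psi> x = a * pflux D ip p u \<phi> x + b * pflux D ip p u \<theta> x"
proof -
  interpret inner_form "ip x" using assms(1) by (rule inner)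
  show ?thesis unfolding pflux_def assms(2) bil by (simp add: algebra_simps)
qed

lemma pflux_lincomb:
  assumes u: "u \<in> NN" and \<phi>: "\<phi> \<in> NN" and \<psi>: "\<psi> \<in> NN"
  shows "(\<integral>x. pflux D ip p u (\<lambda>y. a * \<phi> y + b * \<psi> y) x \<partial>mu)
     = a * (\<integral>x. pflux D ip p u \<phi> x \<partial>mu) + b * (\<integral>x. pflux D ip p u \<psi> x \<partial>mu)"
proof -
  note [measurable] = u \<phi> \<psi> newton_lincomb[OF \<phi> \<psi>]
  have "(\<integral>x. pflux D ip p u (\<lambda>y. a * \<phi> y + b * \<psi> y) x \<partial>mu)
     = (\<integral>x. a * pflux D ip p u \<phi> x + b * pflux D ip p u \<psi> x \<partial>mu)"
  proof (rule integral_cong_AE)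
    show "AE x in mu. pflux D ip p u (\<lambda>y. a * \<phi> y + b * \<psi> y) x = a * pflux D ip p u \<phi> x + b * pflux D ip p u \<psi> x"
      using D_lincomb[OF \<phi> \<psi>, of a b] AE_space by eventually_elim (simp add: pflux_AE_linear)
  qed measurable
  also have "\<dots> = a * (\<integral>x. pflux D ip p u \<phi> x \<partial>mu) + b * (\<integral>x. pflux D ip p u \<psi> x \<partial>mu)"
    using pflux_integrable[OF u \<phi>] pflux_integrable[OF u \<psi>] by simp
  finally show ?thesis .
qed

end

text \<open>The weight is fixed so that the \<open>c\<close> term is at most half the tolerance, and
  only afterwards \<open>b\<close> is small enough for the other half.\<close>

lemma tendsto_zero_from_young:
  fixes a b :: "nat \<Rightarrow> real"
  assumes p: "1 < p" and le: "\<And>k s. 0 < s \<Longrightarrow> \<bar>a k\<bar> \<le> s powr (- p) * b k + s powr (p / (p - 1)) * c"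
    and b: "b \<longlonglongrightarrow> 0"
  shows "a \<longlonglongrightarrow> 0"
proof (rule tendstoI)
  fix e :: real assume e: "0 < e"
  define q where "q = p / (p - 1)"
  have q: "0 < q" using p by (simp add: q_def)
  define s where "s = (e / (2 * (\<bar>c\<bar> + 1))) powr (1 / q)"
  have s: "0 < s" using e by (simp add: s_def)
  have "s powr q * c \<le> s powr q * (\<bar>c\<bar> + 1)" by (intro mult_left_mono) auto
  also have "s powr q * (\<bar>c\<bar> + 1) = e / 2" using q e by (simp add: s_def powr_powr field_simps)
  finally have sc: "s powr q * c \<le> e / 2" .
  have "(\<lambda>k. s powr (- p) * b k) \<longlonglongrightarrow> s powr (- p) * 0" by (intro tendsto_intros b)
  then have "\<forall>\<^sub>F k in sequentially. s powr (- p) * b k < e / 2"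
    by (rule order_tendstoD(2)) (use e in simp)
  then show "\<forall>\<^sub>F k in sequentially. dist (a k) 0 < e"
  proof eventually_elim
    case (elim k)
    then show ?case using le[OF s, of k] sc by (simp add: q_def dist_real_def)
  qed
qed

section \<open>Closure of the Newton space under weak limits\<close>

text \<open>Dyadic convex combinations. Closure under midpoints is all that uniform convexity asks
  of a convex hull, and induction over midpoints replaces handling of coefficients.\<close>

inductive_set mid_hull :: "('a \<Rightarrow> real) set \<Rightarrow> ('a \<Rightarrow> real) set" for W where
  base: "u \<in> W \<Longrightarrow> u \<in> mid_hull W"
| mid: "u \<in> mid_hull W \<Longrightarrow> v \<in> mid_hull W \<Longrightarrow> (\<lambda>x. (1/2) * u x + (1/2) * v x) \<in> mid_hull W"

lemma mid_hull_mono: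
  assumes "W \<subseteq> W'" shows "mid_hull W \<subseteq> mid_hull W'"
proof
  fix u assume "u \<in> mid_hull W"
  then show "u \<in> mid_hull W'"
  proof induction
    case (base u) then show ?case using assms by (blast intro: mid_hull.base)
  next
    case (mid u v) then show ?case by (intro mid_hull.mid)
  qed
qed

text \<open>An everywhere defined, measurable representative of an almost everywhere limit. It is
  meaningful for bounded sequences; an infinite limsup is sent to 0.\<close>

definition rlimsup :: "(nat \<Rightarrow> real) \<Rightarrow> real" where
  "rlimsup s = real_of_ereal (limsup (\<lambda>k. ereal (s k)))"

lemma limsup_bounded_real:
  assumes "\<And>k. \<bar>s k\<bar> \<le> K"
  shows "limsup (\<lambda>k. ereal (s k)) = ereal (rlimsup s)" "\<bar>rlimsup s\<bar> \<le> K"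
proof -
  have 1: "limsup (\<lambda>k. ereal (s k)) \<le> ereal K"
    using assms by (intro Limsup_bounded always_eventually allI) (auto simp: abs_le_iff)
  have 2: "ereal (- K) \<le> limsup (\<lambda>k. ereal (s k))"
    using assms by (intro le_Limsup always_eventually allI) (auto simp: abs_le_iff minus_le_iff)
  show eq: "limsup (\<lambda>k. ereal (s k)) = ereal (rlimsup s)"
    unfolding rlimsup_def using 1 2 by (cases "limsup (\<lambda>k. ereal (s k))") auto
  show "\<bar>rlimsup s\<bar> \<le> K" using 1 2 unfolding eq by auto
qed

lemma rlimsup_eq_lim: "s \<longlonglongrightarrow> l \<Longrightarrow> rlimsup s = l"
  unfolding rlimsup_def
  using lim_imp_Limsup[of sequentially "\<lambda>k. ereal (s k)" "ereal l"] by (simp add: lim_ereal)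

lemma rlimsup_le_add:
  assumes s: "\<And>k. \<bar>s k\<bar> \<le> K" and t: "\<And>k. \<bar>t k\<bar> \<le> K'" and le: "\<And>k. k \<ge> j \<Longrightarrow> s k \<le> t k + c"
  shows "rlimsup s \<le> rlimsup t + c"
proof -
  have "limsup (\<lambda>k. ereal (s k)) \<le> limsup (\<lambda>k. ereal (t k) + ereal c)"
    using le by (intro Limsup_mono) (auto simp: eventually_sequentially)
  also have "\<dots> = limsup (\<lambda>k. ereal (t k)) + ereal c"
    by (rule Limsup_add_ereal_right) auto
  finally show ?thesis
    unfolding limsup_bounded_real(1)[of s, OF s] limsup_bounded_real(1)[of t, OF t] by simp
qed

lemma rlimsup_measurable [measurable]:
  assumes [measurable]: "\<And>k. y k \<in> borel_measurable N"
  shows "(\<lambda>x. rlimsup (\<lambda>k. y k x)) \<in> borel_measurable N"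
  unfolding rlimsup_def by measurable

lemma upper_gradient_mono:
  assumes "upper_gradient S u g" "h \<in> borel_measurable borel" "\<And>x. x \<in> S \<Longrightarrow> g x \<le> h x"
  shows "upper_gradient S u h"
  unfolding upper_gradient_def
proof (intro conjI allI impI assms(2); (elim conjE)?)
  fix \<gamma> a b assume r: "rectifiable_curve \<gamma> a b" "\<gamma> ` {a..b} \<subseteq> S"
  have "ennreal \<bar>u (\<gamma> a) - u (\<gamma> b)\<bar> \<le> line_integral \<gamma> a b g" by (rule upper_gradientD[OF assms(1) r])
  also have "\<dots> \<le> line_integral \<gamma> a b h" using r assms(3) by (intro line_integral_mono) auto
  finally show "ennreal \<bar>u (\<gamma> a) - u (\<gamma> b)\<bar> \<le> line_integral \<gamma> a b h" .
qed

text \<open>Along a fixed curve the same bound holds for all \<open>k \<ge> j\<close>, so the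
  limsups at the two ends obey it as well; the sequences need not converge there. This is the reason
  for a limsup in place of an almost everywhere limit, which says nothing about individual
  curves.\<close>

lemma upper_gradient_rlimsup:
  assumes ug: "\<And>k. k \<ge> j \<Longrightarrow> upper_gradient S (\<lambda>x. y j x - y k x) h"
    and bd: "\<And>k x. x \<in> S \<Longrightarrow> \<bar>y k x\<bar> \<le> H x"
  shows "upper_gradient S (\<lambda>x. y j x - rlimsup (\<lambda>k. y k x)) h"
  unfolding upper_gradient_def
proof (intro conjI allI impI; (elim conjE)?)
  show "h \<in> borel_measurable borel" using upper_gradient_measurable[OF ug[of j]] by simp
  fix \<gamma> a b assume r: "rectifiable_curve \<gamma> a b" "\<gamma> ` {a..b} \<subseteq> S"
  define A where "A = \<gamma> a"
  define B where "B = \<gamma> b"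
  have AB: "A \<in> S" "B \<in> S" using curve_ends[OF r] by (auto simp: A_def B_def)
  show "ennreal \<bar>y j (\<gamma> a) - rlimsup (\<lambda>k. y k (\<gamma> a)) - (y j (\<gamma> b) - rlimsup (\<lambda>k. y k (\<gamma> b)))\<bar> \<le> line_integral \<gamma> a b h"
    unfolding A_def[symmetric] B_def[symmetric]
  proof (cases "line_integral \<gamma> a b h")
    case (real c)
    have le: "\<bar>y j A - y k A - (y j B - y k B)\<bar> \<le> c" if "k \<ge> j" for k
      using upper_gradientD[OF ug[OF that] r] real by (simp add: A_def B_def)
    have "rlimsup (\<lambda>k. y k A) \<le> rlimsup (\<lambda>k. y k B) + (y j A - y j B + c)"
      using le by (intro rlimsup_le_add[where K="H A" and K'="H B" and j=j] bd AB) (smt (verit))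
    moreover have "rlimsup (\<lambda>k. y k B) \<le> rlimsup (\<lambda>k. y k A) + (y j B - y j A + c)"
      using le by (intro rlimsup_le_add[where K="H B" and K'="H A" and j=j] bd AB) (smt (verit))
    ultimately have "\<bar>y j A - rlimsup (\<lambda>k. y k A) - (y j B - rlimsup (\<lambda>k. y k B))\<bar> \<le> c" by linarith
    then show "ennreal \<bar>y j A - rlimsup (\<lambda>k. y k A) - (y j B - rlimsup (\<lambda>k. y k B))\<bar> \<le> line_integral \<gamma> a b h"
      using real by (simp add: ennreal_leI)
  qed simp
qed

section \<open>Strong convergence of midpoint combinations\<close>

context cheeger_space
begin

lemma en_uniform_convexity:
  assumes \<epsilon>: "0 < (\<epsilon>::real)"
  obtains K where "0 \<le> K" "\<And>u v. u \<in> NN \<Longrightarrow> v \<in> NN \<Longrightarrow>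
    en (\<lambda>x. u x - v x) \<le> \<epsilon> * (en u + en v) + K * ((en u + en v) / 2 - en (\<lambda>x. (1/2) * u x + (1/2) * v x))"
proof -
  obtain K where K0: "0 \<le> K" and K: "\<And>(B :: real^'n \<Rightarrow> real^'n \<Rightarrow> real) v w. inner_prod B \<Longrightarrow>
     sqrt (B (v - w) (v - w)) powr p \<le> \<epsilon> * (sqrt (B v v) powr p + sqrt (B w w) powr p)
       + K * ((sqrt (B v v) powr p + sqrt (B w w) powr p) / 2
              - sqrt (B ((1/2) *\<^sub>R v + (1/2) *\<^sub>R w) ((1/2) *\<^sub>R v + (1/2) *\<^sub>R w)) powr p)"
    using uniform_convexity[OF p \<epsilon>] by blast
  show ?thesis
  proof (rule that[OF K0])
    fix u v assume u: "u \<in> NN" and v: "v \<in> NN"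
    let ?m = "\<lambda>x. (1/2) * u x + (1/2) * v x"
    have m: "?m \<in> NN" and d: "(\<lambda>x. u x - v x) \<in> NN"
      by (rule newton_lincomb[OF u v], rule newton_diff[OF u v])
    note int = G_integrable[OF u] G_integrable[OF v] G_integrable[OF m] G_integrable[OF d]
    have "en (\<lambda>x. u x - v x) \<le> (\<integral>x. \<epsilon> * (G u x powr p + G v x powr p) + K * ((G u x powr p + G v x powr p) / 2 - G ?m x powr p) \<partial>mu)"
      unfolding en_def
    proof (rule integral_mono_AE)
      show "AE x in mu. G (\<lambda>x. u x - v x) x powr p \<le> \<epsilon> * (G u x powr p + G v x powr p) + K * ((G u x powr p + G v x powr p) / 2 - G ?m x powr p)"
        using D_diff[OF u v] D_lincomb[OF u v, of "1/2" "1/2"] AE_space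
      proof eventually_elim
        case (elim x)
        then have "inner_prod (ip x)" using inner by (simp add: inner_form_def)
        from K[OF this, of "D u x" "D v x"] elim show ?case by (simp add: G_def cnorm_def)
      qed
    qed (use int in auto)
    also have "\<dots> = \<epsilon> * (en u + en v) + K * ((en u + en v) / 2 - en ?m)"
      using int unfolding en_def by simp
    finally show "en (\<lambda>x. u x - v x) \<le> \<epsilon> * (en u + en v) + K * ((en u + en v) / 2 - en ?m)" .
  qed
qed

lemma en_midpoint:
  assumes u: "u \<in> NN" and v: "v \<in> NN"
  shows "en (\<lambda>x. (1/2) * u x + (1/2) * v x) \<le> (en u + en v) / 2"
proof -
  let ?m = "\<lambda>x. (1/2) * u x + (1/2) * v x"
  have m: "?m \<in> NN" using u v by (rule newton_lincomb)
  note int = G_integrable[OF u] G_integrable[OF v] G_integrable[OF m]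
  have "en ?m \<le> (\<integral>x. (G u x powr p + G v x powr p) / 2 \<partial>mu)"
    unfolding en_def
  proof (rule integral_mono_AE)
    show "AE x in mu. G ?m x powr p \<le> (G u x powr p + G v x powr p) / 2"
      using D_lincomb[OF u v, of "1/2" "1/2"] AE_space
    proof eventually_elim
      case (elim x)
      then interpret inner_form "ip x" by (intro inner) simp
      show ?case using elim nm_midpoint_powr[OF p, of "D u x" "D v x"] by (simp add: G_def cnorm_nm)
    qed
  qed (use int in auto)
  then show ?thesis using int by (simp add: en_def)
qed

text \<open>The least energies \<open>m n\<close> over the hulls of the tails increase to a finite
  limit. Two nearly minimal elements of late hulls have a midpoint in a common hull, whose energy is
  not below \<open>m N\<close>; their convexity defect is then small, and uniform convexity makes
  their difference small.\<close>

lemma mid_hull_energy_cauchy: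
  fixes w :: "nat \<Rightarrow> 'a \<Rightarrow> real"
  assumes W: "\<And>k. w k \<in> NN" and B: "\<And>k. en (w k) \<le> B"
  obtains z where "\<And>n. z n \<in> mid_hull (w ` {n..})"
    "\<And>e. 0 < e \<Longrightarrow> \<exists>N. \<forall>i\<ge>N. \<forall>j\<ge>N. en (\<lambda>x. z i x - z j x) \<le> e"
proof -
  define K where "K n = mid_hull (w ` {n..})" for n
  have Kp: "z \<in> NN \<and> en z \<le> B" if "z \<in> K n" for z n
    using that unfolding K_def
  proof induction
    case (base u) then show ?case using W B by auto
  next
    case (mid u v)
    then show ?case using newton_lincomb[of u v "1/2" "1/2"] en_midpoint[of u v] by auto
  qed
  have Kmono: "K n' \<subseteq> K n" if "n \<le> n'" for n n' :: nat
    unfolding K_def using that by (intro mid_hull_mono image_mono) (auto intro: order.trans)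
  have Kw: "w n \<in> K n" for n unfolding K_def by (intro mid_hull.base) auto
  define m where "m n = Inf (en ` K n)" for n
  have bdd: "bdd_below (en ` K n)" for n by (intro bdd_belowI[of _ 0]) (auto simp: en_nonneg)
  have m_le: "m n \<le> en z" if "z \<in> K n" for z n
    unfolding m_def using that bdd by (intro cInf_lower) auto
  have mB: "m n \<le> B" for n using m_le[OF Kw[of n]] B[of n] by linarith
  have "incseq m"
  proof (rule incseq_SucI)
    fix n show "m n \<le> m (Suc n)"
      unfolding m_def using Kw[of "Suc n"] Kmono[of n "Suc n"] bdd[of n] by (intro cInf_superset_mono) auto
  qed
  then obtain L where L: "m \<longlonglongrightarrow> L" "\<And>n. m n \<le> L"
    using incseq_convergent[of m B] mB by blast
  have "\<exists>z\<in>K n. en z < m n + 1 / Suc n" for n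
  proof -
    have "Inf (en ` K n) < m n + 1 / Suc n" by (simp add: m_def)
    then show ?thesis using bdd[of n] Kw[of n] by (subst (asm) cInf_less_iff) auto
  qed
  then obtain z where z: "\<And>n. z n \<in> K n" "\<And>n. en (z n) < m n + 1 / Suc n" by metis
  show ?thesis
  proof (rule that)
    show "z n \<in> mid_hull (w ` {n..})" for n using z(1) by (simp add: K_def)
    fix e :: real assume e: "0 < e"
    have B0: "0 \<le> B" using B[of 0] en_nonneg[of "w 0"] by linarith
    define \<epsilon> where "\<epsilon> = e / (4 * (B + 1))"
    have \<epsilon>: "0 < \<epsilon>" "\<epsilon> * (B + B) \<le> e / 2" using e B0 by (auto simp: \<epsilon>_def field_simps)
    obtain C where C0: "0 \<le> C" and C: "\<And>u v. u \<in> NN \<Longrightarrow> v \<in> NN \<Longrightarrow>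
      en (\<lambda>x. u x - v x) \<le> \<epsilon> * (en u + en v) + C * ((en u + en v) / 2 - en (\<lambda>x. (1/2) * u x + (1/2) * v x))"
      using en_uniform_convexity[OF \<epsilon>(1)] by blast
    have "(\<lambda>n. C * ((L + 1 / Suc n) - m n)) \<longlonglongrightarrow> C * ((L + 0) - L)"
      by (intro tendsto_intros L LIMSEQ_Suc[OF lim_1_over_n])
    then have "\<forall>\<^sub>F n in sequentially. C * ((L + 1 / Suc n) - m n) < e / 2"
      by (rule order_tendstoD(2)) (use e in simp)
    then obtain N where N: "C * ((L + 1 / Suc N) - m N) < e / 2" by (auto simp: eventually_sequentially)
    have "en (\<lambda>x. z i x - z j x) \<le> e" if "i \<ge> N" "j \<ge> N" for i j
    proof -
      have ij: "z i \<in> K N" "z j \<in> K N" using Kmono that z(1) by blast+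
      then have "(\<lambda>x. (1/2) * z i x + (1/2) * z j x) \<in> K N" unfolding K_def by (rule mid_hull.mid)
      then have 1: "m N \<le> en (\<lambda>x. (1/2) * z i x + (1/2) * z j x)" by (rule m_le)
      have small: "en (z i) \<le> L + 1 / Suc N" if "i \<ge> N" for i
      proof -
        have "1 / real (Suc i) \<le> 1 / real (Suc N)" using that by (simp add: frac_le)
        then show ?thesis using z(2)[of i] L(2)[of i] by linarith
      qed
      have "(en (z i) + en (z j)) / 2 - en (\<lambda>x. (1/2) * z i x + (1/2) * z j x) \<le> (L + 1 / Suc N) - m N"
        using small[OF that(1)] small[OF that(2)] by (intro diff_mono 1) (simp add: field_simps)
      then have "C * ((en (z i) + en (z j)) / 2 - en (\<lambda>x. (1/2) * z i x + (1/2) * z j x)) \<le> C * ((L + 1 / Suc N) - m N)"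
        using C0 by (intro mult_left_mono)
      moreover have "\<epsilon> * (en (z i) + en (z j)) \<le> \<epsilon> * (B + B)"
        using Kp[OF ij(1)] Kp[OF ij(2)] \<epsilon> by (intro mult_left_mono) auto
      moreover have "en (\<lambda>x. z i x - z j x) \<le> \<epsilon> * (en (z i) + en (z j)) + C * ((en (z i) + en (z j)) / 2 - en (\<lambda>x. (1/2) * z i x + (1/2) * z j x))"
        using Kp[OF ij(1)] Kp[OF ij(2)] by (intro C) auto
      ultimately show ?thesis using N \<epsilon>(2) by linarith
    qed
    then show "\<exists>N. \<forall>i\<ge>N. \<forall>j\<ge>N. en (\<lambda>x. z i x - z j x) \<le> e" by blast
  qed
qed

text \<open>Along a fast subsequence the consecutive differences have upper gradients
  \<open>h i\<close> whose energies remain summable after dilation by \<open>2 ^ i\<close>. Their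
  dilated supremum \<open>R\<close> has finite energy, and telescoping gives the distance to the
  limsup the upper gradient \<open>2 * (1/2) ^ j * R\<close>. The limsup equals \<open>v\<close>
  almost everywhere, a difference that \<open>D\<close> does not see.\<close>

lemma energy_cauchy_limit:
  assumes z: "\<And>n. z n \<in> NN" and v: "v \<in> NN"
    and cauchy: "\<And>e. 0 < e \<Longrightarrow> \<exists>N. \<forall>i\<ge>N. \<forall>j\<ge>N. en (\<lambda>x. z i x - z j x) \<le> e"
    and lim: "AE x in mu. (\<lambda>n. z n x) \<longlonglongrightarrow> v x"
    and H: "H \<in> borel_measurable mu" "integrable mu (\<lambda>x. H x powr p)" and dom: "\<And>n x. x \<in> S \<Longrightarrow> \<bar>z n x\<bar> \<le> H x"
  obtains r where "strict_mono (r :: nat \<Rightarrow> nat)" "(\<lambda>j. en (\<lambda>x. z (r j) x - v x)) \<longlonglongrightarrow> 0"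
proof -
  \<comment> \<open>Half of the energy budget \<open>(1/2) ^ i / (2 ^ i) powr p\<close> for
    \<open>h i\<close>, divided by \<open>CC\<close>; the other half is the slack of
    \<open>upper_gradient_energy\<close>.\<close>
  define \<delta> where "\<delta> i = (1/2) ^ i / ((2 ^ i) powr p * (2 * CC))" for i :: nat
  have \<delta>: "0 < \<delta> i" for i using CC_ge_1 by (auto simp: \<delta>_def)
  have "\<exists>r. \<forall>i. (\<forall>a\<ge>r i. \<forall>b\<ge>r i. en (\<lambda>x. z a x - z b x) \<le> \<delta> i) \<and> r i < r (Suc i)"
  proof (rule dependent_nat_choice)
    show "\<exists>N. \<forall>a\<ge>N. \<forall>b\<ge>N. en (\<lambda>x. z a x - z b x) \<le> \<delta> 0" using cauchy[OF \<delta>] .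
    fix N n
    obtain N' where N': "\<forall>a\<ge>N'. \<forall>b\<ge>N'. en (\<lambda>x. z a x - z b x) \<le> \<delta> (Suc n)" using cauchy[OF \<delta>] by blast
    then show "\<exists>y. (\<forall>a\<ge>y. \<forall>b\<ge>y. en (\<lambda>x. z a x - z b x) \<le> \<delta> (Suc n)) \<and> N < y"
      by (intro exI[of _ "max N' (Suc N)"]) auto
  qed
  then obtain r where r: "\<And>i a b. a \<ge> r i \<Longrightarrow> b \<ge> r i \<Longrightarrow> en (\<lambda>x. z a x - z b x) \<le> \<delta> i" "\<And>i. r i < r (Suc i)"
    by blast
  have sm: "strict_mono r" using r(2) by (simp add: strict_mono_Suc_iff)
  define y where "y j = z (r j)" for j
  have y: "y j \<in> NN" for j using z by (simp add: y_def)
  have ydom: "\<bar>y j x\<bar> \<le> H x" if "x \<in> S" for j x using dom that by (simp add: y_def)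
  have "\<exists>h. upper_gradient S (\<lambda>x. y i x - y (Suc i) x) h \<and> pen h \<le> ennreal ((1/2) ^ i / (2 ^ i) powr p)" for i
  proof -
    have d0: "0 < (1/2) ^ i / ((2 ^ i) powr p * 2 :: real)" by simp
    obtain h where h: "upper_gradient S (\<lambda>x. y i x - y (Suc i) x) h"
      "pen h \<le> ennreal (CC * en (\<lambda>x. y i x - y (Suc i) x) + (1/2) ^ i / ((2 ^ i) powr p * 2))"
      using upper_gradient_energy[OF newton_diff[OF y[of i] y[of "Suc i"]] d0] by blast
    have "en (\<lambda>x. y i x - y (Suc i) x) \<le> \<delta> i"
      unfolding y_def using r(2)[of i] by (intro r(1)) auto
    then have "CC * en (\<lambda>x. y i x - y (Suc i) x) \<le> CC * \<delta> i" using CC_ge_1 by (intro mult_left_mono) auto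
    also have "\<dots> = (1/2) ^ i / ((2 ^ i) powr p * 2)" using CC_ge_1 by (simp add: \<delta>_def)
    finally have "CC * en (\<lambda>x. y i x - y (Suc i) x) + (1/2) ^ i / ((2 ^ i) powr p * 2) \<le> (1/2) ^ i / (2 ^ i) powr p"
      by simp
    then show ?thesis using h by (meson ennreal_leI order.trans)
  qed
  then obtain h where h: "\<And>i. upper_gradient S (\<lambda>x. y i x - y (Suc i) x) (h i)"
    "\<And>i. pen (h i) \<le> ennreal ((1/2) ^ i / (2 ^ i) powr p)" by metis
  note hm[measurable] = upper_gradient_measurable[OF h(1)]
  define R where "R x = (SUP i. ennreal (2 ^ i) * h i x)" for x
  have Rm[measurable]: "R \<in> borel_measurable borel" unfolding R_def by measurable
  have penR: "pen R < \<infinity>"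
  proof -
    have "pen R \<le> (\<Sum>i. pen (\<lambda>x. ennreal (2 ^ i) * h i x))"
      unfolding R_def by (rule pen_SUP) measurable
    also have "\<dots> \<le> (\<Sum>i. ennreal ((1/2) ^ i))"
    proof (intro suminf_le summableI)
      fix i
      have "pen (\<lambda>x. ennreal (2 ^ i) * h i x) = ennreal ((2 ^ i) powr p) * pen (h i)"
        by (rule pen_cmult) auto
      also have "\<dots> \<le> ennreal ((2 ^ i) powr p) * ennreal ((1/2) ^ i / (2 ^ i) powr p)"
        by (intro mult_left_mono h) auto
      also have "\<dots> = ennreal ((1/2) ^ i)" by (subst ennreal_mult[symmetric]) auto
      finally show "pen (\<lambda>x. ennreal (2 ^ i) * h i x) \<le> ennreal ((1/2) ^ i)" .
    qed
    also have "\<dots> = ennreal 2"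
    proof -
      have "(\<lambda>k. (1/2) ^ k) sums (1 / (1 - 1/2) :: real)" by (rule geometric_sums) simp
      then show ?thesis by (intro suminf_ennreal_eq) auto
    qed
    finally show ?thesis by (simp add: le_less_trans)
  qed
  have hR: "h i x \<le> ennreal ((1/2) ^ i) * R x" for i x
  proof -
    have "ennreal (2 ^ i) * h i x \<le> R x" unfolding R_def by (intro SUP_upper) auto
    then have "ennreal ((1/2) ^ i) * (ennreal (2 ^ i) * h i x) \<le> ennreal ((1/2) ^ i) * R x"
      by (rule mult_left_mono) simp
    moreover have "ennreal ((1/2) ^ i) * (ennreal (2 ^ i) * h i x) = h i x"
      by (simp add: mult.assoc[symmetric] ennreal_mult[symmetric] power_mult_distrib[symmetric])
    ultimately show ?thesis by simp
  qed
  \<comment> \<open>The coefficient is the finite geometric sum of \<open>(1/2) ^ i\<close> for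
    \<open>i\<close> from \<open>j\<close> to \<open>j + n - 1\<close>, written in closed
    form.\<close>
  have step: "upper_gradient S (\<lambda>x. y j x - y (j + n) x) (\<lambda>x. ennreal (2 * (1/2) ^ j - 2 * (1/2) ^ (j + n)) * R x)" for j n
  proof (induction n)
    case 0
    show ?case using upper_gradient_lipschitz[of 0 S "\<lambda>x. 0"] by (simp add: lipschitz_on_def)
  next
    case (Suc n)
    have "upper_gradient S (\<lambda>x. (y j x - y (j + n) x) + (y (j + n) x - y (Suc (j + n)) x))
      (\<lambda>x. ennreal (2 * (1/2) ^ j - 2 * (1/2) ^ (j + n)) * R x + h (j + n) x)"
      by (intro upper_gradient_add Suc h)
    then have "upper_gradient S (\<lambda>x. y j x - y (j + Suc n) x)
      (\<lambda>x. ennreal (2 * (1/2) ^ j - 2 * (1/2) ^ (j + n)) * R x + h (j + n) x)" by simp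
    then show ?case
    proof (rule upper_gradient_mono)
      fix x
      have nn: "0 \<le> 2 * (1/2) ^ j - 2 * (1/2::real) ^ (j + n)"
        by (simp add: power_decreasing)
      have "ennreal (2 * (1/2) ^ j - 2 * (1/2) ^ (j + n)) * R x + h (j + n) x
        \<le> ennreal (2 * (1/2) ^ j - 2 * (1/2) ^ (j + n)) * R x + ennreal ((1/2) ^ (j + n)) * R x"
        by (intro add_left_mono hR)
      also have "\<dots> = ennreal (2 * (1/2) ^ j - 2 * (1/2) ^ (j + n) + (1/2) ^ (j + n)) * R x"
        using nn by (simp add: distrib_right[symmetric] ennreal_plus[symmetric] del: ennreal_plus)
      also have "2 * (1/2) ^ j - 2 * (1/2) ^ (j + n) + (1/2) ^ (j + n) = 2 * (1/2) ^ j - 2 * (1/2::real) ^ (j + Suc n)"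
        by simp
      finally show "ennreal (2 * (1/2) ^ j - 2 * (1/2) ^ (j + n)) * R x + h (j + n) x
        \<le> ennreal (2 * (1/2) ^ j - 2 * (1/2) ^ (j + Suc n)) * R x" .
    qed measurable
  qed
  \<comment> \<open>The function \<open>v\<close> is known as a limit only almost everywhere and may
    violate the upper gradient inequality with \<open>R\<close> on single curves, so
    \<open>vs\<close> takes its place.\<close>
  define vs where "vs x = rlimsup (\<lambda>k. y k x)" for x
  have ug: "upper_gradient S (\<lambda>x. y j x - vs x) (\<lambda>x. ennreal (2 * (1/2) ^ j) * R x)" for j
    unfolding vs_def
  proof (rule upper_gradient_rlimsup[where H=H])
    fix k assume "j \<le> k"
    then obtain n where n: "k = j + n" using le_Suc_ex by blast
    show "upper_gradient S (\<lambda>x. y j x - y k x) (\<lambda>x. ennreal (2 * (1/2) ^ j) * R x)"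
      unfolding n
    proof (rule upper_gradient_mono[OF step])
      show "ennreal (2 * (1/2) ^ j - 2 * (1/2) ^ (j + n)) * R x \<le> ennreal (2 * (1/2) ^ j) * R x" for x
        by (intro mult_right_mono ennreal_leI) auto
    qed measurable
  qed (rule ydom)
  note ym[measurable] = newton_measurable[OF y]
  have vsm[measurable]: "vs \<in> borel_measurable mu" unfolding vs_def by measurable
  have vsH: "\<bar>vs x\<bar> \<le> H x" if "x \<in> S" for x
    unfolding vs_def using ydom[OF that] by (rule limsup_bounded_real(2))
  have penj: "pen (\<lambda>x. ennreal (2 * (1/2) ^ j) * R x) = ennreal ((2 * (1/2) ^ j) powr p) * pen R" for j
    by (rule pen_cmult) auto
  have yvs: "(\<lambda>x. y j x - vs x) \<in> NN" for j
  proof (rule newtonI[OF _ _ ug])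
    show "integrable mu (\<lambda>x. \<bar>y j x - vs x\<bar> powr p)"
    proof (rule Bochner_Integration.integrable_bound)
      show "integrable mu (\<lambda>x. 2 powr p * (H x powr p))" using H by simp
      show "AE x in mu. norm (\<bar>y j x - vs x\<bar> powr p) \<le> norm (2 powr p * (H x powr p))"
      proof (rule AE_I2)
        fix x assume "x \<in> space mu"
        then have "\<bar>y j x - vs x\<bar> \<le> 2 * H x" using ydom[of x j] vsH[of x] by simp
        then have "\<bar>y j x - vs x\<bar> powr p \<le> (2 * H x) powr p" using p by (intro powr_mono2) auto
        then show "norm (\<bar>y j x - vs x\<bar> powr p) \<le> norm (2 powr p * (H x powr p))" by (simp add: powr_mult)
      qed
    qed measurable
    show "pen (\<lambda>x. ennreal (2 * (1/2) ^ j) * R x) < \<infinity>"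
      using penR unfolding penj by (simp add: ennreal_mult_less_top)
  qed measurable
  have vsN: "vs \<in> NN" using newton_diff[OF y[of 0] yvs[of 0]] by simp
  have vsv: "AE x in mu. vs x = v x" using lim
  proof eventually_elim
    case (elim x)
    then have "(\<lambda>k. y k x) \<longlonglongrightarrow> v x" using LIMSEQ_subseq_LIMSEQ[OF elim sm] by (simp add: y_def o_def)
    then show ?case unfolding vs_def by (rule rlimsup_eq_lim)
  qed
  have en_eq: "en (\<lambda>x. y j x - v x) = en (\<lambda>x. y j x - vs x)" for j
  proof (rule en_cong_AE[OF newton_diff[OF y v] yvs])
    show "AE x in mu. D (\<lambda>x. y j x - v x) x = D (\<lambda>x. y j x - vs x) x"
    proof (rule D_cong_AE[OF newton_diff[OF y v] yvs])
      show "AE x in mu. y j x - v x = y j x - vs x" using vsv by eventually_elim simp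
    qed
  qed
  obtain P where P: "pen R = ennreal P" "0 \<le> P" using penR by (cases "pen R") auto
  have le: "en (\<lambda>x. y j x - v x) \<le> CC powr p * ((2 * (1/2) ^ j) powr p * P)" for j
  proof -
    have "ennreal (en (\<lambda>x. y j x - vs x)) \<le> ennreal (CC powr p) * (ennreal ((2 * (1/2) ^ j) powr p) * ennreal P)"
      using en_le_pen[OF yvs ug[of j]] unfolding penj P by (simp add: ennreal_mult_less_top)
    also have "\<dots> = ennreal (CC powr p * ((2 * (1/2) ^ j) powr p * P))" using P by (simp add: ennreal_mult)
    finally show ?thesis unfolding en_eq using P by simp
  qed
  have "(\<lambda>j. (2 * (1/2) ^ j :: real)) \<longlonglongrightarrow> 2 * 0"
    by (intro tendsto_mult tendsto_const LIMSEQ_power_zero) simp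
  then have l0: "(\<lambda>j. (2 * (1/2) ^ j :: real)) \<longlonglongrightarrow> 0" by simp
  have "(\<lambda>j. (2 * (1/2) ^ j :: real) powr p) \<longlonglongrightarrow> 0 powr p"
    using p by (intro tendsto_powr'[OF l0 tendsto_const]) auto
  then have "(\<lambda>j. CC powr p * ((2 * (1/2) ^ j) powr p * P)) \<longlonglongrightarrow> CC powr p * (0 powr p * P)"
    by (intro tendsto_mult tendsto_const)
  then have lim0: "(\<lambda>j. CC powr p * ((2 * (1/2) ^ j) powr p * P)) \<longlonglongrightarrow> 0" by simp
  have "(\<lambda>j. en (\<lambda>x. y j x - v x)) \<longlonglongrightarrow> 0"
    by (rule tendsto_sandwich[OF _ _ tendsto_const lim0]) (use le en_nonneg in auto)
  then show ?thesis using that[OF sm] by (simp add: y_def)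
qed

text \<open>A form of Mazur's lemma: bounded energy and almost everywhere convergence suffice for a
  functional that is continuous only for norm convergence. Midpoint combinations of the tails keep
  the value zero, the majorant \<open>H\<close> and the pointwise limit, while converging in energy;
  dominated convergence adds the integral part of the norm.\<close>

lemma mazur_closure:
  fixes w :: "nat \<Rightarrow> 'a \<Rightarrow> real"
  assumes w: "\<And>k. w k \<in> NN" and v: "v \<in> NN" and lim: "AE x in mu. (\<lambda>k. w k x) \<longlonglongrightarrow> v x"
    and H: "H \<in> borel_measurable mu" "integrable mu (\<lambda>x. H x powr p)" and dom: "\<And>k x. x \<in> S \<Longrightarrow> \<bar>w k x\<bar> \<le> H x"
    and B: "\<And>k. en (w k) \<le> B"
    and lin: "\<And>f g a b. f \<in> NN \<Longrightarrow> g \<in> NN \<Longrightarrow> \<Lambda> (\<lambda>x. a * f x + b * g x) = a * \<Lambda> f + b * (\<Lambda> g :: real)"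
    and cont: "\<And>z. (\<And>k. z k \<in> NN) \<Longrightarrow> (\<lambda>k. \<integral>x. \<bar>z k x\<bar> powr p \<partial>mu) \<longlonglongrightarrow> 0 \<Longrightarrow> (\<lambda>k. en (z k)) \<longlonglongrightarrow> 0 \<Longrightarrow> (\<lambda>k. \<Lambda> (z k)) \<longlonglongrightarrow> 0"
    and zero: "\<And>k. \<Lambda> (w k) = 0"
  shows "\<Lambda> v = 0"
proof -
  obtain z where zh: "\<And>n. z n \<in> mid_hull (w ` {n..})"
    and cauchy: "\<And>e. 0 < e \<Longrightarrow> \<exists>N. \<forall>i\<ge>N. \<forall>j\<ge>N. en (\<lambda>x. z i x - z j x) \<le> e"
    using mid_hull_energy_cauchy[of w B] w B by blast
  \<comment> \<open>The last clause says that an interval containing all tail values at a point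
    contains the value of the combination; it carries pointwise convergence from \<open>w\<close> to
    \<open>z\<close>.\<close>
  have hull: "u \<in> NN \<and> \<Lambda> u = 0 \<and> (\<forall>x\<in>S. \<bar>u x\<bar> \<le> H x) \<and> (\<forall>x e c. (\<forall>k\<ge>n. \<bar>w k x - c\<bar> \<le> e) \<longrightarrow> \<bar>u x - c\<bar> \<le> e)"
    if "u \<in> mid_hull (w ` {n..})" for u n
    using that
  proof induction
    case (base u)
    then show ?case using w zero dom by auto
  next
    case (mid f g)
    have "\<bar>1/2 * f x + 1/2 * g x\<bar> \<le> H x" if "x \<in> S" for x
    proof -
      have "\<bar>f x\<bar> \<le> H x" "\<bar>g x\<bar> \<le> H x" using mid that by auto
      then show ?thesis by linarith
    qed
    moreover have "\<bar>1/2 * f x + 1/2 * g x - c\<bar> \<le> e" if "\<forall>k\<ge>n. \<bar>w k x - c\<bar> \<le> e" for x e c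
    proof -
      have "\<bar>f x - c\<bar> \<le> e" "\<bar>g x - c\<bar> \<le> e" using mid that by blast+
      then show ?thesis by linarith
    qed
    ultimately show ?case using mid newton_lincomb[of f g "1/2" "1/2"] lin[of f g "1/2" "1/2"] by auto
  qed
  have z: "z n \<in> NN" "\<Lambda> (z n) = 0" "\<And>x. x \<in> S \<Longrightarrow> \<bar>z n x\<bar> \<le> H x" for n
    using hull[OF zh[of n]] by auto
  have zlim: "AE x in mu. (\<lambda>n. z n x) \<longlonglongrightarrow> v x" using lim
  proof eventually_elim
    case (elim x)
    show ?case
    proof (rule LIMSEQ_I)
      fix e :: real assume "0 < e"
      then obtain N where N: "\<And>k. k \<ge> N \<Longrightarrow> norm (w k x - v x) < e / 2"
        using LIMSEQ_D[OF elim, of "e/2"] by auto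
      have "norm (z n x - v x) < e" if "n \<ge> N" for n
      proof -
        have "\<bar>w k x - v x\<bar> \<le> e / 2" if "k \<ge> n" for k using N[of k] that \<open>n \<ge> N\<close> by auto
        then have "\<bar>z n x - v x\<bar> \<le> e / 2" using hull[OF zh[of n]] by blast
        then show ?thesis using \<open>0 < e\<close> by simp
      qed
      then show "\<exists>no. \<forall>n\<ge>no. norm (z n x - v x) < e" by blast
    qed
  qed
  obtain r where r: "strict_mono (r :: nat \<Rightarrow> nat)" and en0: "(\<lambda>j. en (\<lambda>x. z (r j) x - v x)) \<longlonglongrightarrow> 0"
    using energy_cauchy_limit[OF z(1) v cauchy zlim H z(3)] by blast
  note [measurable] = newton_measurable[OF z(1)] newton_measurable[OF v]
  have vH: "AE x in mu. \<bar>v x\<bar> \<le> H x" using zlim AE_space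
  proof eventually_elim
    case (elim x)
    then show ?case using z(3) by (intro LIMSEQ_le_const2[OF tendsto_rabs[OF elim(1)]]) auto
  qed
  have "(\<lambda>j. \<integral>x. \<bar>z (r j) x - v x\<bar> powr p \<partial>mu) \<longlonglongrightarrow> (\<integral>x. 0 \<partial>mu)"
  proof (rule integral_dominated_convergence)
    show "integrable mu (\<lambda>x. 2 powr p * (H x powr p))" using H by simp
    show "AE x in mu. (\<lambda>j. \<bar>z (r j) x - v x\<bar> powr p) \<longlonglongrightarrow> 0" using zlim
    proof eventually_elim
      case (elim x)
      have "(\<lambda>j. z (r j) x) \<longlonglongrightarrow> v x" using LIMSEQ_subseq_LIMSEQ[OF elim r] by (simp add: o_def)
      then have 1: "(\<lambda>j. \<bar>z (r j) x - v x\<bar>) \<longlonglongrightarrow> 0" by (simp add: LIM_zero tendsto_rabs_zero)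
      have "(\<lambda>j. \<bar>z (r j) x - v x\<bar> powr p) \<longlonglongrightarrow> 0 powr p"
        using p by (intro tendsto_powr'[OF 1 tendsto_const]) auto
      then show ?case by simp
    qed
    show "AE x in mu. norm (\<bar>z (r j) x - v x\<bar> powr p) \<le> 2 powr p * (H x powr p)" for j
      using vH AE_space
    proof eventually_elim
      case (elim x)
      then have "\<bar>z (r j) x - v x\<bar> \<le> 2 * H x" using z(3)[of x "r j"] by simp
      then have "\<bar>z (r j) x - v x\<bar> powr p \<le> (2 * H x) powr p" using p by (intro powr_mono2) auto
      then show ?case by (simp add: powr_mult)
    qed
  qed measurable
  then have "(\<lambda>j. \<Lambda> (\<lambda>x. z (r j) x - v x)) \<longlonglongrightarrow> 0"
    by (intro cont newton_diff z v en0) simp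
  moreover have "\<Lambda> (\<lambda>x. z (r j) x - v x) = - \<Lambda> v" for j
    using lin[OF z(1)[of "r j"] v, of 1 "-1"] z(2) by simp
  ultimately show ?thesis by (simp add: LIMSEQ_const_iff)
qed

end

section \<open>Doubling measures and the Poincare inequality\<close>

definition separated :: "real \<Rightarrow> 'a::metric_space set \<Rightarrow> bool" where
  "separated r A \<longleftrightarrow> (\<forall>a\<in>A. \<forall>b\<in>A. a \<noteq> b \<longrightarrow> r \<le> dist a b)"

text \<open>A separated set of largest cardinality is a net, since an uncovered point could be added
  to it. The bound \<open>n\<close> comes from compactness in one application and from doubling in
  the other.\<close>

lemma maximal_separated_net:
  assumes r: "0 < r" and card: "\<And>A. finite A \<Longrightarrow> A \<subseteq> T \<Longrightarrow> separated r A \<Longrightarrow> card A \<le> n"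
  obtains A where "finite A" "A \<subseteq> T" "separated r A" "T \<subseteq> (\<Union>a\<in>A. ball a r)"
proof -
  have "\<exists>A. (finite A \<and> A \<subseteq> T \<and> separated r A) \<and> (\<forall>B. finite B \<and> B \<subseteq> T \<and> separated r B \<longrightarrow> card B \<le> card A)"
    by (rule ex_has_greatest_nat[where k="{}" and b="Suc n"]) (use card in \<open>auto simp: separated_def less_Suc_eq_le\<close>)
  then obtain A where A: "finite A" "A \<subseteq> T" "separated r A"
    and max: "\<And>B. finite B \<Longrightarrow> B \<subseteq> T \<Longrightarrow> separated r B \<Longrightarrow> card B \<le> card A" by blast
  have "T \<subseteq> (\<Union>a\<in>A. ball a r)"
  proof (rule subsetI, rule ccontr)
    fix x assume x: "x \<in> T" "x \<notin> (\<Union>a\<in>A. ball a r)"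
    then have "separated r (insert x A)" using A(3) unfolding separated_def by (auto simp: not_less dist_commute)
    then have "card (insert x A) \<le> card A" using x A by (intro max) auto
    moreover have "x \<notin> A" using x r by auto
    ultimately show False using A(1) by simp
  qed
  then show ?thesis using that A by blast
qed

text \<open>Each ball of a finite cover by radius \<open>r/2\<close> holds at most one point of a
  separated set, which bounds the cardinality.\<close>

lemma compact_separated_net:
  assumes "compact (S :: 'a::metric_space set)" "0 < r" "T \<subseteq> S"
  obtains A where "finite A" "A \<subseteq> T" "separated r A" "T \<subseteq> (\<Union>a\<in>A. ball a r)"
proof -
  obtain F where F: "finite F" "S \<subseteq> (\<Union>x\<in>F. ball x (r/2))"
    using assms(1,2) unfolding compact_eq_totally_bounded by (meson half_gt_zero)
  have "card A \<le> card F" if A: "A \<subseteq> T" "separated r A" for A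
  proof -
    have "\<forall>a\<in>A. \<exists>x\<in>F. dist x a < r/2" using F A(1) assms(3) by (force simp: ball_def)
    then obtain h where h: "\<And>a. a \<in> A \<Longrightarrow> h a \<in> F \<and> dist (h a) a < r/2" by metis
    have "inj_on h A"
    proof (rule inj_onI, rule ccontr)
      fix a b assume ab: "a \<in> A" "b \<in> A" "h a = h b" "a \<noteq> b"
      have "dist a b \<le> dist (h a) a + dist (h a) b" by (rule dist_triangle3)
      then have "dist a b < r" using h[of a] h[of b] ab by simp
      then show False using A(2) ab unfolding separated_def by fastforce
    qed
    then show ?thesis using F(1) h by (intro card_inj_on_le[of h]) auto
  qed
  then show ?thesis using maximal_separated_net[OF assms(2), of T "card F"] that by blast
qed

lemma lipschitz_on_sum_ex:
  fixes f :: "'i \<Rightarrow> 'a::metric_space \<Rightarrow> real"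
  assumes "finite A" "\<And>a. a \<in> A \<Longrightarrow> \<exists>L. L-lipschitz_on S (f a)"
  shows "\<exists>L. L-lipschitz_on S (\<lambda>x. \<Sum>a\<in>A. c a * f a x)"
  using assms
proof (induction A rule: finite_induct)
  case empty
  show ?case by (intro exI[of _ 0]) (simp add: lipschitz_on_def)
next
  case (insert a A)
  then obtain L where L: "L-lipschitz_on S (\<lambda>x. \<Sum>a\<in>A. c a * f a x)" by auto
  obtain L' where L': "L'-lipschitz_on S (f a)" using insert by auto
  have "(\<bar>c a\<bar> * L')-lipschitz_on S (\<lambda>x. c a * f a x)"
    using lipschitz_on_cmult_real[OF L', of "c a"] by simp
  then show ?case using lipschitz_on_add[OF _ L] insert by auto
qed

context cheeger_space
begin

lemma D_sum:
  assumes "finite A" "\<And>a. a \<in> A \<Longrightarrow> f a \<in> NN"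
  shows "(\<lambda>x. \<Sum>a\<in>A. c a * f a x) \<in> NN \<and>
    (AE x in mu. D (\<lambda>x. \<Sum>a\<in>A. c a * f a x) x = (\<Sum>a\<in>A. c a *\<^sub>R D (f a) x))"
  using assms
proof (induction A rule: finite_induct)
  case empty
  then show ?case using newton_const[of 0] D_eq_0_if_AE_0[OF newton_const[of 0]] by simp
next
  case (insert a A)
  let ?g = "\<lambda>x. \<Sum>a\<in>A. c a * f a x"
  have g: "?g \<in> NN" "AE x in mu. D ?g x = (\<Sum>a\<in>A. c a *\<^sub>R D (f a) x)" and fa: "f a \<in> NN"
    using insert by auto
  have "(\<lambda>x. c a * f a x + 1 * ?g x) \<in> NN" by (rule newton_lincomb[OF fa g(1)])
  moreover have "AE x in mu. D (\<lambda>x. c a * f a x + 1 * ?g x) x = c a *\<^sub>R D (f a) x + (\<Sum>a\<in>A. c a *\<^sub>R D (f a) x)"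
    using D_lincomb[OF fa g(1), of "c a" 1] g(2) by eventually_elim simp
  ultimately show ?case using insert(1,2) by simp
qed

lemma G_lipschitz:
  assumes "L-lipschitz_on S f" shows "AE x in mu. G f x \<le> CC * L"
proof -
  have L: "0 \<le> L" using assms by (rule lipschitz_on_nonneg)
  have "AE x in mu. ennreal (G f x) \<le> ennreal CC * ennreal L"
    by (rule G_le_upper_gradient[OF newton_lipschitz[OF assms] upper_gradient_lipschitz[OF assms] pen_const])
  then show ?thesis using AE_space
  proof eventually_elim
    case (elim x)
    then show ?case using L CC_ge_1 by (simp add: ennreal_mult[symmetric])
  qed
qed

lemma D_const: "AE x in mu. D (\<lambda>_. c) x = 0"
proof -
  have l: "0-lipschitz_on S (\<lambda>_. c)" by (simp add: lipschitz_on_def)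
  show ?thesis using G_lipschitz[OF l] AE_space
  proof eventually_elim
    case (elim x)
    then have "G (\<lambda>_. c) x = 0" by (intro antisym) auto
    then show ?case using elim by (simp add: G_def cnorm_eq_0)
  qed
qed

text \<open>Locality of the gradient, read off from the Leibniz rule for \<open>\<theta> = \<theta> \<zeta>\<close> with a cutoff \<open>\<zeta>\<close>.\<close>

lemma D_eq_0_off_cutoff:
  assumes t: "\<theta> \<in> NN" and z: "\<zeta> \<in> NN" and eq: "\<And>x. \<theta> x * \<zeta> x = \<theta> x"
  shows "AE x in mu. \<zeta> x \<noteq> 1 \<longrightarrow> D \<theta> x = 0"
proof -
  have "(\<lambda>x. \<theta> x * \<zeta> x) = \<theta>" using eq by auto
  then have "AE x in mu. D \<theta> x = \<theta> x *\<^sub>R D \<zeta> x + \<zeta> x *\<^sub>R D \<theta> x"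
    using D_leibniz[OF t z] t by simp
  then show ?thesis
  proof eventually_elim
    case (elim x)
    show ?case
    proof
      assume "\<zeta> x \<noteq> 1"
      then have "\<theta> x = 0" using eq[of x] by simp
      then have "(1 - \<zeta> x) *\<^sub>R D \<theta> x = 0" using elim by (simp add: scaleR_diff_left)
      then show "D \<theta> x = 0" using \<open>\<zeta> x \<noteq> 1\<close> by simp
    qed
  qed
qed

end

section \<open>Bounded overlap of balls and the Poincare inequality for real integrals\<close>

locale pi_space = cheeger_space M p S D ip
  for M :: "'a::metric_space measure" and p S and D :: "('a \<Rightarrow> real) \<Rightarrow> 'a \<Rightarrow> real^'n" and ip +
  assumes doubling: "doubling_on M S" and poincare: "poincare_on M p S"
begin

abbreviation BS :: "'a \<Rightarrow> real \<Rightarrow> 'a set" where "BS x r \<equiv> ball x r \<inter> S"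

definition m :: "'a \<Rightarrow> real \<Rightarrow> real" where "m x r = measure mu (BS x r)"

lemma BS_sets [measurable]: "BS x r \<in> sets mu"
  unfolding sets_mu by (auto simp: sets_restrict_space)

lemma emeasure_BS: "emeasure M (BS x r) = ennreal (m x r)"
  unfolding m_def using emeasure_mu[of "ball x r"] by (simp add: emeasure_eq_measure)

lemma measure_BS: "measure M (BS x r) = m x r"
  using emeasure_BS[of x r] by (simp add: measure_def m_def)

lemma m_nonneg [simp]: "0 \<le> m x r" by (simp add: m_def)

lemma m_mono: "BS x r \<subseteq> BS y s \<Longrightarrow> m x r \<le> m y s"
  unfolding m_def by (intro finite_measure_mono) auto

lemma m_pos: assumes "x \<in> S" "0 < r" shows "0 < m x r"
proof -
  have "0 < emeasure M (BS x (2 * (r/2)))"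
    using doubling assms unfolding doubling_on_def by (metis half_gt_zero)
  then show ?thesis by (simp add: emeasure_BS)
qed

definition Cd :: real where
  "Cd = (SOME C. 1 \<le> C \<and> (\<forall>x\<in>S. \<forall>r>0. m x (2 * r) \<le> C * m x r))"

lemma Cd_spec: "1 \<le> Cd \<and> (\<forall>x\<in>S. \<forall>r>0. m x (2 * r) \<le> Cd * m x r)"
  unfolding Cd_def
proof (rule someI_ex)
  obtain C where C: "\<And>x r. x \<in> S \<Longrightarrow> 0 < r \<Longrightarrow> emeasure M (BS x (2*r)) \<le> ennreal C * emeasure M (BS x r)"
    using doubling unfolding doubling_on_def by blast
  have "m x (2 * r) \<le> max 1 C * m x r" if "x \<in> S" "0 < r" for x r
  proof -
    have "ennreal (m x (2*r)) \<le> ennreal C * ennreal (m x r)" using C[OF that] by (simp add: emeasure_BS)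
    also have "\<dots> \<le> ennreal (max 1 C) * ennreal (m x r)" by (intro mult_right_mono ennreal_leI) auto
    finally show ?thesis by (simp add: ennreal_mult[symmetric])
  qed
  then show "\<exists>C. 1 \<le> C \<and> (\<forall>x\<in>S. \<forall>r>0. m x (2 * r) \<le> C * m x r)" by (intro exI[of _ "max 1 C"]) auto
qed

lemma m_doubling_iter:
  assumes "x \<in> S" "0 < r" shows "m x (2 ^ k * r) \<le> Cd ^ k * m x r"
proof (induction k)
  case (Suc k)
  have "m x (2 ^ Suc k * r) \<le> Cd * m x (2 ^ k * r)"
    using Cd_spec assms by (simp add: mult.assoc)
  also have "\<dots> \<le> Cd * (Cd ^ k * m x r)" using Suc Cd_spec by (intro mult_left_mono) auto
  finally show ?case by (simp add: mult.assoc)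
qed simp

lemma m_compare:
  assumes "y \<in> S" "0 < r" "dist x y + R \<le> 2 ^ k * r" shows "m x R \<le> Cd ^ k * m y r"
proof -
  have "BS x R \<subseteq> BS y (2 ^ k * r)"
  proof
    fix z assume "z \<in> BS x R"
    then show "z \<in> BS y (2 ^ k * r)" using dist_triangle2[of y z x] assms(3) by (auto simp: dist_commute)
  qed
  then show ?thesis using m_mono m_doubling_iter[OF assms(1,2)] by (meson order.trans)
qed

text \<open>Volume packing: the balls of radius \<open>r/2\<close> about the counted points are
  disjoint, lie in the ball of radius \<open>(K + 1) * r\<close> about \<open>x\<close>, and each
  has mass at least \<open>Cd ^ k\<close> times smaller than that ball. The number
  \<open>4 * K + 2\<close> is \<open>(2 * K + 1) * r\<close> measured in units of
  \<open>r/2\<close>.\<close>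

lemma separated_overlap:
  assumes A: "finite A" "A \<subseteq> S" "separated r A" and r: "0 < r" and x: "x \<in> S" and K: "0 < K" "4 * K + 2 \<le> 2 ^ k"
  shows "real (card {a\<in>A. dist x a < K * r}) \<le> Cd ^ k"
proof -
  let ?A = "{a\<in>A. dist x a < K * r}"
  let ?R = "(K + 1) * r"
  have R: "0 < ?R" using K r by simp
  have "m x ?R * real (card ?A) = (\<Sum>a\<in>?A. m x ?R)" by simp
  also have "\<dots> \<le> (\<Sum>a\<in>?A. Cd ^ k * m a (r/2))"
  proof (rule sum_mono)
    fix a assume a: "a \<in> ?A"
    have "dist x a + ?R \<le> (2 * K + 1) * r" using a by (simp add: algebra_simps)
    also have "\<dots> = (4 * K + 2) * (r/2)" by (simp add: algebra_simps)
    also have "\<dots> \<le> 2 ^ k * (r/2)" using K r by (intro mult_right_mono) auto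
    finally show "m x ?R \<le> Cd ^ k * m a (r/2)" using a A r by (intro m_compare) auto
  qed
  also have "\<dots> = Cd ^ k * (\<Sum>a\<in>?A. measure mu (BS a (r/2)))" by (simp add: sum_distrib_left m_def)
  also have "(\<Sum>a\<in>?A. measure mu (BS a (r/2))) = measure mu (\<Union>a\<in>?A. BS a (r/2))"
  proof (rule finite_measure_finite_Union[symmetric])
    show "disjoint_family_on (\<lambda>a. BS a (r/2)) ?A"
      unfolding disjoint_family_on_def
    proof (intro ballI impI)
      fix a b assume ab: "a \<in> ?A" "b \<in> ?A" "a \<noteq> b"
      then have "r \<le> dist a b" using A(3) by (auto simp: separated_def)
      then show "BS a (r/2) \<inter> BS b (r/2) = {}" using dist_triangle_half_r[of _ a r b] by (force simp: dist_commute)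
    qed
  qed (use A(1) in auto)
  also have "\<dots> \<le> m x ?R"
    unfolding m_def
  proof (intro finite_measure_mono)
    show "(\<Union>a\<in>?A. BS a (r/2)) \<subseteq> BS x ?R"
    proof
      fix z assume "z \<in> (\<Union>a\<in>?A. BS a (r/2))"
      then obtain a where a: "dist x a < K * r" "dist a z < r/2" "z \<in> S" by auto
      have "dist x z \<le> dist x a + dist a z" by (rule dist_triangle)
      also have "\<dots> < ?R" using a r by (simp add: distrib_right)
      finally show "z \<in> BS x ?R" using a by simp
    qed
  qed measurable
  finally have "m x ?R * real (card ?A) \<le> m x ?R * Cd ^ k" using Cd_spec by (simp add: mult.commute mult_left_mono)
  then show ?thesis using m_pos[OF x R] by simp
qed

lemma newton_integrable: assumes u: "u \<in> NN" shows "integrable mu u"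
proof (rule Bochner_Integration.integrable_bound)
  show "integrable mu (\<lambda>x. 1 + \<bar>u x\<bar> powr p)" using newton_Lp[OF u] by simp
  show "AE x in mu. norm (u x) \<le> norm (1 + \<bar>u x\<bar> powr p)"
  proof (rule AE_I2)
    fix x
    have "\<bar>u x\<bar> \<le> 1 + \<bar>u x\<bar> powr p"
    proof (cases "\<bar>u x\<bar> \<le> 1")
      case False
      then have "\<bar>u x\<bar> powr 1 \<le> \<bar>u x\<bar> powr p" using p by (intro powr_mono) auto
      then show ?thesis using False by simp
    qed (simp add: add_increasing2)
    then show "norm (u x) \<le> norm (1 + \<bar>u x\<bar> powr p)" by simp
  qed
qed (rule newton_measurable[OF u])

text \<open>Real-valued version of \<open>enn_powr (g x) p\<close>. Infinite values become 0, which
  for finite energy changes only a null set.\<close>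

definition dens :: "('a \<Rightarrow> ennreal) \<Rightarrow> 'a \<Rightarrow> real" where "dens g x = enn2real (g x) powr p"

lemma dens_nonneg [simp]: "0 \<le> dens g x" by (simp add: dens_def)

lemma enn_powr_dens:
  assumes g: "g \<in> borel_measurable borel" "pen g < \<infinity>"
  shows "AE x in mu. enn_powr (g x) p = ennreal (dens g x)"
proof -
  note [measurable] = borel_imp_mu[OF g(1)]
  have "AE x in mu. enn_powr (g x) p \<noteq> \<infinity>"
    using g(2) unfolding pen_def by (intro nn_integral_PInf_AE) auto
  then show ?thesis by eventually_elim (auto simp: enn_powr_def dens_def)
qed

lemma dens_integrable:
  assumes g: "g \<in> borel_measurable borel" "pen g < \<infinity>"
  shows "integrable mu (dens g)"
proof (rule integrableI_bounded)
  note [measurable] = borel_imp_mu[OF g(1)]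
  show "dens g \<in> borel_measurable mu" unfolding dens_def[abs_def] by measurable
  have "(\<integral>\<^sup>+ x. ennreal (norm (dens g x)) \<partial>mu) = pen g"
    unfolding pen_def
  proof (rule nn_integral_cong_AE)
    show "AE x in mu. ennreal (norm (dens g x)) = enn_powr (g x) p"
      using enn_powr_dens[OF g] by eventually_elim simp
  qed
  then show "(\<integral>\<^sup>+ x. ennreal (norm (dens g x)) \<partial>mu) < \<infinity>" using g by simp
qed

definition avg :: "('a \<Rightarrow> real) \<Rightarrow> 'a \<Rightarrow> real \<Rightarrow> real" where
  "avg u x r = (\<integral>y. indicator (BS x r) y * u y \<partial>mu) / m x r"

lemma integrable_BS [simp]: "integrable mu u \<Longrightarrow> integrable mu (\<lambda>y. indicator (BS x r) y * (u y :: real))"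
  using integrable_mult_indicator[of "BS x r" mu u] by simp

lemma set_integral_BS: "(LINT y:BS x r|M. u y) = (\<integral>y. indicator (BS x r) y * (u y :: real) \<partial>mu)"
proof -
  have "(LINT y:BS x r|M. u y) = (LINT y:S|M. indicator (BS x r) y * u y)"
    unfolding set_lebesgue_integral_def by (intro Bochner_Integration.integral_cong) (auto simp: indicator_def)
  then show ?thesis by (simp add: set_integral_mu)
qed

lemma nn_integral_BS: "(\<integral>\<^sup>+y\<in>BS x r. F y \<partial>M) = (\<integral>\<^sup>+y. indicator (BS x r) y * F y \<partial>mu)"
proof -
  have "(\<integral>\<^sup>+y\<in>BS x r. F y \<partial>M) = (\<integral>\<^sup>+y\<in>S. indicator (BS x r) y * F y \<partial>M)"
    by (intro nn_integral_cong) (auto simp: indicator_def)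
  then show ?thesis by (simp add: nn_integral_mu)
qed

text \<open>Newton functions are integrable over the finite measure, so the premise of local
  integrability is automatic, and since balls have positive finite mass the quotients in
  \<open>ennreal\<close> can be read as real ones.\<close>

lemma poincare_real:
  obtains CP lam where "0 < CP" "1 \<le> lam" "\<And>u g x r. u \<in> NN \<Longrightarrow> upper_gradient S u g \<Longrightarrow> pen g < \<infinity> \<Longrightarrow> x \<in> S \<Longrightarrow> 0 < r \<Longrightarrow>
    (\<integral>y. indicator (BS x r) y * \<bar>u y - avg u x r\<bar> \<partial>mu)
      \<le> CP * r * m x r * ((\<integral>y. indicator (BS x (lam * r)) y * dens g y \<partial>mu) / m x (lam * r)) powr (1/p)"
proof -
  obtain CP lam where CP: "0 < CP" "1 \<le> lam" and P: "\<And>x r u g. x \<in> S \<Longrightarrow> 0 < r \<Longrightarrow>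
     set_borel_measurable M S u \<and> (\<forall>y \<in> S. \<forall>s > 0. set_integrable M (BS y s) u) \<and> upper_gradient S u g \<Longrightarrow>
      (\<integral>\<^sup>+ y \<in> BS x r. ennreal \<bar>u y - (LINT y:BS x r|M. u y) / measure M (BS x r)\<bar> \<partial>M) / emeasure M (BS x r)
          \<le> ennreal (CP * r) * enn_powr ((\<integral>\<^sup>+ y \<in> BS x (lam * r). enn_powr (g y) p \<partial>M) / emeasure M (BS x (lam * r))) (1 / p)"
    using poincare unfolding poincare_on_def Let_def by (smt (verit))
  show ?thesis
  proof (rule that[OF CP])
    fix u g x and r :: real assume u: "u \<in> NN" and g: "upper_gradient S u g" "pen g < \<infinity>" and x: "x \<in> S" and r: "0 < r"
    note gm = upper_gradient_measurable[OF g(1)]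
    have "set_integrable M S u"
      using newton_integrable[OF u] unfolding mu_def set_integrable_def
      by (subst (asm) integrable_restrict_space) (auto simp: space_M)
    then have "set_integrable M (BS y s) u" for y s
      by (rule set_integrable_subset) (auto simp: sets_M)
    then have *: "set_borel_measurable M S u \<and> (\<forall>y \<in> S. \<forall>s > 0. set_integrable M (BS y s) u) \<and> upper_gradient S u g"
      using newton_measurable[OF u] g by (simp add: borel_mu)
    let ?I = "\<integral>y. indicator (BS x r) y * \<bar>u y - avg u x r\<bar> \<partial>mu"
    let ?E = "\<integral>y. indicator (BS x (lam * r)) y * dens g y \<partial>mu"
    have mp: "0 < m x r" "0 < m x (lam * r)" using m_pos[OF x] r CP by auto
    have E0: "0 \<le> ?E" by (intro integral_nonneg_AE) auto
    have i1: "integrable mu (\<lambda>y. indicator (BS x r) y * \<bar>u y - avg u x r\<bar>)"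
      using newton_integrable[OF u] by (intro integrable_BS integrable_abs Bochner_Integration.integrable_diff) auto
    have "(\<integral>\<^sup>+ y \<in> BS x r. ennreal \<bar>u y - (LINT y:BS x r|M. u y) / measure M (BS x r)\<bar> \<partial>M)
      = (\<integral>\<^sup>+ y. indicator (BS x r) y * ennreal \<bar>u y - avg u x r\<bar> \<partial>mu)"
      unfolding nn_integral_BS set_integral_BS measure_BS avg_def ..
    also have "\<dots> = (\<integral>\<^sup>+ y. ennreal (indicator (BS x r) y * \<bar>u y - avg u x r\<bar>) \<partial>mu)"
      by (intro nn_integral_cong) (auto simp: indicator_def)
    also have "\<dots> = ennreal ?I" by (rule nn_integral_eq_integral[OF i1]) auto
    finally have L: "(\<integral>\<^sup>+ y \<in> BS x r. ennreal \<bar>u y - (LINT y:BS x r|M. u y) / measure M (BS x r)\<bar> \<partial>M) = ennreal ?I" .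
    have "(\<integral>\<^sup>+ y \<in> BS x (lam * r). enn_powr (g y) p \<partial>M) = (\<integral>\<^sup>+ y. ennreal (indicator (BS x (lam * r)) y * dens g y) \<partial>mu)"
      unfolding nn_integral_BS
    proof (intro nn_integral_cong_AE)
      show "AE y in mu. indicator (BS x (lam * r)) y * enn_powr (g y) p = ennreal (indicator (BS x (lam * r)) y * dens g y)"
        using enn_powr_dens[OF gm g(2)] by eventually_elim (auto simp: indicator_def)
    qed
    also have "\<dots> = ennreal ?E"
      by (rule nn_integral_eq_integral[OF integrable_BS[OF dens_integrable[OF gm g(2)]]]) auto
    finally have R: "(\<integral>\<^sup>+ y \<in> BS x (lam * r). enn_powr (g y) p \<partial>M) = ennreal ?E" .
    have "ennreal ?I / ennreal (m x r) \<le> ennreal (CP * r) * enn_powr (ennreal ?E / ennreal (m x (lam * r))) (1 / p)"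
      using P[OF x r *] unfolding L R emeasure_BS .
    moreover have "0 \<le> ?I" by (intro integral_nonneg_AE) auto
    ultimately have "ennreal (?I / m x r) \<le> ennreal (CP * r * (?E / m x (lam * r)) powr (1 / p))"
      using mp E0 CP r by (simp add: divide_ennreal enn_powr_ennreal ennreal_mult[symmetric])
    then have "?I / m x r \<le> CP * r * (?E / m x (lam * r)) powr (1 / p)"
      using CP r by simp
    then show "?I \<le> CP * r * m x r * (?E / m x (lam * r)) powr (1/p)"
      using mp by (simp add: divide_le_eq mult.assoc mult.commute mult.left_commute)
  qed
qed

end

section \<open>Discrete convolutions and density of Lipschitz functions\<close>

text \<open>A tent of height 1 supported in the ball of radius \<open>2 * r\<close> and at least 1/2
  on the ball of radius \<open>r\<close>; on the region covered by a net the denominator of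
  \<open>pou\<close> is therefore bounded below.\<close>

definition psi :: "real \<Rightarrow> 'a::metric_space \<Rightarrow> 'a \<Rightarrow> real" where
  "psi r a x = max 0 (1 - dist x a / (2 * r))"

definition pou :: "real \<Rightarrow> 'a::metric_space set \<Rightarrow> 'a \<Rightarrow> 'a \<Rightarrow> real" where
  "pou r A a x = psi r a x / (\<Sum>b\<in>A. psi r b x)"

lemma psi_nonneg [simp]: "0 \<le> psi r a x" by (simp add: psi_def)

lemma psi_eq_0: "0 < r \<Longrightarrow> 2 * r \<le> dist x a \<Longrightarrow> psi r a x = 0"
  by (simp add: psi_def max_def)

lemma psi_lipschitz: "0 < r \<Longrightarrow> \<bar>psi r a x - psi r a y\<bar> \<le> dist x y / (2 * r)"
proof -
  assume r: "0 < r"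
  have "\<bar>psi r a x - psi r a y\<bar> \<le> \<bar>dist x a / (2 * r) - dist y a / (2 * r)\<bar>"
    unfolding psi_def by (auto simp: max_def)
  also have "\<dots> = \<bar>dist x a - dist y a\<bar> / (2 * r)" using r by (simp add: diff_divide_distrib[symmetric])
  also have "\<dots> \<le> dist x y / (2 * r)"
    using r abs_dist_diff_le[of x a y] by (intro divide_right_mono) (auto simp: dist_commute)
  finally show ?thesis .
qed

lemma pou_nonneg [simp]: "0 \<le> pou r A a x"
  unfolding pou_def by (intro divide_nonneg_nonneg sum_nonneg) auto

lemma pou_eq_0: "0 < r \<Longrightarrow> 2 * r \<le> dist x a \<Longrightarrow> pou r A a x = 0"
  by (simp add: pou_def psi_eq_0)

lemma psi_sum_ge:
  assumes "finite A" "0 < r" "x \<in> (\<Union>a\<in>A. ball a r)"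
  shows "1/2 \<le> (\<Sum>b\<in>A. psi r b x)"
proof -
  obtain a where a: "a \<in> A" "dist x a < r" using assms(3) by (auto simp: dist_commute)
  then have "1/2 \<le> psi r a x" using assms(2) by (simp add: psi_def max_def field_simps)
  also have "\<dots> \<le> (\<Sum>b\<in>A. psi r b x)" using a assms(1) by (intro member_le_sum) auto
  finally show ?thesis .
qed

lemma pou_sum:
  assumes "finite A" "0 < r" "x \<in> (\<Union>a\<in>A. ball a r)"
  shows "(\<Sum>a\<in>A. pou r A a x) = 1"
  using psi_sum_ge[OF assms] unfolding pou_def sum_divide_distrib[symmetric] by simp

lemma truncation_contracts: "\<bar>max (-k) (min k s) - max (-k) (min k t)\<bar> \<le> \<bar>s - t\<bar>" for s t k :: real
  by (auto simp: max_def min_def)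

context pi_space
begin

text \<open>Numerator and denominator vary at a rate of order \<open>1 / r\<close>: at most
  \<open>2 * Cd ^ 4\<close> tents are nonzero at one of the two points, and the denominators are at
  least 1/2. The exponent 4 serves \<open>K = 2\<close> in \<open>separated_overlap\<close>, where
  10 is at most 16.\<close>

lemma pou_lipschitz:
  assumes A: "finite A" "A \<subseteq> S" "separated r A" "S \<subseteq> (\<Union>a\<in>A. ball a r)" and r: "0 < r" and a: "a \<in> A"
  shows "((1 + 2 * Cd ^ 4) / r)-lipschitz_on S (pou r A a)"
proof (rule lipschitz_onI)
  show "0 \<le> (1 + 2 * Cd ^ 4) / r" using r Cd_spec by simp
  fix x y assume xy: "x \<in> S" "y \<in> S"
  let ?P = "\<lambda>x. \<Sum>b\<in>A. psi r b x"
  define X where "X = ?P x"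
  define Y where "Y = ?P y"
  define s where "s = psi r a x"
  define t where "t = psi r a y"
  define d where "d = dist x y"
  have XY: "1/2 \<le> X" "1/2 \<le> Y"
    unfolding X_def Y_def by (rule psi_sum_ge[OF A(1) r subsetD[OF A(4) xy(1)]], rule psi_sum_ge[OF A(1) r subsetD[OF A(4) xy(2)]])
  have near: "real (card {b\<in>A. dist z b < 2 * r}) \<le> Cd ^ 4" if "z \<in> S" for z
    by (rule separated_overlap[OF A(1,2,3) r that]) auto
  have "\<bar>Y - X\<bar> \<le> (\<Sum>b\<in>A. \<bar>psi r b y - psi r b x\<bar>)"
    unfolding X_def Y_def sum_subtractf[symmetric] by (rule sum_abs)
  also have "\<dots> = (\<Sum>b\<in>{b\<in>A. dist x b < 2 * r} \<union> {b\<in>A. dist y b < 2 * r}. \<bar>psi r b y - psi r b x\<bar>)"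
    using A(1) r by (intro sum.mono_neutral_right) (auto simp: psi_eq_0 not_less)
  also have "\<dots> \<le> (\<Sum>b\<in>{b\<in>A. dist x b < 2 * r} \<union> {b\<in>A. dist y b < 2 * r}. d / (2 * r))"
    unfolding d_def using psi_lipschitz[OF r, of _ y x] by (intro sum_mono) (simp add: dist_commute)
  also have "\<dots> = real (card ({b\<in>A. dist x b < 2 * r} \<union> {b\<in>A. dist y b < 2 * r})) * (d / (2 * r))" by simp
  also have "\<dots> \<le> (Cd ^ 4 + Cd ^ 4) * (d / (2 * r))"
  proof (rule mult_right_mono)
    have "real (card ({b\<in>A. dist x b < 2 * r} \<union> {b\<in>A. dist y b < 2 * r})) \<le>
      real (card {b\<in>A. dist x b < 2 * r}) + real (card {b\<in>A. dist y b < 2 * r})"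
      unfolding of_nat_add[symmetric] of_nat_le_iff by (rule card_Un_le)
    then show "real (card ({b\<in>A. dist x b < 2 * r} \<union> {b\<in>A. dist y b < 2 * r})) \<le> Cd ^ 4 + Cd ^ 4"
      using near[OF xy(1)] near[OF xy(2)] by linarith
  qed (use r in \<open>simp add: d_def\<close>)
  also have "\<dots> = Cd ^ 4 * d / r" by simp
  finally have YX: "\<bar>Y - X\<bar> \<le> Cd ^ 4 * d / r" .
  have st: "\<bar>s - t\<bar> \<le> d / (2 * r)" unfolding s_def t_def d_def by (rule psi_lipschitz[OF r])
  have tY: "0 \<le> t / Y" "t / Y \<le> 1"
  proof -
    show "0 \<le> t / Y" using XY by (simp add: t_def)
    show "t / Y \<le> 1"
    proof -
      have "t \<le> Y" unfolding t_def Y_def using A(1) a by (intro member_le_sum) auto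
      then show ?thesis using XY by simp
    qed
  qed
  have "s / X - t / Y = (s - t) / X + (t / Y) * ((Y - X) / X)" using XY by (simp add: field_simps)
  also have "\<bar>\<dots>\<bar> \<le> \<bar>s - t\<bar> / X + (t / Y) * (\<bar>Y - X\<bar> / X)"
  proof -
    have "\<bar>(s - t) / X\<bar> = \<bar>s - t\<bar> / X" "\<bar>(Y - X) / X\<bar> = \<bar>Y - X\<bar> / X" using XY by simp_all
    moreover have "\<bar>(t / Y) * ((Y - X) / X)\<bar> = (t / Y) * \<bar>(Y - X) / X\<bar>"
      unfolding abs_mult by (simp only: abs_of_nonneg[OF tY(1)])
    ultimately show ?thesis using abs_triangle_ineq[of "(s - t) / X" "(t / Y) * ((Y - X) / X)"] by metis
  qed
  also have "\<dots> \<le> \<bar>s - t\<bar> / (1/2) + 1 * (\<bar>Y - X\<bar> / (1/2))"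
    using XY tY by (intro add_mono mult_mono divide_left_mono) auto
  also have "\<dots> \<le> d / r + 2 * (Cd ^ 4 * d / r)"
    using YX st by simp
  also have "\<dots> = (1 + 2 * Cd ^ 4) / r * d" by (simp add: algebra_simps add_divide_distrib)
  finally show "dist (pou r A a x) (pou r A a y) \<le> (1 + 2 * Cd ^ 4) / r * dist x y"
    unfolding pou_def dist_real_def by (simp add: X_def Y_def s_def t_def d_def)
qed

text \<open>Enlarges the ball in the oscillation integral while keeping the smaller mass; with
  \<open>q\<close> the mean over the larger ball this is how neighbouring averages are compared, and
  with \<open>q = 0\<close> it bounds an average.\<close>

lemma avg_diff_le:
  assumes u: "integrable mu u" and sub: "BS a r \<subseteq> BS b s" and pos: "0 < m a r"
  shows "\<bar>avg u a r - q\<bar> \<le> (\<integral>y. indicator (BS b s) y * \<bar>u y - q\<bar> \<partial>mu) / m a r"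
proof -
  have iq: "integrable mu (\<lambda>y. u y - q)" using u by simp
  have ind: "(\<integral>y. indicator (BS a r) y * q \<partial>mu) = m a r * q"
    unfolding m_def by (simp add: measurable_sets)
  have "(\<integral>y. indicator (BS a r) y * (u y - q) \<partial>mu)
    = (\<integral>y. indicator (BS a r) y * u y - indicator (BS a r) y * q \<partial>mu)"
    by (simp add: right_diff_distrib)
  also have "\<dots> = (\<integral>y. indicator (BS a r) y * u y \<partial>mu) - m a r * q"
    using u unfolding ind[symmetric] by (intro Bochner_Integration.integral_diff integrable_BS) auto
  finally have "avg u a r - q = (\<integral>y. indicator (BS a r) y * (u y - q) \<partial>mu) / m a r"
    using pos by (simp add: avg_def diff_divide_distrib)
  then have "\<bar>avg u a r - q\<bar> = \<bar>\<integral>y. indicator (BS a r) y * (u y - q) \<partial>mu\<bar> / m a r"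
    using pos by simp
  also have "\<dots> \<le> (\<integral>y. indicator (BS b s) y * \<bar>u y - q\<bar> \<partial>mu) / m a r"
  proof (rule divide_right_mono)
    have "\<bar>\<integral>y. indicator (BS a r) y * (u y - q) \<partial>mu\<bar> \<le> (\<integral>y. \<bar>indicator (BS a r) y * (u y - q)\<bar> \<partial>mu)"
      by (rule integral_abs_bound)
    also have "\<dots> \<le> (\<integral>y. indicator (BS b s) y * \<bar>u y - q\<bar> \<partial>mu)"
      using sub iq by (intro integral_mono integrable_abs integrable_BS) (auto simp: indicator_def)
    finally show "\<bar>\<integral>y. indicator (BS a r) y * (u y - q) \<partial>mu\<bar> \<le> (\<integral>y. indicator (BS b s) y * \<bar>u y - q\<bar> \<partial>mu)" .
  qed simp
  finally show ?thesis .
qed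

lemma avg_bound:
  assumes u: "integrable mu u" and K: "\<And>x. x \<in> S \<Longrightarrow> \<bar>u x\<bar> \<le> K" and pos: "0 < m a r"
  shows "\<bar>avg u a r\<bar> \<le> K"
proof -
  have "\<bar>avg u a r\<bar> \<le> (\<integral>y. indicator (BS a r) y * \<bar>u y\<bar> \<partial>mu) / m a r"
    using avg_diff_le[OF u _ pos, of a r 0] by simp
  also have "\<dots> \<le> (\<integral>y. indicator (BS a r) y * K \<partial>mu) / m a r"
    using K u by (intro divide_right_mono integral_mono integrable_BS integrable_abs) (auto simp: indicator_def)
  also have "(\<integral>y. indicator (BS a r) y * K \<partial>mu) = m a r * K"
    unfolding m_def by (simp add: measurable_sets)
  finally show ?thesis using pos by simp
qed

text \<open>Each point is counted at most \<open>Cd ^ k\<close> times, so local bounds over dilated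
  balls of a net add up to a global one.\<close>

lemma overlap_integral_sum:
  assumes A: "finite A" "A \<subseteq> S" "separated r A" and r: "0 < r" and K: "0 < K" "4 * K + 2 \<le> 2 ^ k"
    and f: "integrable mu f" "\<And>x. 0 \<le> f x"
  shows "(\<Sum>b\<in>A. \<integral>x. indicator (BS b (K * r)) x * f x \<partial>mu) \<le> Cd ^ k * (\<integral>x. f x \<partial>mu)"
proof -
  have "(\<Sum>b\<in>A. \<integral>x. indicator (BS b (K * r)) x * f x \<partial>mu) = (\<integral>x. (\<Sum>b\<in>A. indicator (BS b (K * r)) x * f x) \<partial>mu)"
    using f by (intro Bochner_Integration.integral_sum[symmetric] integrable_BS)
  also have "\<dots> \<le> (\<integral>x. Cd ^ k * f x \<partial>mu)"
  proof (intro integral_mono Bochner_Integration.integrable_sum integrable_BS integrable_mult_right f)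
    fix x assume x: "x \<in> space mu"
    have "(\<Sum>b\<in>A. indicator (BS b (K * r)) x * f x) = (\<Sum>b\<in>A. if dist x b < K * r then f x else 0)"
      using x by (intro sum.cong) (auto simp: indicator_def dist_commute)
    also have "\<dots> = (\<Sum>b\<in>{b\<in>A. dist x b < K * r}. f x)"
      using A(1) by (intro sum.inter_filter[symmetric])
    also have "\<dots> = real (card {b\<in>A. dist x b < K * r}) * f x" by simp
    also have "\<dots> \<le> Cd ^ k * f x"
      using x f by (intro mult_right_mono separated_overlap[OF A r _ K]) auto
    finally show "(\<Sum>b\<in>A. indicator (BS b (K * r)) x * f x) \<le> Cd ^ k * f x" .
  qed
  also have "\<dots> = Cd ^ k * (\<integral>x. f x \<partial>mu)" by simp
  finally show ?thesis .
qed

text \<open>The partition functions sum to 1, so their gradients sum to 0 and any number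
  \<open>q\<close> may be subtracted from all coefficients. Locality leaves the centres within
  \<open>3 * r\<close>, of which there are at most \<open>Cd ^ 4\<close>. The quantifiers over
  \<open>q\<close> and \<open>Q\<close> stand inside \<open>AE\<close>, so that both may be chosen
  for each point separately.\<close>

lemma pou_gradient:
  fixes c :: "'a \<Rightarrow> real"
  assumes A: "finite A" "A \<subseteq> S" "separated r A" "S \<subseteq> (\<Union>a\<in>A. ball a r)" and r: "0 < r"
  defines "w \<equiv> \<lambda>x. \<Sum>a\<in>A. c a * pou r A a x"
  shows "AE x in mu. \<forall>q Q. 0 \<le> Q \<longrightarrow> (\<forall>a\<in>A. dist x a < 3 * r \<longrightarrow> \<bar>c a - q\<bar> \<le> Q) \<longrightarrow>
     G w x \<le> Cd ^ 4 * (Q * (CC * ((1 + 2 * Cd ^ 4) / r)))"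
proof -
  let ?L = "CC * ((1 + 2 * Cd ^ 4) / r)"
  note lip = pou_lipschitz[OF A r]
  have pN: "pou r A a \<in> NN" if "a \<in> A" for a by (rule newton_lipschitz[OF lip[OF that]])
  have 1: "AE x in mu. D w x = (\<Sum>a\<in>A. c a *\<^sub>R D (pou r A a) x)"
    unfolding w_def using D_sum[OF A(1), of "pou r A" c] pN by blast
  have 2: "AE x in mu. (\<Sum>a\<in>A. D (pou r A a) x) = 0"
  proof -
    have s: "(\<lambda>x. \<Sum>a\<in>A. 1 * pou r A a x) \<in> NN"
      "AE x in mu. D (\<lambda>x. \<Sum>a\<in>A. 1 * pou r A a x) x = (\<Sum>a\<in>A. 1 *\<^sub>R D (pou r A a) x)"
      using D_sum[OF A(1), of "pou r A" "\<lambda>_. 1"] pN by blast+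
    have "AE x in mu. (\<Sum>a\<in>A. 1 * pou r A a x) = 1"
      using A(4) by (intro AE_I2) (auto intro!: pou_sum[OF A(1) r])
    from D_cong_AE[OF s(1) newton_const this] s(2) D_const[of 1] show ?thesis
      by eventually_elim simp
  qed
  have 3: "AE x in mu. \<forall>a\<in>A. 3 * r \<le> dist x a \<longrightarrow> D (pou r A a) x = 0"
  proof (rule AE_finite_allI[OF A(1)])
    fix a assume aA: "a \<in> A"
    \<comment> \<open>Equal to 1 up to distance \<open>2 * r\<close>, where the partition function
      lives, and 0 from \<open>3 * r\<close> on.\<close>
    define z where "z x = min 1 (max 0 (3 - dist x a / r))" for x
    have "(1 / r)-lipschitz_on S z"
    proof (rule lipschitz_onI)
      fix x y
      have "\<bar>z x - z y\<bar> \<le> \<bar>dist x a / r - dist y a / r\<bar>" unfolding z_def by (auto simp: max_def min_def)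
      also have "\<dots> = \<bar>dist x a - dist y a\<bar> / r" using r by (simp add: diff_divide_distrib[symmetric])
      also have "\<dots> \<le> dist x y / r"
        using r abs_dist_diff_le[of x a y] by (intro divide_right_mono) (auto simp: dist_commute)
      finally show "dist (z x) (z y) \<le> 1 / r * dist x y" by (simp add: dist_real_def)
    qed (use r in simp)
    from newton_lipschitz[OF this] have zN: "z \<in> NN" .
    have "pou r A a x * z x = pou r A a x" for x
    proof (cases "2 * r \<le> dist x a")
      case False
      then have "dist x a / r \<le> 2" using r by (simp add: divide_le_eq)
      then have "z x = 1" by (simp add: z_def)
      then show ?thesis by simp
    qed (simp add: pou_eq_0[OF r])
    from D_eq_0_off_cutoff[OF pN[OF aA] zN this]
    show "AE x in mu. 3 * r \<le> dist x a \<longrightarrow> D (pou r A a) x = 0"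
    proof eventually_elim
      case (elim x)
      have "z x \<noteq> 1" if "3 * r \<le> dist x a"
      proof -
        have "3 \<le> dist x a / r" using that r by (simp add: le_divide_eq)
        then show ?thesis by (simp add: z_def)
      qed
      then show ?case using elim by blast
    qed
  qed
  have 4: "AE x in mu. \<forall>a\<in>A. G (pou r A a) x \<le> ?L"
    by (rule AE_finite_allI[OF A(1)]) (rule G_lipschitz[OF lip])
  show ?thesis using 1 2 3 4 AE_space
  proof eventually_elim
    case (elim x)
    then have x: "x \<in> S" by simp
    show ?case
    proof (intro allI impI)
      fix q Q :: real assume Q: "0 \<le> Q" "\<forall>a\<in>A. dist x a < 3 * r \<longrightarrow> \<bar>c a - q\<bar> \<le> Q"
      let ?A = "{a\<in>A. dist x a < 3 * r}"
      have "D w x = (\<Sum>a\<in>A. (c a - q) *\<^sub>R D (pou r A a) x)"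
        using elim(1,2) by (simp add: scaleR_diff_left sum_subtractf scaleR_sum_right[symmetric])
      also have "\<dots> = (\<Sum>a\<in>?A. (c a - q) *\<^sub>R D (pou r A a) x)"
        using A(1) elim(3) by (intro sum.mono_neutral_right) (auto simp: not_less)
      finally have "G w x \<le> (\<Sum>a\<in>?A. cnorm ip x ((c a - q) *\<^sub>R D (pou r A a) x))"
        unfolding G_def using cnorm_sum[of ?A x] A(1) x by simp
      also have "\<dots> \<le> (\<Sum>a\<in>?A. Q * ?L)"
      proof (rule sum_mono)
        fix a assume a: "a \<in> ?A"
        have "cnorm ip x ((c a - q) *\<^sub>R D (pou r A a) x) = \<bar>c a - q\<bar> * G (pou r A a) x"
          using x by (simp add: cnorm_scale G_def)
        also have "\<dots> \<le> Q * ?L"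
          using a Q elim(4) x by (intro mult_mono) auto
        finally show "cnorm ip x ((c a - q) *\<^sub>R D (pou r A a) x) \<le> Q * ?L" .
      qed
      also have "\<dots> = real (card ?A) * (Q * ?L)" by simp
      also have "\<dots> \<le> Cd ^ 4 * (Q * ?L)"
        using Q CC_ge_1 Cd_spec r by (intro mult_right_mono separated_overlap[OF A(1,2,3) r x]) auto
      finally show "G w x \<le> Cd ^ 4 * (Q * ?L)" .
    qed
  qed
qed

text \<open>Averages of \<open>u\<close> over small balls are glued by the partition of unity. The
  Poincare inequality bounds the difference of neighbouring averages by \<open>r\<close> times a
  local mean of the energy, and the gradient of the partition contributes \<open>1 / r\<close>, so
  the energy bound is uniform; without that factor the same oscillation gives an error of order
  \<open>r\<close>. Averaging and gluing preserve the bound \<open>K\<close>.\<close>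

lemma discrete_convolution:
  assumes u: "u \<in> NN" and K: "\<And>x. x \<in> S \<Longrightarrow> \<bar>u x\<bar> \<le> K"
  obtains C where "\<And>r. 0 < r \<Longrightarrow> \<exists>w L. L-lipschitz_on S w \<and> (\<forall>x\<in>S. \<bar>w x\<bar> \<le> K) \<and> en w \<le> C \<and> (\<integral>x. \<bar>w x - u x\<bar> \<partial>mu) \<le> C * r"
proof -
  obtain g where g: "upper_gradient S u g" "pen g < \<infinity>" using u by (rule newtonE)
  note gm = upper_gradient_measurable[OF g(1)]
  obtain CP lam where CP: "0 < CP" "1 \<le> lam" and P0: "\<And>u g x r. u \<in> NN \<Longrightarrow> upper_gradient S u g \<Longrightarrow> pen g < \<infinity> \<Longrightarrow> x \<in> S \<Longrightarrow> 0 < r \<Longrightarrow>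
    (\<integral>y. indicator (BS x r) y * \<bar>u y - avg u x r\<bar> \<partial>mu)
      \<le> CP * r * m x r * ((\<integral>y. indicator (BS x (lam * r)) y * dens g y \<partial>mu) / m x (lam * r)) powr (1/p)"
    by (rule poincare_real) (rule that)
  note P = P0[OF u g]
  \<comment> \<open>Number of doublings for the largest balls in use, of radius
    \<open>5 * lam * r\<close>.\<close>
  obtain k where k: "4 * (5 * lam) + 2 < 2 ^ k" using real_arch_pow[of 2] by auto
  define N where "N = Cd ^ k"
  have Cd1: "1 \<le> Cd ^ j" for j using Cd_spec by (simp add: one_le_power)
  define I where "I = (\<integral>x. dens g x \<partial>mu)"
  have I0: "0 \<le> I" unfolding I_def by (intro integral_nonneg_AE) auto
  note di = dens_integrable[OF gm g(2)]
  note ui = newton_integrable[OF u]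
  define C3 where "C3 = Cd ^ 4 * (Cd ^ 4 * CP * 5) * (CC * (1 + 2 * Cd ^ 4))"
  have C30: "0 \<le> C3" using Cd1[of 4] CP CC_ge_1 by (auto simp: C3_def)
  define C where "C = max (C3 powr p * (N * I)) (10 * Cd ^ 4 * CP * (N * (measure mu S + I)))"
  show ?thesis
  proof (rule that[of C])
    fix r :: real assume r: "0 < r"
    obtain A where A: "finite A" "A \<subseteq> S" "separated r A" "S \<subseteq> (\<Union>a\<in>A. ball a r)"
      using compact_separated_net[OF compact_S r order.refl] by blast
    define E where "E b = (\<integral>y. indicator (BS b (5 * lam * r)) y * dens g y \<partial>mu)" for b
    define mb where "mb b = m b (5 * lam * r)" for b
    define t where "t b = (E b / mb b) powr (1/p)" for b
    \<comment> \<open>If \<open>x\<close> is within \<open>r\<close> of \<open>b\<close> and within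
      \<open>3 * r\<close> of \<open>a\<close>, the centres are less than \<open>4 * r\<close>
      apart, and the \<open>r\<close>-ball about \<open>a\<close> lies in the ball of radius
      \<open>5 * r\<close> about \<open>b\<close>.\<close>
    define q where "q b = avg u b (5 * r)" for b
    define Q where "Q b = Cd ^ 4 * CP * 5 * r * t b" for b
    define c where "c a = avg u a r" for a
    define w where "w x = (\<Sum>a\<in>A. c a * pou r A a x)" for x
    have E0: "0 \<le> E b" for b unfolding E_def by (intro integral_nonneg_AE) auto
    have mp: "0 < m b s" if "b \<in> A" "0 < s" for b s using m_pos[of b s] that A(2) by auto
    have mb0: "0 < mb b" if "b \<in> A" for b unfolding mb_def using mp[OF that] r CP by simp
    have t0: "0 \<le> t b" for b by (simp add: t_def)
    have Q0: "0 \<le> Q b" for b unfolding Q_def using Cd1[of 4] CP r t0 by auto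
    have mle: "m b s \<le> mb b" if "s \<le> 5 * r" for b s
    proof -
      have "1 * (5 * r) \<le> lam * (5 * r)" using CP r by (intro mult_right_mono) auto
      then have "s \<le> 5 * lam * r" using that by simp
      then show ?thesis unfolding mb_def by (intro m_mono Int_mono subset_ball) auto
    qed
    have Pb: "(\<integral>y. indicator (BS b (5 * r)) y * \<bar>u y - q b\<bar> \<partial>mu) \<le> CP * (5 * r) * m b (5 * r) * t b" if "b \<in> A" for b
    proof -
      have "lam * (5 * r) = 5 * lam * r" by simp
      then show ?thesis
        using P[of b "5 * r"] that A(2) r unfolding q_def t_def E_def mb_def by (auto simp only: subset_iff mult_pos_pos zero_less_numeral)
    qed
    have step: "\<bar>c a - q b\<bar> \<le> Q b" if "a \<in> A" "b \<in> A" "dist a b < 4 * r" for a b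
    proof -
      have sub: "BS a r \<subseteq> BS b (5 * r)"
      proof
        fix z assume "z \<in> BS a r"
        then have "dist a z < r" "z \<in> S" by auto
        moreover have "dist b z \<le> dist a b + dist a z" by (rule dist_triangle3)
        ultimately show "z \<in> BS b (5 * r)" using that(3) by simp
      qed
      have "m b (5 * r) \<le> Cd ^ 4 * m a r"
        using that A(2) r by (intro m_compare) (auto simp: dist_commute)
      have "\<bar>c a - q b\<bar> \<le> (\<integral>y. indicator (BS b (5 * r)) y * \<bar>u y - q b\<bar> \<partial>mu) / m a r"
        unfolding c_def by (rule avg_diff_le[OF ui sub mp[OF that(1) r]])
      also have "\<dots> \<le> (CP * (5 * r) * m b (5 * r) * t b) / m a r"
        by (intro divide_right_mono Pb that) auto
      also have "\<dots> \<le> (CP * (5 * r) * (Cd ^ 4 * m a r) * t b) / m a r"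
        using CP r t0 \<open>m b (5 * r) \<le> Cd ^ 4 * m a r\<close> by (intro divide_right_mono mult_right_mono mult_left_mono) auto
      also have "\<dots> = Q b" using mp[OF that(1) r] by (simp add: Q_def)
      finally show ?thesis .
    qed
    have near: "\<exists>b\<in>A. dist x b < r" if "x \<in> S" for x
      using subsetD[OF A(4) that] by (auto simp: dist_commute)
    have wlip: "\<exists>L. L-lipschitz_on S w"
      unfolding w_def using pou_lipschitz[OF A r] by (intro lipschitz_on_sum_ex A(1)) blast
    then have wN: "w \<in> NN" using newton_lipschitz by blast
    have wK: "\<bar>w x\<bar> \<le> K" if x: "x \<in> S" for x
    proof -
      have "\<bar>w x\<bar> \<le> (\<Sum>a\<in>A. \<bar>c a\<bar> * pou r A a x)"
        unfolding w_def by (rule order.trans[OF sum_abs]) (simp add: abs_mult)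
      also have "\<dots> \<le> (\<Sum>a\<in>A. K * pou r A a x)"
        unfolding c_def using mp r K by (intro sum_mono mult_right_mono avg_bound ui) auto
      also have "\<dots> = K" using pou_sum[OF A(1) r subsetD[OF A(4) x]] by (simp add: sum_distrib_left[symmetric])
      finally show ?thesis .
    qed
    have tp: "t b powr p = E b / mb b" if "b \<in> A" for b
      using p E0[of b] mb0[OF that] by (simp add: t_def powr_powr)
    have sumE: "(\<Sum>b\<in>A. E b) \<le> N * I"
      unfolding E_def N_def I_def using k CP by (intro overlap_integral_sum[OF A(1,2,3) r _ _ di]) auto
    have sumM: "(\<Sum>b\<in>A. mb b) \<le> N * measure mu S"
    proof -
      have "(\<Sum>b\<in>A. \<integral>x. indicator (BS b (5 * lam * r)) x * 1 \<partial>mu) \<le> N * (\<integral>x. 1 \<partial>mu)"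
        unfolding N_def using k CP by (intro overlap_integral_sum[OF A(1,2,3) r]) auto
      then show ?thesis by (simp add: mb_def m_def)
    qed
    have enw: "en w \<le> C"
    proof -
      \<comment> \<open>The nearby centre depends on the point; summing over all centres avoids a
        measurable choice of it.\<close>
      have Gw: "AE x in mu. G w x powr p \<le> (\<Sum>b\<in>A. indicator (BS b r) x * (C3 powr p * (E b / mb b)))"
        using pou_gradient[OF A r, of c] AE_space
      proof eventually_elim
        case (elim x)
        then have x: "x \<in> S" by simp
        obtain b where b: "b \<in> A" "dist x b < r" using near[OF x] by blast
        have close: "dist a b < 4 * r" if "dist x a < 3 * r" for a
          using dist_triangle3[of a b x] that b by simp
        then have "G w x \<le> Cd ^ 4 * (Q b * (CC * ((1 + 2 * Cd ^ 4) / r)))"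
          using elim(1) Q0[of b] step b unfolding w_def by blast
        also have "\<dots> = C3 * t b" using r by (simp add: Q_def C3_def)
        finally have "G w x powr p \<le> (C3 * t b) powr p" using p x by (intro powr_mono2) auto
        also have "\<dots> = C3 powr p * (E b / mb b)" using tp[OF b(1)] by (simp add: powr_mult)
        also have "\<dots> = indicator (BS b r) x * (C3 powr p * (E b / mb b))" using b x by (simp add: dist_commute)
        also have "\<dots> \<le> (\<Sum>b\<in>A. indicator (BS b r) x * (C3 powr p * (E b / mb b)))"
        proof (rule member_le_sum[OF b(1) _ A(1)])
          fix i assume "i \<in> A - {b}"
          then show "0 \<le> indicator (BS i r) x * (C3 powr p * (E i / mb i))" using E0[of i] mb0[of i] by simp
        qed
        finally show ?case .
      qed
      have "en w \<le> (\<integral>x. (\<Sum>b\<in>A. indicator (BS b r) x * (C3 powr p * (E b / mb b))) \<partial>mu)"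
        unfolding en_def using Gw
        by (intro integral_mono_AE G_integrable wN Bochner_Integration.integrable_sum integrable_BS) auto
      also have "\<dots> = (\<Sum>b\<in>A. m b r * (C3 powr p * (E b / mb b)))"
        by (subst Bochner_Integration.integral_sum) (auto intro!: integrable_BS simp: m_def simp del: integrable_mult_left_iff)
      also have "\<dots> \<le> (\<Sum>b\<in>A. C3 powr p * E b)"
      proof (rule sum_mono)
        fix b assume b: "b \<in> A"
        have "m b r * (C3 powr p * (E b / mb b)) \<le> mb b * (C3 powr p * (E b / mb b))"
          using mle[of r b] r E0[of b] mb0[OF b] by (intro mult_right_mono) auto
        then show "m b r * (C3 powr p * (E b / mb b)) \<le> C3 powr p * E b" using mb0[OF b] by simp
      qed
      also have "\<dots> \<le> C3 powr p * (N * I)"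
        unfolding sum_distrib_left[symmetric] by (intro mult_left_mono sumE) auto
      finally show ?thesis by (simp add: C_def)
    qed
    have L1: "(\<integral>x. \<bar>w x - u x\<bar> \<partial>mu) \<le> C * r"
    proof -
      have pt: "\<bar>w x - u x\<bar> \<le> (\<Sum>b\<in>A. indicator (BS b (5 * r)) x * \<bar>u x - q b\<bar> + indicator (BS b r) x * Q b)"
        if x: "x \<in> S" for x
      proof -
        obtain b where b: "b \<in> A" "dist x b < r" using near[OF x] by blast
        have one: "(\<Sum>a\<in>A. pou r A a x) = 1" using pou_sum[OF A(1) r subsetD[OF A(4) x]] by simp
        have "w x - q b = (\<Sum>a\<in>A. c a * pou r A a x) - q b * (\<Sum>a\<in>A. pou r A a x)"
          unfolding one by (simp add: w_def)
        also have "\<dots> = (\<Sum>a\<in>A. (c a - q b) * pou r A a x)"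
          by (simp add: sum_distrib_left sum_subtractf[symmetric] left_diff_distrib)
        finally have "\<bar>w x - q b\<bar> \<le> (\<Sum>a\<in>A. \<bar>c a - q b\<bar> * pou r A a x)"
          using sum_abs[of "\<lambda>a. (c a - q b) * pou r A a x" A] by (simp add: abs_mult)
        also have "\<dots> \<le> (\<Sum>a\<in>A. Q b * pou r A a x)"
        proof (rule sum_mono)
          fix a assume a: "a \<in> A"
          show "\<bar>c a - q b\<bar> * pou r A a x \<le> Q b * pou r A a x"
          proof (cases "2 * r \<le> dist x a")
            case False
            then have "dist a b < 4 * r" using dist_triangle3[of a b x] b r by simp
            then show ?thesis using step[OF a b(1)] by (intro mult_right_mono) auto
          qed (simp add: pou_eq_0[OF r])
        qed
        also have "\<dots> = Q b" unfolding sum_distrib_left[symmetric] one by simp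
        finally have "\<bar>w x - u x\<bar> \<le> \<bar>u x - q b\<bar> + Q b" by linarith
        also have "\<dots> = indicator (BS b (5 * r)) x * \<bar>u x - q b\<bar> + indicator (BS b r) x * Q b"
          using b x r by (simp add: dist_commute)
        also have "\<dots> \<le> (\<Sum>b\<in>A. indicator (BS b (5 * r)) x * \<bar>u x - q b\<bar> + indicator (BS b r) x * Q b)"
          using Q0 by (intro member_le_sum[OF b(1) _ A(1)] add_nonneg_nonneg mult_nonneg_nonneg) auto
        finally show ?thesis .
      qed
      have i1: "integrable mu (\<lambda>x. indicator (BS b (5 * r)) x * \<bar>u x - q b\<bar>)" for b
        using ui by (intro integrable_BS integrable_abs Bochner_Integration.integrable_diff) auto
      have i2: "integrable mu (\<lambda>x. indicator (BS b r) x * Q b)" for b by (intro integrable_BS) auto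
      have "(\<integral>x. \<bar>w x - u x\<bar> \<partial>mu) \<le> (\<integral>x. (\<Sum>b\<in>A. indicator (BS b (5 * r)) x * \<bar>u x - q b\<bar> + indicator (BS b r) x * Q b) \<partial>mu)"
        using ui newton_integrable[OF wN] pt
        by (intro integral_mono Bochner_Integration.integrable_sum Bochner_Integration.integrable_add i1 i2 integrable_abs Bochner_Integration.integrable_diff) auto
      also have "\<dots> = (\<Sum>b\<in>A. (\<integral>x. indicator (BS b (5 * r)) x * \<bar>u x - q b\<bar> + indicator (BS b r) x * Q b \<partial>mu))"
        by (intro Bochner_Integration.integral_sum Bochner_Integration.integrable_add i1 i2)
      also have "\<dots> = (\<Sum>b\<in>A. (\<integral>x. indicator (BS b (5 * r)) x * \<bar>u x - q b\<bar> \<partial>mu) + m b r * Q b)"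
      proof (rule sum.cong[OF refl])
        fix b
        have "(\<integral>x. indicator (BS b r) x * Q b \<partial>mu) = m b r * Q b" unfolding m_def by simp
        then show "(\<integral>x. indicator (BS b (5 * r)) x * \<bar>u x - q b\<bar> + indicator (BS b r) x * Q b \<partial>mu)
          = (\<integral>x. indicator (BS b (5 * r)) x * \<bar>u x - q b\<bar> \<partial>mu) + m b r * Q b"
          by (subst Bochner_Integration.integral_add[OF i1 i2]) simp
      qed
      also have "\<dots> \<le> (\<Sum>b\<in>A. 10 * Cd ^ 4 * CP * r * (mb b + E b))"
      proof (rule sum_mono)
        fix b assume b: "b \<in> A"
        have "CP * (5 * r) * m b (5 * r) * t b \<le> Q b * mb b"
        proof -
          have "CP * (5 * r) * m b (5 * r) * t b \<le> CP * (5 * r) * mb b * t b"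
            using CP r t0 mle[of "5 * r" b] by (intro mult_right_mono mult_left_mono) auto
          also have "\<dots> \<le> Cd ^ 4 * (CP * (5 * r) * mb b * t b)"
            using Cd1[of 4] CP r t0 mb0[OF b] by (intro mult_right_mono[of 1 "Cd ^ 4", simplified]) auto
          finally show ?thesis by (simp add: Q_def mult_ac)
        qed
        moreover have "m b r * Q b \<le> Q b * mb b"
          using mle[of r b] r Q0[of b] by (subst mult.commute) (intro mult_left_mono, auto)
        ultimately have "(\<integral>x. indicator (BS b (5 * r)) x * \<bar>u x - q b\<bar> \<partial>mu) + m b r * Q b \<le> 2 * (Q b * mb b)"
          using Pb[OF b] by linarith
        \<comment> \<open>A root is at most 1 plus its radicand; this linear bound lets the local
          energies be summed.\<close>
        also have "t b \<le> 1 + E b / mb b"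
        proof (cases "E b / mb b \<le> 1")
          case True
          have "0 \<le> E b / mb b" using E0[of b] mb0[OF b] by simp
          then have "t b \<le> 1" unfolding t_def using True p by (simp add: powr_le1)
          then show ?thesis using \<open>0 \<le> E b / mb b\<close> by linarith
        next
          case False
          then have "t b \<le> (E b / mb b) powr 1" unfolding t_def using p by (intro powr_mono) auto
          then show ?thesis using False by simp
        qed
        then have "2 * (Q b * mb b) \<le> 2 * (Cd ^ 4 * CP * 5 * r * (1 + E b / mb b) * mb b)"
          unfolding Q_def using Cd1[of 4] CP r mb0[OF b] by (intro mult_left_mono mult_right_mono) auto
        also have "\<dots> = 10 * Cd ^ 4 * CP * r * (mb b + E b)" using mb0[OF b] by (simp add: field_simps)
        finally show "(\<integral>x. indicator (BS b (5 * r)) x * \<bar>u x - q b\<bar> \<partial>mu) + m b r * Q b \<le> 10 * Cd ^ 4 * CP * r * (mb b + E b)" .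
      qed
      also have "\<dots> = 10 * Cd ^ 4 * CP * r * ((\<Sum>b\<in>A. mb b) + (\<Sum>b\<in>A. E b))"
        by (simp only: sum_distrib_left[symmetric] sum.distrib)
      also have "\<dots> \<le> 10 * Cd ^ 4 * CP * r * (N * measure mu S + N * I)"
        using sumE sumM Cd1[of 4] CP r by (intro mult_left_mono add_mono) auto
      also have "\<dots> = (10 * Cd ^ 4 * CP * (N * (measure mu S + I))) * r" by (simp add: algebra_simps)
      also have "\<dots> \<le> C * r" using r by (intro mult_right_mono) (auto simp: C_def)
      finally show ?thesis .
    qed
    show "\<exists>w L. L-lipschitz_on S w \<and> (\<forall>x\<in>S. \<bar>w x\<bar> \<le> K) \<and> en w \<le> C \<and> (\<integral>x. \<bar>w x - u x\<bar> \<partial>mu) \<le> C * r"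
      using wlip wK enw L1 by blast
  qed
qed

text \<open>Bounded functions are reached by discrete convolutions, and arbitrary ones by
  truncations, which all share an upper gradient of \<open>u\<close>. In both passages only bounded
  energy and almost everywhere convergence are at hand, so both go through
  \<open>mazur_closure\<close>; a subsequence turns convergence of integrals into convergence almost
  everywhere.\<close>

lemma lipschitz_determine_functional:
  fixes \<Lambda> :: "('a \<Rightarrow> real) \<Rightarrow> real"
  assumes lin: "\<And>f g a b. f \<in> NN \<Longrightarrow> g \<in> NN \<Longrightarrow> \<Lambda> (\<lambda>x. a * f x + b * g x) = a * \<Lambda> f + b * \<Lambda> g"
    and cont: "\<And>z. (\<And>k. z k \<in> NN) \<Longrightarrow> (\<lambda>k. \<integral>x. \<bar>z k x\<bar> powr p \<partial>mu) \<longlonglongrightarrow> 0 \<Longrightarrow> (\<lambda>k. en (z k)) \<longlonglongrightarrow> 0 \<Longrightarrow> (\<lambda>k. \<Lambda> (z k)) \<longlonglongrightarrow> 0"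
    and zero: "\<And>w L. L-lipschitz_on S w \<Longrightarrow> \<Lambda> w = 0"
    and u: "u \<in> NN"
  shows "\<Lambda> u = 0"
proof -
  have bdd: "\<Lambda> v = 0" if v: "v \<in> NN" and K: "\<And>x. x \<in> S \<Longrightarrow> \<bar>v x\<bar> \<le> K" for v K
  proof -
    obtain C where C: "\<And>r. 0 < r \<Longrightarrow> \<exists>w L. L-lipschitz_on S w \<and> (\<forall>x\<in>S. \<bar>w x\<bar> \<le> K) \<and> en w \<le> C \<and> (\<integral>x. \<bar>w x - v x\<bar> \<partial>mu) \<le> C * r"
      using discrete_convolution[OF v K] by blast
    have "\<exists>w L. L-lipschitz_on S w \<and> (\<forall>x\<in>S. \<bar>w x\<bar> \<le> K) \<and> en w \<le> C \<and> (\<integral>x. \<bar>w x - v x\<bar> \<partial>mu) \<le> C * (1 / Suc n)" for n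
      by (rule C) simp
    then obtain w L where w: "\<And>n. (L n)-lipschitz_on S (w n)" "\<And>n x. x \<in> S \<Longrightarrow> \<bar>w n x\<bar> \<le> K" "\<And>n. en (w n) \<le> C"
      "\<And>n. (\<integral>x. \<bar>w n x - v x\<bar> \<partial>mu) \<le> C * (1 / Suc n)" by metis
    have wN: "w n \<in> NN" for n by (rule newton_lipschitz[OF w(1)])
    have "(\<lambda>n. C * (1 / real (Suc n))) \<longlonglongrightarrow> C * 0"
      by (intro tendsto_mult tendsto_const LIMSEQ_Suc[OF lim_1_over_n])
    then have l0: "(\<lambda>n. C * (1 / real (Suc n))) \<longlonglongrightarrow> 0" by simp
    have "(\<lambda>n. \<integral>x. norm (w n x - v x) \<partial>mu) \<longlonglongrightarrow> 0"
      by (rule tendsto_sandwich[OF _ _ tendsto_const l0]) (use w(4) in auto)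
    then obtain s :: "nat \<Rightarrow> nat" where s: "strict_mono s" "AE x in mu. (\<lambda>n. w (s n) x - v x) \<longlonglongrightarrow> 0"
      using tendsto_L1_AE_subseq[of mu "\<lambda>n x. w n x - v x"] newton_integrable[OF wN] newton_integrable[OF v] by auto
    show ?thesis
    proof (rule mazur_closure[of "\<lambda>n. w (s n)" v "\<lambda>_. K" C])
      show "AE x in mu. (\<lambda>n. w (s n) x) \<longlonglongrightarrow> v x"
        using s(2) by eventually_elim (simp add: LIM_zero_iff)
      show "\<Lambda> (w (s k)) = 0" for k by (rule zero[OF w(1)])
    qed (use wN v w(2,3) lin cont in auto)
  qed
  define T where "T k x = max (- real k) (min (real k) (u x))" for k x
  note [measurable] = newton_measurable[OF u]
  have Tm[measurable]: "T k \<in> borel_measurable mu" for k unfolding T_def by measurable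
  have Tk: "\<bar>T k x\<bar> \<le> real k" "\<bar>T k x\<bar> \<le> \<bar>u x\<bar>" for k x by (auto simp: T_def max_def min_def)
  have Tl: "\<bar>T k x - T k y\<bar> \<le> 1 * \<bar>u x - u y\<bar>" for k x y
    unfolding T_def using truncation_contracts[of "real k" "u x" "u y"] by simp
  have TN: "T k \<in> NN" for k
    by (rule newton_contract[OF u Tm Lp_bounded[OF Tm Tk(1)] _ Tl]) auto
  obtain g where g: "upper_gradient S u g" "pen g < \<infinity>" using u by (rule newtonE)
  have Tug: "upper_gradient S (T k) g" for k
    using upper_gradient_contract[OF g(1) _ Tl] by simp
  obtain P where P: "pen g = ennreal P" "0 \<le> P" using g(2) by (cases "pen g") auto
  show ?thesis
  proof (rule mazur_closure[of T u "\<lambda>x. \<bar>u x\<bar>" "CC powr p * P"])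
    show "AE x in mu. (\<lambda>k. T k x) \<longlonglongrightarrow> u x"
    proof (rule AE_I2)
      fix x
      obtain n where n: "\<bar>u x\<bar> \<le> real n" using real_arch_simple by blast
      have "T k x = u x" if "k \<ge> n" for k
      proof -
        have "\<bar>u x\<bar> \<le> real k" using that n by (meson of_nat_mono order.trans)
        then show ?thesis unfolding T_def by (auto simp: max_def min_def)
      qed
      then have "\<forall>\<^sub>F k in sequentially. T k x = u x" by (auto simp: eventually_sequentially)
      then show "(\<lambda>k. T k x) \<longlonglongrightarrow> u x" by (rule tendsto_eventually)
    qed
    show "en (T k) \<le> CC powr p * P" for k
    proof -
      have "ennreal (en (T k)) \<le> ennreal (CC powr p) * ennreal P"
        using en_le_pen[OF TN Tug g(2)] P by simp
      then have "ennreal (en (T k)) \<le> ennreal (CC powr p * P)" using P by (simp add: ennreal_mult)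
      then show ?thesis using P by simp
    qed
    show "\<Lambda> (T k) = 0" for k by (rule bdd[OF TN Tk(1)])
    show "integrable mu (\<lambda>x. \<bar>u x\<bar> powr p)" by (rule newton_Lp[OF u])
  qed (use TN u Tk lin cont in auto)
qed

end

section \<open>Geometry of John domains\<close>

text \<open>The John inequality at the last point of the curve, \<open>x0\<close>, bounds its entire
  length.\<close>

lemma john_domain_bounded:
  assumes "john_domain \<Omega> x0 CJ"
  shows "closure \<Omega> \<subseteq> cball x0 (CJ * infdist x0 (- \<Omega>))"
proof (rule closure_minimal)
  show "\<Omega> \<subseteq> cball x0 (CJ * infdist x0 (- \<Omega>))"
  proof
    fix x assume "x \<in> \<Omega>"
    then obtain \<gamma> a b where g: "rectifiable_curve \<gamma> a b" "\<gamma> a = x" "\<gamma> b = x0"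
      "\<forall>t \<in> {a..b}. curve_length \<gamma> a t \<le> ennreal CJ * ennreal (infdist (\<gamma> t) (- \<Omega>))"
      and CJ: "1 \<le> CJ"
      using assms unfolding john_domain_def by blast
    have ab: "a \<le> b" using g(1) by (simp add: rectifiable_curve_def)
    have "ennreal (dist x x0) \<le> curve_length \<gamma> a b"
      using dist_le_curve_length[of a a b b \<gamma>] ab g by simp
    also have "\<dots> \<le> ennreal CJ * ennreal (infdist x0 (- \<Omega>))" using g ab by force
    also have "\<dots> = ennreal (CJ * infdist x0 (- \<Omega>))"
      using CJ by (simp add: ennreal_mult infdist_nonneg)
    finally have "dist x x0 \<le> CJ * infdist x0 (- \<Omega>)"
      using CJ by (simp add: infdist_nonneg)
    then show "x \<in> cball x0 (CJ * infdist x0 (- \<Omega>))" by (simp add: dist_commute)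
  qed
qed simp

text \<open>Iterated doubling bounds the finite, positive total mass by \<open>Q ^ k\<close> times
  the mass of any ball of radius \<open>e/2\<close> centred in \<open>S\<close>; these balls are
  disjoint for a separated set, which bounds its cardinality. It precedes the use of the locales,
  whose assumptions include the compactness derived from it.\<close>

lemma doubling_imp_totally_bounded:
  assumes sets: "sets M = sets borel" and S: "closed S" "x0 \<in> S" "S \<subseteq> cball x0 R"
    and dbl: "doubling_on M S" and e: "0 < e"
  shows "\<exists>k. finite k \<and> S \<subseteq> (\<Union>x\<in>k. ball x e)"
proof -
  have R: "0 \<le> R" using S(2,3) by auto
  obtain C where C: "\<And>x r. x \<in> S \<Longrightarrow> 0 < r \<Longrightarrow> 0 < emeasure M (ball x (2*r) \<inter> S)
     \<and> emeasure M (ball x (2*r) \<inter> S) \<le> ennreal C * emeasure M (ball x r \<inter> S) \<and> emeasure M (ball x r \<inter> S) < \<infinity>"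
    using dbl unfolding doubling_on_def by blast
  \<comment> \<open>The doubling constant is an arbitrary real and \<open>ennreal C\<close> is 0 for
    negative \<open>C\<close>.\<close>
  define Q where "Q = max C 0"
  have iter: "emeasure M (ball x (2 ^ k * r) \<inter> S) \<le> ennreal (Q ^ k) * emeasure M (ball x r \<inter> S)"
    if "x \<in> S" "0 < r" for x r k
  proof (induction k)
    case (Suc k)
    have "emeasure M (ball x (2 ^ Suc k * r) \<inter> S) \<le> ennreal C * emeasure M (ball x (2 ^ k * r) \<inter> S)"
      using C[OF that(1), of "2 ^ k * r"] that by (simp add: mult.assoc)
    also have "\<dots> \<le> ennreal Q * (ennreal (Q ^ k) * emeasure M (ball x r \<inter> S))"
      by (intro mult_mono Suc ennreal_leI) (auto simp: Q_def)
    also have "\<dots> = ennreal (Q ^ Suc k) * emeasure M (ball x r \<inter> S)"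
      by (simp add: mult.assoc[symmetric] ennreal_mult[symmetric] Q_def)
    finally show ?case .
  qed simp
  have Sball: "S \<subseteq> ball x (2 * R + 1)" if "x \<in> S" for x
  proof
    fix y assume "y \<in> S"
    then have "dist x0 x \<le> R" "dist x0 y \<le> R" using S(3) that by auto
    then show "y \<in> ball x (2 * R + 1)" using dist_triangle3[of x y x0] by simp
  qed
  have eq: "ball x0 (2 * R + 1) \<inter> S = S" using Sball[OF S(2)] by blast
  have MS: "0 < emeasure M S" "emeasure M S < \<infinity>"
    using C[OF S(2), of "R + 1/2"] C[OF S(2), of "2 * R + 1"] R eq by (auto simp: distrib_left)
  obtain k where k: "(2 * R + 1) / (e/2) < 2 ^ k" using real_arch_pow[of 2 "(2 * R + 1) / (e/2)"] by auto
  have big: "emeasure M S \<le> ennreal (Q ^ k) * emeasure M (ball x (e/2) \<inter> S)" if "x \<in> S" for x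
  proof -
    have "2 * R + 1 \<le> 2 ^ k * (e/2)" using k e by (simp add: field_simps)
    then have "S \<subseteq> ball x (2 ^ k * (e/2)) \<inter> S" using Sball[OF that] subset_ball by blast
    moreover have "ball x (2 ^ k * (e/2)) \<inter> S \<in> sets M" using S(1) by (simp add: sets)
    ultimately have "emeasure M S \<le> emeasure M (ball x (2 ^ k * (e/2)) \<inter> S)" by (rule emeasure_mono)
    also have "\<dots> \<le> ennreal (Q ^ k) * emeasure M (ball x (e/2) \<inter> S)" by (rule iter[OF that]) (use e in simp)
    finally show ?thesis .
  qed
  have card: "real (card A) \<le> Q ^ k" if A: "finite A" "A \<subseteq> S" "separated e A" for A
  proof -
    have "of_nat (card A) * emeasure M S = (\<Sum>a\<in>A. emeasure M S)" by simp
    also have "\<dots> \<le> (\<Sum>a\<in>A. ennreal (Q ^ k) * emeasure M (ball a (e/2) \<inter> S))"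
      using A(2) by (intro sum_mono big) auto
    also have "\<dots> = ennreal (Q ^ k) * (\<Sum>a\<in>A. emeasure M (ball a (e/2) \<inter> S))" by (simp add: sum_distrib_left)
    also have "(\<Sum>a\<in>A. emeasure M (ball a (e/2) \<inter> S)) = emeasure M (\<Union>a\<in>A. ball a (e/2) \<inter> S)"
    proof (rule sum_emeasure[OF _ _ A(1)])
      show "(\<lambda>a. ball a (e/2) \<inter> S) ` A \<subseteq> sets M" using S(1) by (auto simp: sets)
      show "disjoint_family_on (\<lambda>a. ball a (e/2) \<inter> S) A"
        unfolding disjoint_family_on_def
      proof (intro ballI impI)
        fix a b assume ab: "a \<in> A" "b \<in> A" "a \<noteq> b"
        then have "e \<le> dist a b" using A(3) by (auto simp: separated_def)
        then show "ball a (e/2) \<inter> S \<inter> (ball b (e/2) \<inter> S) = {}" using dist_triangle_half_r[of _ a e b] by (force simp: dist_commute)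
      qed
    qed
    also have "\<dots> \<le> emeasure M S" using S(1) by (intro emeasure_mono) (auto simp: sets)
    finally have *: "of_nat (card A) * emeasure M S \<le> ennreal (Q ^ k) * emeasure M S" by (simp add: mult_left_mono)
    obtain c where c: "emeasure M S = ennreal c" "0 < c" using MS by (cases "emeasure M S") auto
    have "ennreal (real (card A) * c) \<le> ennreal (Q ^ k * c)"
      using * c by (simp add: ennreal_mult ennreal_of_nat_eq_real_of_nat Q_def)
    then have "real (card A) * c \<le> Q ^ k * c" using c by (simp add: Q_def)
    then show ?thesis using c by simp
  qed
  obtain n where n: "Q ^ k \<le> real n" using real_arch_simple by blast
  have "card A \<le> n" if "finite A" "A \<subseteq> S" "separated e A" for A
    using card[OF that] n by linarith
  then show ?thesis using maximal_separated_net[OF e, of S n] by metis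
qed

lemma john_doubling_compact:
  fixes \<Omega> :: "'a::complete_space set"
  assumes sets: "sets M = sets borel" and john: "john_domain \<Omega> x0 CJ" and dbl: "doubling_on M (closure \<Omega>)"
  shows "compact (closure \<Omega>)" "emeasure M (closure \<Omega>) < \<infinity>"
proof -
  have x0: "x0 \<in> closure \<Omega>" using john closure_subset unfolding john_domain_def by blast
  note sub = john_domain_bounded[OF john]
  show "compact (closure \<Omega>)"
    unfolding compact_eq_totally_bounded
    using doubling_imp_totally_bounded[OF sets closed_closure x0 sub dbl] by (simp add: complete_eq_closed)
  let ?R = "CJ * infdist x0 (- \<Omega>)"
  have "closure \<Omega> \<subseteq> ball x0 (\<bar>?R\<bar> + 1)" using sub by force
  then have "ball x0 (\<bar>?R\<bar> + 1) \<inter> closure \<Omega> = closure \<Omega>" by blast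
  moreover have "0 < \<bar>?R\<bar> + 1" by linarith
  ultimately show "emeasure M (closure \<Omega>) < \<infinity>"
    using dbl x0 unfolding doubling_on_def by metis
qed

text \<open>A point \<open>y\<close> of \<Omega> close to \<open>x\<close> is joined to
  \<open>x0\<close>, which is more than \<open>r/8\<close> away from \<open>y\<close>. Where the
  curve has moved a distance \<open>r/8\<close> from \<open>y\<close>, its length is at least that,
  so the John inequality keeps this point \<open>r / (8 * CJ)\<close> away from the complement. The
  ball found lies in \<open>ball x (r/2)\<close>, so balls belonging to \<open>r\<close>-separated
  boundary points are disjoint.\<close>

lemma john_porosity:
  assumes john: "john_domain \<Omega> x0 CJ" and op: "open \<Omega>"
    and x: "x \<in> closure \<Omega> - \<Omega>" and r: "0 < r" "r < infdist x0 (- \<Omega>)"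
  shows "\<exists>z. ball z (r / (8 * CJ)) \<subseteq> \<Omega> \<inter> ball x (r/2) \<and> dist x z \<le> r"
proof -
  have CJ: "1 \<le> CJ" using john by (simp add: john_domain_def)
  obtain y where y: "y \<in> \<Omega>" "dist y x < r/8" using x r by (auto simp: closure_approachable dest!: spec[of _ "r/8"])
  obtain \<gamma> a b where g: "rectifiable_curve \<gamma> a b" "\<gamma> a = y" "\<gamma> b = x0"
    "\<forall>t \<in> {a..b}. curve_length \<gamma> a t \<le> ennreal CJ * ennreal (infdist (\<gamma> t) (- \<Omega>))"
    using john y(1) unfolding john_domain_def by blast
  have ab: "a \<le> b" and cont: "continuous_on {a..b} \<gamma>" using g(1) by (auto simp: rectifiable_curve_def)
  have "infdist x0 (- \<Omega>) \<le> dist x0 x" using x by (intro infdist_le) auto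
  also have "\<dots> \<le> dist x0 y + dist y x" by (rule dist_triangle)
  finally have far: "r/8 \<le> dist (\<gamma> b) y" using r y g by simp
  have "\<exists>t. a \<le> t \<and> t \<le> b \<and> dist (\<gamma> t) y = r/8"
    using far r g(2) ab by (intro IVT') (auto intro!: continuous_intros cont)
  then obtain t where t: "a \<le> t" "t \<le> b" "dist (\<gamma> t) y = r/8" by blast
  have d: "dist (\<gamma> a) (\<gamma> t) = r/8" using t(3) g(2) by (simp add: dist_commute)
  have "ennreal (r/8) \<le> curve_length \<gamma> a t"
    using dist_le_curve_length[of a a t t \<gamma>] t(1) unfolding d by simp
  also have "\<dots> \<le> ennreal CJ * ennreal (infdist (\<gamma> t) (- \<Omega>))" using g(4) t by auto
  also have "\<dots> = ennreal (CJ * infdist (\<gamma> t) (- \<Omega>))" using CJ by (simp add: ennreal_mult infdist_nonneg)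
  finally have "r/8 \<le> CJ * infdist (\<gamma> t) (- \<Omega>)" using CJ by (simp add: infdist_nonneg)
  then have inf: "r / (8 * CJ) \<le> infdist (\<gamma> t) (- \<Omega>)" using CJ by (simp add: field_simps)
  have small: "r / (8 * CJ) \<le> r / 8" using CJ r by (intro divide_left_mono) auto
  have xt: "dist x (\<gamma> t) < r/4"
  proof -
    have "dist x (\<gamma> t) \<le> dist y x + dist y (\<gamma> t)" by (rule dist_triangle3)
    then show ?thesis using t y by (simp add: dist_commute)
  qed
  have "ball (\<gamma> t) (r / (8 * CJ)) \<subseteq> \<Omega> \<inter> ball x (r/2)"
  proof
    fix w assume "w \<in> ball (\<gamma> t) (r / (8 * CJ))"
    then have w: "dist (\<gamma> t) w < r / (8 * CJ)" by simp
    have "w \<in> \<Omega>"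
    proof (rule ccontr)
      assume "w \<notin> \<Omega>"
      then have "infdist (\<gamma> t) (- \<Omega>) \<le> dist (\<gamma> t) w" by (intro infdist_le) auto
      then show False using w inf by simp
    qed
    moreover have "dist x w \<le> dist x (\<gamma> t) + dist (\<gamma> t) w" by (rule dist_triangle)
    then have "dist x w < r/2" using xt w small r by simp
    ultimately show "w \<in> \<Omega> \<inter> ball x (r/2)" by simp
  qed
  moreover have "dist x (\<gamma> t) \<le> r" using xt r by simp
  ultimately show ?thesis by blast
qed

text \<open>By porosity, each boundary ball of a packing has mass comparable to that of a disjoint ball in
  \<open>\<Omega>\<close> close to the boundary; the mass of the boundary layer tends to zero.\<close>

lemma (in pi_space) boundary_null:
  assumes S: "S = closure \<Omega>" and op: "open \<Omega>" and john: "john_domain \<Omega> x0 CJ"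
  shows "measure mu (S - \<Omega>) = 0"
proof (cases "S - \<Omega> = {}")
  case False
  let ?B = "S - \<Omega>"
  have CJ: "1 \<le> CJ" and x0: "x0 \<in> \<Omega>" using john by (auto simp: john_domain_def)
  have clB: "closed ?B" unfolding S using op by (intro closed_Diff) auto
  have Bm[measurable]: "?B \<in> sets mu"
    unfolding sets_mu using op S_sets(2) by (auto simp: sets_restrict_space)
  define \<rho> where "\<rho> = infdist x0 (- \<Omega>)"
  have \<rho>: "0 < \<rho>"
  proof -
    have ne: "- \<Omega> \<noteq> {}" using False by auto
    have "closed (- \<Omega>)" using op by (simp add: closed_Compl)
    then have "infdist x0 (- \<Omega>) \<noteq> 0" using in_closed_iff_infdist_zero[OF _ ne, of x0] x0 by simp
    then show ?thesis unfolding \<rho>_def using infdist_nonneg[of x0 "- \<Omega>"] by linarith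
  qed
  \<comment> \<open>A ball of radius \<open>r\<close> about a boundary point lies in the ball of
    radius \<open>2 * r\<close> about the porosity centre, and \<open>2 * r\<close> is
    \<open>16 * CJ\<close> times the radius \<open>r / (8 * CJ)\<close>.\<close>
  obtain k where k: "16 * CJ < 2 ^ k" using real_arch_pow[of 2] by auto
  define V where "V r = {x \<in> \<Omega>. infdist x ?B < r}" for r
  have Vm[measurable]: "V r \<in> sets mu" for r
  proof -
    have "open (\<Omega> \<inter> {x. infdist x ?B < r})"
      using op by (intro open_Int open_Collect_less continuous_intros)
    moreover have "V r = S \<inter> (\<Omega> \<inter> {x. infdist x ?B < r})" unfolding V_def S using closure_subset by auto
    ultimately show ?thesis unfolding sets_mu by (auto simp: sets_restrict_space)
  qed
  have est: "measure mu ?B \<le> Cd ^ k * measure mu (V r)" if r: "0 < r" "r < \<rho>" for r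
  proof -
    obtain A where A: "finite A" "A \<subseteq> ?B" "separated r A" "?B \<subseteq> (\<Union>a\<in>A. ball a r)"
      using compact_separated_net[OF compact_S r(1), of ?B] by blast
    have "\<forall>a\<in>A. \<exists>z. ball z (r / (8 * CJ)) \<subseteq> \<Omega> \<inter> ball a (r/2) \<and> dist a z \<le> r"
      using john_porosity[OF john op _ r(1)] r(2) A(2) S unfolding \<rho>_def by blast
    then obtain z where z: "\<And>a. a \<in> A \<Longrightarrow> ball (z a) (r / (8 * CJ)) \<subseteq> \<Omega> \<inter> ball a (r/2)"
      "\<And>a. a \<in> A \<Longrightarrow> dist a (z a) \<le> r" by metis
    have rpos: "0 < r / (8 * CJ)" using r CJ by simp
    have zS: "z a \<in> S" if "a \<in> A" for a
    proof -
      have "z a \<in> ball (z a) (r / (8 * CJ))" using rpos by (simp only: centre_in_ball)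
      then show ?thesis using z(1)[OF that] closure_subset unfolding S by blast
    qed
    have "measure mu ?B \<le> measure mu (\<Union>a\<in>A. BS a r)"
    proof (rule finite_measure_mono)
      show "?B \<subseteq> (\<Union>a\<in>A. BS a r)" using A(4) by blast
      show "(\<Union>a\<in>A. BS a r) \<in> sets mu" using A(1) by (intro sets.finite_UN BS_sets)
    qed
    also have "\<dots> \<le> (\<Sum>a\<in>A. m a r)"
      unfolding m_def using A(1) by (intro finite_measure_subadditive_finite) auto
    also have "\<dots> \<le> (\<Sum>a\<in>A. Cd ^ k * m (z a) (r / (8 * CJ)))"
    proof (rule sum_mono)
      fix a assume a: "a \<in> A"
      have "dist a (z a) + r \<le> (16 * CJ) * (r / (8 * CJ))" using z(2)[OF a] CJ by simp
      also have "\<dots> \<le> 2 ^ k * (r / (8 * CJ))" using k rpos by (intro mult_right_mono) auto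
      finally show "m a r \<le> Cd ^ k * m (z a) (r / (8 * CJ))" by (rule m_compare[OF zS[OF a] rpos])
    qed
    also have "\<dots> = Cd ^ k * (\<Sum>a\<in>A. measure mu (BS (z a) (r / (8 * CJ))))"
      by (simp add: sum_distrib_left m_def)
    also have "(\<Sum>a\<in>A. measure mu (BS (z a) (r / (8 * CJ)))) = measure mu (\<Union>a\<in>A. BS (z a) (r / (8 * CJ)))"
    proof (rule finite_measure_finite_Union[symmetric])
      show "disjoint_family_on (\<lambda>a. BS (z a) (r / (8 * CJ))) A"
        unfolding disjoint_family_on_def
      proof (intro ballI impI)
        fix a b assume ab: "a \<in> A" "b \<in> A" "a \<noteq> b"
        then have "r \<le> dist a b" using A(3) by (auto simp: separated_def)
        then have "ball a (r/2) \<inter> ball b (r/2) = {}" using dist_triangle_half_r[of _ a r b] by (force simp: dist_commute)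
        then show "BS (z a) (r / (8 * CJ)) \<inter> BS (z b) (r / (8 * CJ)) = {}" using z(1)[OF ab(1)] z(1)[OF ab(2)] by blast
      qed
    qed (use A(1) in auto)
    also have "\<dots> \<le> measure mu (V r)"
    proof (intro finite_measure_mono subsetI)
      fix x assume "x \<in> (\<Union>a\<in>A. BS (z a) (r / (8 * CJ)))"
      then obtain a where a: "a \<in> A" "x \<in> ball (z a) (r / (8 * CJ))" by auto
      then have xa: "x \<in> \<Omega>" "dist x a < r/2" using z(1)[OF a(1)] by (auto simp: dist_commute)
      have "infdist x ?B \<le> dist x a" using a A(2) by (intro infdist_le) auto
      then show "x \<in> V r" using xa r by (simp add: V_def)
    qed measurable
    finally show ?thesis using Cd_spec by (simp add: mult_left_mono)
  qed
  have "(\<lambda>n. measure mu (V (1 / Suc n))) \<longlonglongrightarrow> measure mu (\<Inter>n. V (1 / Suc n))"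
  proof (rule finite_Lim_measure_decseq)
    show "decseq (\<lambda>n. V (1 / real (Suc n)))"
    proof (rule decseq_SucI)
      fix n
      have "1 / real (Suc (Suc n)) \<le> 1 / real (Suc n)" by (intro frac_le) auto
      then show "V (1 / real (Suc (Suc n))) \<subseteq> V (1 / real (Suc n))"
        unfolding V_def by (blast intro: less_le_trans)
    qed
  qed auto
  moreover have "(\<Inter>n. V (1 / real (Suc n))) = {}"
  proof -
    have False if "\<And>n. x \<in> V (1 / real (Suc n))" for x
    proof -
      have "infdist x ?B \<le> 0"
      proof (rule field_le_epsilon)
        fix e :: real assume "0 < e"
        then obtain n where "1 / real (Suc n) < e" by (rule nat_approx_posE)
        then show "infdist x ?B \<le> 0 + e" using that[of n] by (simp add: V_def)
      qed
      then have "infdist x ?B = 0" using infdist_nonneg[of x ?B] by linarith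
      then have "x \<in> ?B" using in_closed_iff_infdist_zero[OF clB False] by simp
      then show False using that[of 0] by (simp add: V_def)
    qed
    then show ?thesis by blast
  qed
  ultimately have lim: "(\<lambda>n. Cd ^ k * measure mu (V (1 / Suc n))) \<longlonglongrightarrow> Cd ^ k * 0"
    by (intro tendsto_mult tendsto_const) simp
  have "\<forall>\<^sub>F n in sequentially. measure mu ?B \<le> Cd ^ k * measure mu (V (1 / Suc n))"
  proof -
    obtain n0 where "1 / real (Suc n0) < \<rho>" using \<rho> by (rule nat_approx_posE)
    moreover have "1 / real (Suc n) \<le> 1 / real (Suc n0)" if "n0 \<le> n" for n using that by (simp add: frac_le)
    ultimately have "measure mu ?B \<le> Cd ^ k * measure mu (V (1 / Suc n))" if "n0 \<le> n" for n
      using that by (intro est) (auto intro: le_less_trans)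
    then show ?thesis by (auto simp: eventually_sequentially)
  qed
  then have "measure mu ?B \<le> Cd ^ k * 0" by (intro tendsto_lowerbound[OF lim]) auto
  then show ?thesis using measure_nonneg[of mu ?B] by simp
next
  case True
  show ?thesis unfolding True by simp
qed

section \<open>Traces and the variational problem\<close>

text \<open>The assumption \<open>bnull\<close> is supplied by \<open>boundary_null\<close>; it is
  the form in which the geometry of the domain enters the variational part, besides the facts about
  the closure.\<close>

locale neumann_space = pi_space M p S D ip
  for M :: "'a::metric_space measure" and p S and D :: "('a \<Rightarrow> real) \<Rightarrow> 'a \<Rightarrow> real^'n" and ip +
  fixes \<Omega> :: "'a set" and \<nu> :: "'a measure" and T :: "('a \<Rightarrow> real) \<Rightarrow> 'a \<Rightarrow> real" and f :: "'a \<Rightarrow> real"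
  assumes S_eq: "S = closure \<Omega>" and op: "open \<Omega>"
    and bnull: "measure mu (S - \<Omega>) = 0"
    and nu_sets: "sets \<nu> = sets borel"
    and nu_supp: "emeasure \<nu> (- (S - \<Omega>)) = 0"
    and trace_meas: "\<And>w. w \<in> NN \<Longrightarrow> T w \<in> borel_measurable \<nu>"
    and trace_lebesgue: "\<And>w. w \<in> NN \<Longrightarrow> AE x in \<nu>.
           ((\<lambda>r. (\<integral>\<^sup>+ y \<in> ball x r \<inter> \<Omega>. ennreal \<bar>w y - T w x\<bar> \<partial>M) / emeasure M (ball x r \<inter> \<Omega>))
              \<longlongrightarrow> 0) (at_right 0)"
    and trace_linear: "\<And>w v a b. w \<in> NN \<Longrightarrow> v \<in> NN \<Longrightarrow> AE x in \<nu>. T (\<lambda>y. a * w y + b * v y) x = a * T w x + b * T v x"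
    and trace_bounded: "\<exists>C. \<forall>w \<in> NN. \<forall>g. upper_gradient S w g \<longrightarrow>
           (\<integral>\<^sup>+ x. ennreal (\<bar>T w x\<bar> powr p) \<partial>\<nu>)
             \<le> ennreal C * ((\<integral>\<^sup>+ x \<in> S. ennreal (\<bar>w x\<bar> powr p) \<partial>M)
                             + (\<integral>\<^sup>+ x \<in> S. enn_powr (g x) p \<partial>M))"
    and f_meas [measurable]: "f \<in> borel_measurable \<nu>"
    and f_Lp': "(\<integral>\<^sup>+ x. ennreal (\<bar>f x\<bar> powr (p / (p - 1))) \<partial>\<nu>) < \<infinity>"
begin

abbreviation bd :: "'a set" where "bd \<equiv> S - \<Omega>"

lemma Omega_sub: "\<Omega> \<subseteq> S" unfolding S_eq by (rule closure_subset)

lemma bd_closed: "closed bd" unfolding S_eq using op by (intro closed_Diff) auto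

lemma sets_muI: "A \<in> sets borel \<Longrightarrow> A \<subseteq> S \<Longrightarrow> A \<in> sets mu"
  unfolding sets_mu sets_restrict_space by (intro image_eqI[of _ _ A]) auto

lemma bd_sets_mu [measurable]: "bd \<in> sets mu" "\<Omega> \<in> sets mu"
  using op Omega_sub bd_closed by (intro sets_muI borel_open borel_closed; blast)+

lemma AE_Omega: "AE x in mu. x \<in> \<Omega>"
  using bnull by (intro AE_I[of _ _ bd]) (auto simp: emeasure_eq_measure)

lemma AE_bd: "AE x in \<nu>. x \<in> bd"
proof (rule AE_I[of _ _ "- bd"])
  show "- bd \<in> sets \<nu>" unfolding nu_sets by (rule borel_comp[OF borel_closed[OF bd_closed]])
qed (use nu_supp in auto)

lemma set_integral_Omega:
  fixes F :: "'a \<Rightarrow> real"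
  assumes [measurable]: "F \<in> borel_measurable mu" shows "(LINT x:\<Omega>|M. F x) = (\<integral>x. F x \<partial>mu)"
proof -
  have "(LINT x:\<Omega>|M. F x) = (LINT x:S|M. indicator \<Omega> x * F x)"
    unfolding set_lebesgue_integral_def using Omega_sub
    by (intro Bochner_Integration.integral_cong) (auto simp: indicator_def)
  also have "\<dots> = (\<integral>x. indicator \<Omega> x * F x \<partial>mu)" by (rule set_integral_mu)
  also have "\<dots> = (\<integral>x. F x \<partial>mu)"
    using AE_Omega by (intro integral_cong_AE) auto
  finally show ?thesis .
qed

lemma emeasure_ball_Omega:
  assumes "x \<in> bd" "0 < r"
  shows "0 < emeasure M (ball x r \<inter> \<Omega>)" "emeasure M (ball x r \<inter> \<Omega>) < \<infinity>"
proof -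
  have s: "ball x r \<inter> \<Omega> \<in> sets M" using op by (simp add: sets_M)
  have "emeasure M (ball x r \<inter> \<Omega>) \<le> emeasure M (BS x r)"
    using Omega_sub S_sets by (intro emeasure_mono) (auto simp: sets_M)
  then show "emeasure M (ball x r \<inter> \<Omega>) < \<infinity>" by (simp add: emeasure_BS le_less_trans)
  have "x \<in> closure \<Omega>" using assms S_eq by auto
  then obtain y where y: "y \<in> \<Omega>" "dist y x < r" using assms(2) unfolding closure_approachable by blast
  then have "y \<in> ball x r \<inter> \<Omega>" by (simp add: dist_commute)
  then obtain e where e: "0 < e" "ball y e \<subseteq> ball x r \<inter> \<Omega>"
    using op by (meson open_Int open_ball open_contains_ball)
  have "0 < emeasure M (BS y e)" using m_pos[of y e] y Omega_sub e by (auto simp: emeasure_BS)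
  also have "\<dots> \<le> emeasure M (ball x r \<inter> \<Omega>)" using e s by (intro emeasure_mono) auto
  finally show "0 < emeasure M (ball x r \<inter> \<Omega>)" .
qed

text \<open>If the trace differed from the limit of \<open>w\<close> at \<open>x\<close>, then
  \<open>\<bar>w y - T w x\<bar>\<close> would stay above half the gap on \<Omega> near
  \<open>x\<close>, and its averages could not tend to zero. Division by the mass of
  \<open>ball x r \<inter> \<Omega>\<close> is harmless by
  \<open>emeasure_ball_Omega\<close>.\<close>

lemma trace_eq:
  assumes w: "w \<in> NN" and lim: "\<And>x. x \<in> bd \<Longrightarrow> (w \<longlongrightarrow> w x) (at x within S)"
  shows "AE x in \<nu>. T w x = w x"
  using trace_lebesgue[OF w] AE_bd
proof eventually_elim
  case (elim x)
  show ?case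
  proof (rule ccontr)
    assume ne: "T w x \<noteq> w x"
    define d where "d = \<bar>w x - T w x\<bar> / 2"
    have d: "0 < d" using ne by (simp add: d_def)
    have "\<forall>\<^sub>F y in at x within S. dist (w y) (w x) < d" using lim[OF elim(2)] d by (rule tendstoD)
    then obtain e where e: "0 < e" "\<And>y. y \<in> S \<Longrightarrow> y \<noteq> x \<Longrightarrow> dist y x < e \<Longrightarrow> dist (w y) (w x) < d"
      unfolding eventually_at by blast
    have near: "d \<le> \<bar>w y - T w x\<bar>" if "y \<in> \<Omega>" "dist x y < e" for y
    proof -
      have "y \<noteq> x" "y \<in> S" using that elim(2) Omega_sub by auto
      then have "\<bar>w y - w x\<bar> < d" using e(2)[of y] that by (simp add: dist_real_def dist_commute)
      then show ?thesis unfolding d_def by (simp add: abs_if split: if_splits)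
    qed
    have ge: "ennreal d \<le> (\<integral>\<^sup>+ y \<in> ball x r \<inter> \<Omega>. ennreal \<bar>w y - T w x\<bar> \<partial>M) / emeasure M (ball x r \<inter> \<Omega>)"
      if r: "0 < r" "r < e" for r
    proof -
      note em = emeasure_ball_Omega[OF elim(2) r(1)]
      have "ennreal d * emeasure M (ball x r \<inter> \<Omega>) = (\<integral>\<^sup>+ y \<in> ball x r \<inter> \<Omega>. ennreal d \<partial>M)"
        using op by (subst nn_integral_cmult_indicator) (auto simp: sets_M)
      also have "\<dots> \<le> (\<integral>\<^sup>+ y \<in> ball x r \<inter> \<Omega>. ennreal \<bar>w y - T w x\<bar> \<partial>M)"
        using near r by (intro nn_integral_mono) (auto simp: indicator_def intro!: ennreal_leI)
      finally have "ennreal d * emeasure M (ball x r \<inter> \<Omega>) / emeasure M (ball x r \<inter> \<Omega>)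
        \<le> (\<integral>\<^sup>+ y \<in> ball x r \<inter> \<Omega>. ennreal \<bar>w y - T w x\<bar> \<partial>M) / emeasure M (ball x r \<inter> \<Omega>)"
        by (rule divide_right_mono_ennreal)
      then show ?thesis using em by (simp add: ennreal_mult_divide_eq)
    qed
    have "\<forall>\<^sub>F r in at_right 0. (\<integral>\<^sup>+ y \<in> ball x r \<inter> \<Omega>. ennreal \<bar>w y - T w x\<bar> \<partial>M) / emeasure M (ball x r \<inter> \<Omega>) < ennreal d"
      using elim(1) d by (intro order_tendstoD(2)) auto
    moreover have "\<forall>\<^sub>F r in at_right 0. r < e \<and> 0 < r"
      using e(1) by (auto simp: eventually_at_right_field)
    ultimately have "\<forall>\<^sub>F r in at_right (0::real). False"
      by eventually_elim (use ge in \<open>auto simp: not_less[symmetric]\<close>)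
    then show False by (simp add: trivial_limit_at_right_real)
  qed
qed

text \<open>The trace bound holds for every upper gradient; choosing nearly optimal ones replaces
  their energy by \<open>CC * en w\<close>, with a slack that is sent to zero.\<close>

lemma trace_Lp:
  "\<exists>C\<ge>0. \<forall>w\<in>NN. integrable \<nu> (\<lambda>x. \<bar>T w x\<bar> powr p) \<and>
    (\<integral>x. \<bar>T w x\<bar> powr p \<partial>\<nu>) \<le> C * ((\<integral>x. \<bar>w x\<bar> powr p \<partial>mu) + en w)"
proof -
  obtain C0 where C0: "\<And>w g. w \<in> NN \<Longrightarrow> upper_gradient S w g \<Longrightarrow>
    (\<integral>\<^sup>+ x. ennreal (\<bar>T w x\<bar> powr p) \<partial>\<nu>) \<le> ennreal C0 * ((\<integral>\<^sup>+ x. ennreal (\<bar>w x\<bar> powr p) \<partial>mu) + pen g)"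
    using trace_bounded unfolding nn_integral_mu pen_def by blast
  define C where "C = max C0 0"
  have C: "0 \<le> C" by (simp add: C_def)
  show ?thesis
  proof (intro exI[of _ "C * CC"] conjI ballI)
    show "0 \<le> C * CC" using C CC_ge_1 by simp
    fix w assume w: "w \<in> NN"
    note [measurable] = trace_meas[OF w]
    let ?L = "\<integral>x. \<bar>w x\<bar> powr p \<partial>mu"
    have L0: "0 \<le> ?L" by (intro integral_nonneg_AE) auto
    have Lw: "(\<integral>\<^sup>+ x. ennreal (\<bar>w x\<bar> powr p) \<partial>mu) = ennreal ?L"
      by (rule nn_integral_eq_integral[OF newton_Lp[OF w]]) auto
    have bound: "(\<integral>\<^sup>+ x. ennreal (\<bar>T w x\<bar> powr p) \<partial>\<nu>) \<le> ennreal (C * (?L + (CC * en w + e)))" if e: "0 < e" for e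
    proof -
      obtain h where h: "upper_gradient S w h" "pen h \<le> ennreal (CC * en w + e)"
        using upper_gradient_energy[OF w e] by blast
      have "(\<integral>\<^sup>+ x. ennreal (\<bar>T w x\<bar> powr p) \<partial>\<nu>) \<le> ennreal C0 * (ennreal ?L + pen h)"
        using C0[OF w h(1)] Lw by simp
      also have "\<dots> \<le> ennreal C * (ennreal ?L + ennreal (CC * en w + e))"
        by (intro mult_mono add_mono h ennreal_leI) (auto simp: C_def)
      also have "\<dots> = ennreal (C * (?L + (CC * en w + e)))"
        using C L0 CC_ge_1 en_nonneg[of w] e by (simp add: ennreal_mult ennreal_plus)
      finally show ?thesis .
    qed
    show int: "integrable \<nu> (\<lambda>x. \<bar>T w x\<bar> powr p)"
      using bound[of 1] by (intro integrableI_bounded) (auto simp: le_less_trans)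
    have "(\<integral>x. \<bar>T w x\<bar> powr p \<partial>\<nu>) \<le> C * (?L + CC * en w) + e" if e: "0 < e" for e
    proof -
      have "0 < e / (C + 1)" using e C by simp
      from bound[OF this] have "ennreal (\<integral>x. \<bar>T w x\<bar> powr p \<partial>\<nu>) \<le> ennreal (C * (?L + (CC * en w + e / (C + 1))))"
        by (subst nn_integral_eq_integral[OF int, symmetric]) auto
      moreover have "0 \<le> C * (?L + (CC * en w + e / (C + 1)))"
        using C L0 CC_ge_1 en_nonneg[of w] e by simp
      ultimately have "(\<integral>x. \<bar>T w x\<bar> powr p \<partial>\<nu>) \<le> C * (?L + (CC * en w + e / (C + 1)))" by simp
      also have "\<dots> = C * (?L + CC * en w) + C / (C + 1) * e" by (simp add: algebra_simps)
      also have "C / (C + 1) * e \<le> 1 * e" using C e by (intro mult_right_mono) auto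
      finally show ?thesis by simp
    qed
    then have "(\<integral>x. \<bar>T w x\<bar> powr p \<partial>\<nu>) \<le> C * (?L + CC * en w)" by (rule field_le_epsilon)
    also have "\<dots> \<le> C * (CC * ?L + CC * en w)"
      using C L0 CC_ge_1 mult_right_mono[of 1 CC ?L] by (intro mult_left_mono) auto
    finally show "(\<integral>x. \<bar>T w x\<bar> powr p \<partial>\<nu>) \<le> C * CC * (?L + en w)" by (simp add: algebra_simps)
  qed
qed

lemma f_integrable: "integrable \<nu> (\<lambda>x. \<bar>f x\<bar> powr (p / (p - 1)))"
  using f_Lp' by (intro integrableI_bounded) auto

lemma trace_young:
  assumes s: "0 < s"
  shows "\<bar>T w x * f x\<bar> \<le> s powr (- p) * \<bar>T w x\<bar> powr p + s powr (p / (p - 1)) * \<bar>f x\<bar> powr (p / (p - 1))"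
proof -
  have "\<bar>T w x * f x\<bar> = (\<bar>T w x\<bar> / s) * (s * \<bar>f x\<bar>)" using s by (simp add: abs_mult)
  also have "\<dots> \<le> (\<bar>T w x\<bar> / s) powr p + (s * \<bar>f x\<bar>) powr (p / (p - 1))"
    using s p by (intro young_weak) auto
  also have "\<dots> = s powr (- p) * \<bar>T w x\<bar> powr p + s powr (p / (p - 1)) * \<bar>f x\<bar> powr (p / (p - 1))"
    using s by (simp add: powr_divide powr_minus_divide powr_mult)
  finally show ?thesis .
qed

lemma trace_Lp_integrable: "w \<in> NN \<Longrightarrow> integrable \<nu> (\<lambda>x. \<bar>T w x\<bar> powr p)"
  using trace_Lp by blast

lemma Tf_integrable: assumes w: "w \<in> NN" shows "integrable \<nu> (\<lambda>x. T w x * f x)"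
proof (rule Bochner_Integration.integrable_bound)
  note [measurable] = trace_meas[OF w]
  show "integrable \<nu> (\<lambda>x. \<bar>T w x\<bar> powr p + \<bar>f x\<bar> powr (p / (p - 1)))"
    using trace_Lp_integrable[OF w] f_integrable by simp
  show "AE x in \<nu>. norm (T w x * f x) \<le> norm (\<bar>T w x\<bar> powr p + \<bar>f x\<bar> powr (p / (p - 1)))"
    using trace_young[of 1 w] by (intro AE_I2) (simp add: abs_of_nonneg)
  show "(\<lambda>x. T w x * f x) \<in> borel_measurable \<nu>" by measurable
qed

lemma Tf_integral_le:
  assumes w: "w \<in> NN" and s: "0 < s"
  shows "\<bar>\<integral>x. T w x * f x \<partial>\<nu>\<bar> \<le> s powr (- p) * (\<integral>x. \<bar>T w x\<bar> powr p \<partial>\<nu>) + s powr (p / (p - 1)) * (\<integral>x. \<bar>f x\<bar> powr (p / (p - 1)) \<partial>\<nu>)"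
proof -
  have "\<bar>\<integral>x. T w x * f x \<partial>\<nu>\<bar> \<le> (\<integral>x. \<bar>T w x * f x\<bar> \<partial>\<nu>)" by (rule integral_abs_bound)
  also have "\<dots> \<le> (\<integral>x. s powr (- p) * \<bar>T w x\<bar> powr p + s powr (p / (p - 1)) * \<bar>f x\<bar> powr (p / (p - 1)) \<partial>\<nu>)"
    using Tf_integrable[OF w] trace_Lp_integrable[OF w] f_integrable trace_young[OF s]
    by (intro integral_mono integrable_abs Bochner_Integration.integrable_add integrable_mult_right) auto
  also have "\<dots> = s powr (- p) * (\<integral>x. \<bar>T w x\<bar> powr p \<partial>\<nu>) + s powr (p / (p - 1)) * (\<integral>x. \<bar>f x\<bar> powr (p / (p - 1)) \<partial>\<nu>)"
    using trace_Lp_integrable[OF w] f_integrable by simp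
  finally show ?thesis .
qed

definition data :: "('a \<Rightarrow> real) \<Rightarrow> real" where "data w = (\<integral>x. T w x * f x \<partial>\<nu>)"

lemma data_lincomb:
  assumes w: "w \<in> NN" and v: "v \<in> NN"
  shows "data (\<lambda>x. a * w x + b * v x) = a * data w + b * data v"
proof -
  note [measurable] = trace_meas[OF w] trace_meas[OF v] trace_meas[OF newton_lincomb[OF w v]]
  have "data (\<lambda>x. a * w x + b * v x) = (\<integral>x. a * (T w x * f x) + b * (T v x * f x) \<partial>\<nu>)"
    unfolding data_def
  proof (rule integral_cong_AE)
    show "AE x in \<nu>. T (\<lambda>x. a * w x + b * v x) x * f x = a * (T w x * f x) + b * (T v x * f x)"
      using trace_linear[OF w v, of a b] by eventually_elim (simp add: algebra_simps)
  qed measurable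
  also have "\<dots> = a * data w + b * data v"
    unfolding data_def using Tf_integrable[OF w] Tf_integrable[OF v] by simp
  finally show ?thesis .
qed

lemma data_tendsto_zero:
  assumes z: "\<And>k. z k \<in> NN" and l: "(\<lambda>k. \<integral>x. \<bar>z k x\<bar> powr p \<partial>mu) \<longlonglongrightarrow> 0" "(\<lambda>k. en (z k)) \<longlonglongrightarrow> 0"
  shows "(\<lambda>k. data (z k)) \<longlonglongrightarrow> 0"
proof -
  obtain C where C: "0 \<le> C" "\<And>w. w \<in> NN \<Longrightarrow> (\<integral>x. \<bar>T w x\<bar> powr p \<partial>\<nu>) \<le> C * ((\<integral>x. \<bar>w x\<bar> powr p \<partial>mu) + en w)"
    using trace_Lp by blast
  have "(\<lambda>k. C * ((\<integral>x. \<bar>z k x\<bar> powr p \<partial>mu) + en (z k))) \<longlonglongrightarrow> C * (0 + 0)"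
    by (intro tendsto_intros l)
  then have l0: "(\<lambda>k. C * ((\<integral>x. \<bar>z k x\<bar> powr p \<partial>mu) + en (z k))) \<longlonglongrightarrow> 0" by simp
  show ?thesis
  proof (rule tendsto_zero_from_young[OF p _ l0])
    fix k and s :: real assume s: "0 < s"
    have "s powr (- p) * (\<integral>x. \<bar>T (z k) x\<bar> powr p \<partial>\<nu>) \<le> s powr (- p) * (C * ((\<integral>x. \<bar>z k x\<bar> powr p \<partial>mu) + en (z k)))"
      using C(2)[OF z] by (intro mult_left_mono) auto
    then show "\<bar>data (z k)\<bar> \<le> s powr (- p) * (C * ((\<integral>x. \<bar>z k x\<bar> powr p \<partial>mu) + en (z k)))
      + s powr (p / (p - 1)) * (\<integral>x. \<bar>f x\<bar> powr (p / (p - 1)) \<partial>\<nu>)"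
      using Tf_integral_le[OF z s] unfolding data_def by (meson add_right_mono order.trans)
  qed
qed

section \<open>Weak solutions and minimizers\<close>

abbreviation flux :: "('a \<Rightarrow> real) \<Rightarrow> ('a \<Rightarrow> real) \<Rightarrow> real" where
  "flux u \<phi> \<equiv> (\<integral>x. pflux D ip p u \<phi> x \<partial>mu)"

lemma flux_tendsto_zero:
  assumes u: "u \<in> NN" and z: "\<And>k. z k \<in> NN" and l: "(\<lambda>k. en (z k)) \<longlonglongrightarrow> 0"
  shows "(\<lambda>k. flux u (z k)) \<longlonglongrightarrow> 0"
  by (rule tendsto_zero_from_young[OF p pflux_integral_le[OF u z] l])

text \<open>The defect \<open>flux u w - data w\<close> is linear in \<open>w\<close> and continuous
  for the Newton norm, hence zero once it is zero on Lipschitz functions.\<close>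

lemma weak_solution_if_lipschitz:
  assumes u: "u \<in> NN" and lip: "\<And>w L. L-lipschitz_on S w \<Longrightarrow> flux u w = data w" and \<phi>: "\<phi> \<in> NN"
  shows "flux u \<phi> = data \<phi>"
proof -
  have "flux u \<phi> - data \<phi> = 0"
  proof (rule lipschitz_determine_functional[of "\<lambda>w. flux u w - data w", OF _ _ _ \<phi>])
    fix g h a b assume g: "g \<in> NN" "h \<in> NN"
    show "flux u (\<lambda>x. a * g x + b * h x) - data (\<lambda>x. a * g x + b * h x) = a * (flux u g - data g) + b * (flux u h - data h)"
      unfolding pflux_lincomb[OF u g] data_lincomb[OF g] by (simp add: algebra_simps)
  next
    fix z assume z: "\<And>k :: nat. z k \<in> NN" "(\<lambda>k. \<integral>x. \<bar>z k x\<bar> powr p \<partial>mu) \<longlonglongrightarrow> 0" "(\<lambda>k. en (z k)) \<longlonglongrightarrow> 0"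
    show "(\<lambda>k. flux u (z k) - data (z k)) \<longlonglongrightarrow> 0"
      using tendsto_diff[OF flux_tendsto_zero[OF u z(1,3)] data_tendsto_zero[OF z]] by simp
  qed (use lip in simp)
  then show ?thesis by simp
qed

text \<open>Convexity at \<open>u\<close> in the direction \<open>v - u\<close>, integrated; the
  weak identity evaluates the linear term.\<close>

lemma weak_imp_minimizer:
  assumes u: "u \<in> NN" and v: "v \<in> NN" and weak: "\<And>\<phi>. \<phi> \<in> NN \<Longrightarrow> flux u \<phi> = data \<phi>"
  shows "en u - p * data u \<le> en v - p * data v"
proof -
  have d: "(\<lambda>x. v x - u x) \<in> NN" using newton_diff[OF v u] .
  have "en u + p * flux u (\<lambda>x. v x - u x) = (\<integral>x. G u x powr p + p * pflux D ip p u (\<lambda>x. v x - u x) x \<partial>mu)"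
    unfolding en_def using G_integrable[OF u] pflux_integrable[OF u d] by simp
  also have "\<dots> \<le> en v"
    unfolding en_def
  proof (rule integral_mono_AE)
    show "AE x in mu. G u x powr p + p * pflux D ip p u (\<lambda>x. v x - u x) x \<le> G v x powr p"
      using D_diff[OF v u] AE_space
    proof eventually_elim
      case (elim x)
      then interpret inner_form "ip x" by (intro inner) simp
      show ?case using elim gradient_inequality[OF p, of "D u x" "D v x"] by (simp add: G_def pflux_def cnorm_nm)
    qed
  qed (use G_integrable[OF u] pflux_integrable[OF u d] G_integrable[OF v] in auto)
  finally have "en u + p * flux u (\<lambda>x. v x - u x) \<le> en v" .
  moreover have "data (\<lambda>x. v x - u x) = data v - data u" using data_lincomb[OF v u, of 1 "-1"] by simp
  ultimately show ?thesis using weak[OF d] by (simp add: right_diff_distrib)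
qed

text \<open>Continuity of the flux along a ray takes the place of differentiating the energy under
  the integral. A sequence of parameters is enough, since \<open>minimizer_imp_le\<close> produces
  an inequality for each of them.\<close>

lemma flux_perturbation:
  assumes u: "u \<in> NN" and \<phi>: "\<phi> \<in> NN"
  shows "(\<lambda>n. flux (\<lambda>x. 1 * u x + 1 / real (Suc n) * \<phi> x) \<phi>) \<longlonglongrightarrow> flux u \<phi>"
proof -
  define t where "t n = 1 / real (Suc n)" for n
  have t: "0 < t n" "t n \<le> 1" for n by (auto simp: t_def)
  have v: "(\<lambda>x. 1 * u x + t n * \<phi> x) \<in> NN" for n by (rule newton_lincomb[OF u \<phi>])
  note [measurable] = u \<phi> v
  have t0: "t \<longlonglongrightarrow> 0" unfolding t_def by (intro LIMSEQ_Suc[OF lim_1_over_n])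
  then have tat: "filterlim t (at 0) sequentially"
    unfolding filterlim_at using t by (auto intro!: always_eventually simp: less_imp_neq[symmetric])
  have Dv: "AE x in mu. \<forall>n. D (\<lambda>x. 1 * u x + t n * \<phi> x) x = D u x + t n *\<^sub>R D \<phi> x"
    unfolding AE_all_countable using D_lincomb[OF u \<phi>, of 1] by (intro allI) simp
  have "(\<lambda>n. flux (\<lambda>x. 1 * u x + t n * \<phi> x) \<phi>) \<longlonglongrightarrow> flux u \<phi>"
  proof (rule integral_dominated_convergence)
    show "integrable mu (\<lambda>x. 2 powr p * (G u x powr p + G \<phi> x powr p))"
      using G_integrable[OF u] G_integrable[OF \<phi>] by simp
    show "AE x in mu. (\<lambda>n. pflux D ip p (\<lambda>x. 1 * u x + t n * \<phi> x) \<phi> x) \<longlonglongrightarrow> pflux D ip p u \<phi> x"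
      using Dv AE_space
    proof eventually_elim
      case (elim x)
      then have x: "x \<in> S" by simp
      then interpret inner_form "ip x" by (rule inner)
      show ?case using filterlim_compose[OF flux_perturbation_tendsto[OF p, of "D u x" "D \<phi> x"] tat] elim
        by (simp add: pflux_def cnorm_nm[OF x])
    qed
    show "AE x in mu. norm (pflux D ip p (\<lambda>x. 1 * u x + t n * \<phi> x) \<phi> x) \<le> 2 powr p * (G u x powr p + G \<phi> x powr p)" for n
      using Dv AE_space
    proof eventually_elim
      case (elim x)
      then have x: "x \<in> S" by simp
      have "G (\<lambda>x. 1 * u x + t n * \<phi> x) x \<le> G u x + \<bar>t n\<bar> * G \<phi> x"
        using elim cnorm_triangle[OF x, of "D u x" "t n *\<^sub>R D \<phi> x"] by (simp add: G_def cnorm_scale[OF x])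
      also have "\<dots> \<le> G u x + 1 * G \<phi> x" using t[of n] x by (intro add_left_mono mult_right_mono) auto
      finally have Gv: "G (\<lambda>x. 1 * u x + t n * \<phi> x) x \<le> G u x + G \<phi> x" by simp
      have "norm (pflux D ip p (\<lambda>x. 1 * u x + t n * \<phi> x) \<phi> x) \<le> G (\<lambda>x. 1 * u x + t n * \<phi> x) x powr (p - 1) * G \<phi> x"
        using pflux_le[OF x] by simp
      also have "\<dots> \<le> (G u x + G \<phi> x) powr (p - 1) * (G u x + G \<phi> x)"
        using Gv p x by (intro mult_mono powr_mono2) auto
      also have "\<dots> = \<bar>G u x + G \<phi> x\<bar> powr p"
        using powr_mult_base[of "G u x + G \<phi> x" "p - 1"] x by (simp add: mult.commute)
      also have "\<dots> \<le> 2 powr p * (G u x powr p + G \<phi> x powr p)"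
        using powr_abs_add_le[OF p_pos(1), of "G u x" "G \<phi> x"] x by simp
      finally show ?case .
    qed
  qed measurable
  then show ?thesis unfolding t_def .
qed

text \<open>Convexity is used at the perturbed function, not at \<open>u\<close>: it bounds the
  increase of energy by \<open>p * t\<close> times the flux of the perturbed function, minimality
  compares this with \<open>p * t * data \<phi>\<close>, and \<open>t\<close> tends to zero after
  division. The reverse inequality comes from the test function with opposite sign.\<close>

lemma minimizer_imp_le:
  assumes u: "u \<in> NN" and \<phi>: "\<phi> \<in> NN" and min: "\<And>v. v \<in> NN \<Longrightarrow> en u - p * data u \<le> en v - p * data v"
  shows "data \<phi> \<le> flux u \<phi>"
proof (rule LIMSEQ_le_const[OF flux_perturbation[OF u \<phi>]], intro exI allI impI)
  fix n :: nat
  define t where "t = 1 / real (Suc n)"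
  have t: "0 < t" by (simp add: t_def)
  let ?v = "\<lambda>x. 1 * u x + t * \<phi> x"
  have v: "?v \<in> NN" by (rule newton_lincomb[OF u \<phi>])
  have "en ?v + p * (- t * flux ?v \<phi>) = (\<integral>x. G ?v x powr p + p * (- t * pflux D ip p ?v \<phi> x) \<partial>mu)"
    unfolding en_def using G_integrable[OF v] pflux_integrable[OF v \<phi>] by simp
  also have "\<dots> \<le> en u"
    unfolding en_def
  proof (rule integral_mono_AE)
    show "AE x in mu. G ?v x powr p + p * (- t * pflux D ip p ?v \<phi> x) \<le> G u x powr p"
      using D_lincomb[OF u \<phi>, of 1 t] AE_space
    proof eventually_elim
      case (elim x)
      then have x: "x \<in> S" by simp
      then interpret inner_form "ip x" by (rule inner)
      have "D u x - D ?v x = (- t) *\<^sub>R D \<phi> x" using elim by simp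
      then have "ip x (D ?v x) (D u x - D ?v x) = - t * ip x (D ?v x) (D \<phi> x)" by (simp only: scale_right)
      then show ?case using gradient_inequality[OF p, of "D ?v x" "D u x"]
        by (simp add: G_def pflux_def cnorm_nm[OF x] mult.left_commute)
    qed
  qed (use G_integrable[OF v] G_integrable[OF u] pflux_integrable[OF v \<phi>] in auto)
  finally have "en ?v - p * t * flux ?v \<phi> \<le> en u" by simp
  moreover have "data ?v = data u + t * data \<phi>" using data_lincomb[OF u \<phi>, of 1 t] by simp
  ultimately have "p * t * data \<phi> \<le> p * t * flux ?v \<phi>" using min[OF v] by (simp add: algebra_simps)
  then have "data \<phi> \<le> flux ?v \<phi>" using t p by simp
  then show "data \<phi> \<le> flux (\<lambda>x. 1 * u x + 1 / real (Suc n) * \<phi> x) \<phi>"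
    unfolding t_def .
qed

lemma weak_iff_minimizer:
  assumes u: "u \<in> NN"
  shows "(\<forall>\<phi>\<in>NN. flux u \<phi> = data \<phi>) \<longleftrightarrow> (\<forall>v\<in>NN. en u - p * data u \<le> en v - p * data v)"
proof
  assume "\<forall>\<phi>\<in>NN. flux u \<phi> = data \<phi>"
  then show "\<forall>v\<in>NN. en u - p * data u \<le> en v - p * data v" using weak_imp_minimizer[OF u] by blast
next
  assume min: "\<forall>v\<in>NN. en u - p * data u \<le> en v - p * data v"
  show "\<forall>\<phi>\<in>NN. flux u \<phi> = data \<phi>"
  proof
    fix \<phi> assume \<phi>: "\<phi> \<in> NN"
    have \<phi>': "(\<lambda>x. (-1) * \<phi> x + 0 * \<phi> x) \<in> NN" by (rule newton_lincomb[OF \<phi> \<phi>])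
    have "data \<phi> \<le> flux u \<phi>" using minimizer_imp_le[OF u \<phi>] min by blast
    moreover have "- data \<phi> \<le> - flux u \<phi>"
      using minimizer_imp_le[OF u \<phi>'] min data_lincomb[OF \<phi> \<phi>, of "-1" 0] pflux_lincomb[OF u \<phi> \<phi>, of "-1" 0] by simp
    ultimately show "flux u \<phi> = data \<phi>" by simp
  qed
qed

end

section \<open>Boundary flux\<close>

context neumann_space
begin

definition eta :: "real \<Rightarrow> 'a \<Rightarrow> real" where "eta e y = min 1 (infdist y bd / e)"

lemma eta_range: "0 < e \<Longrightarrow> 0 \<le> eta e y" "eta e y \<le> 1"
  by (auto simp: eta_def infdist_nonneg)

lemma eta_lipschitz:
  assumes e: "0 < e" shows "(1 / e)-lipschitz_on S (eta e)"
proof (rule lipschitz_onI)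
  fix x y
  have "\<bar>eta e x - eta e y\<bar> \<le> \<bar>infdist x bd / e - infdist y bd / e\<bar>"
    unfolding eta_def by (auto simp: min_def)
  also have "\<dots> = \<bar>infdist x bd - infdist y bd\<bar> / e" using e by (simp add: diff_divide_distrib[symmetric])
  also have "\<dots> \<le> dist x y / e" using e by (intro divide_right_mono infdist_triangle_abs) auto
  finally show "dist (eta e x) (eta e y) \<le> 1 / e * dist x y" by (simp add: dist_real_def)
qed (use e in simp)

lemma eta_NN: "0 < e \<Longrightarrow> eta e \<in> NN"
  by (rule newton_lipschitz[OF eta_lipschitz])

lemma eta_boundary: "x \<in> bd \<Longrightarrow> eta e x = 0"
  by (simp add: eta_def)

lemma lipschitz_mult:
  fixes g h :: "'a \<Rightarrow> real"
  assumes g: "L-lipschitz_on S g" and h: "L'-lipschitz_on S h"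
  shows "\<exists>L. L-lipschitz_on S (\<lambda>x. g x * h x)"
proof -
  obtain A where A: "\<And>x. x \<in> S \<Longrightarrow> \<bar>g x\<bar> \<le> A" using lipschitz_bounded[OF g] by blast
  obtain B where B: "\<And>x. x \<in> S \<Longrightarrow> \<bar>h x\<bar> \<le> B" using lipschitz_bounded[OF h] by blast
  have L: "0 \<le> L" "0 \<le> L'" using g h lipschitz_on_nonneg by auto
  have "(\<bar>A\<bar> * L' + \<bar>B\<bar> * L)-lipschitz_on S (\<lambda>x. g x * h x)"
  proof (rule lipschitz_onI)
    fix x y assume xy: "x \<in> S" "y \<in> S"
    have "g x * h x - g y * h y = g x * (h x - h y) + h y * (g x - g y)" by (simp add: algebra_simps)
    then have "\<bar>g x * h x - g y * h y\<bar> \<le> \<bar>g x\<bar> * \<bar>h x - h y\<bar> + \<bar>h y\<bar> * \<bar>g x - g y\<bar>"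
      using abs_triangle_ineq[of "g x * (h x - h y)" "h y * (g x - g y)"] by (simp only: abs_mult)
    also have "\<dots> \<le> \<bar>A\<bar> * (L' * dist x y) + \<bar>B\<bar> * (L * dist x y)"
      using A[OF xy(1)] B[OF xy(2)] lipschitz_onD[OF g xy] lipschitz_onD[OF h xy]
      by (intro add_mono mult_mono) (auto simp: dist_real_def)
    finally show "dist (g x * h x) (g y * h y) \<le> (\<bar>A\<bar> * L' + \<bar>B\<bar> * L) * dist x y"
      by (simp add: dist_real_def algebra_simps)
  qed (use L in simp)
  then show ?thesis by blast
qed

lemma lipschitz_tendsto:
  fixes g :: "'a \<Rightarrow> real"
  assumes "L-lipschitz_on S g" "x \<in> S" shows "(g \<longlongrightarrow> g x) (at x within S)"
  using lipschitz_on_continuous_on[OF assms(1)] assms(2) by (simp add: continuous_on_def)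

lemma bounded_times_flux_integrable:
  assumes u: "u \<in> NN" and \<phi>: "\<phi> \<in> NN" and g: "L-lipschitz_on S g"
  shows "integrable mu (\<lambda>x. g x * pflux D ip p u \<phi> x)"
proof -
  obtain A where A: "\<And>x. x \<in> S \<Longrightarrow> \<bar>g x\<bar> \<le> A" using lipschitz_bounded[OF g] by blast
  note [measurable] = u \<phi> newton_measurable[OF newton_lipschitz[OF g]]
  show ?thesis
  proof (rule Bochner_Integration.integrable_bound)
    show "integrable mu (\<lambda>x. A * \<bar>pflux D ip p u \<phi> x\<bar>)" using pflux_integrable[OF u \<phi>] by simp
    show "AE x in mu. norm (g x * pflux D ip p u \<phi> x) \<le> norm (A * \<bar>pflux D ip p u \<phi> x\<bar>)"
    proof (rule AE_I2)
      fix x assume "x \<in> space mu"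
      then have "\<bar>g x\<bar> \<le> \<bar>A\<bar>" using A[of x] by simp
      then show "norm (g x * pflux D ip p u \<phi> x) \<le> norm (A * \<bar>pflux D ip p u \<phi> x\<bar>)"
        by (simp add: abs_mult mult_right_mono)
    qed
  qed measurable
qed

lemma flux_product:
  assumes u: "u \<in> NN" and g: "L-lipschitz_on S g" and h: "L'-lipschitz_on S h"
  shows "flux u (\<lambda>x. g x * h x) = (\<integral>x. g x * pflux D ip p u h x \<partial>mu) + (\<integral>x. h x * pflux D ip p u g x \<partial>mu)"
proof -
  have gN: "g \<in> NN" and hN: "h \<in> NN" using newton_lipschitz g h by auto
  have ghN: "(\<lambda>x. g x * h x) \<in> NN" using lipschitz_mult[OF g h] newton_lipschitz by blast
  note i = bounded_times_flux_integrable[OF u hN g] bounded_times_flux_integrable[OF u gN h]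
  note [measurable] = u gN hN ghN newton_measurable[OF gN] newton_measurable[OF hN]
  have "flux u (\<lambda>x. g x * h x) = (\<integral>x. g x * pflux D ip p u h x + h x * pflux D ip p u g x \<partial>mu)"
  proof (rule integral_cong_AE)
    show "AE x in mu. pflux D ip p u (\<lambda>x. g x * h x) x = g x * pflux D ip p u h x + h x * pflux D ip p u g x"
      using D_leibniz[OF gN hN ghN] AE_space by eventually_elim (simp add: pflux_AE_linear)
  qed measurable
  then show ?thesis using i by simp
qed

text \<open>At a point of \<Omega> the distance to the closed, nonempty boundary is positive, so the
  cutoffs are eventually 1 there; the boundary itself is a null set. Sequences are used because
  dominated convergence is stated for them.\<close>

lemma eta_flux_tendsto:
  assumes u: "u \<in> NN" and \<phi>: "\<phi> \<in> NN" and ne: "bd \<noteq> {}"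
  shows "((\<lambda>e. \<integral>x. eta e x * pflux D ip p u \<phi> x \<partial>mu) \<longlongrightarrow> flux u \<phi>) (at_right 0)"
  unfolding tendsto_at_iff_sequentially o_def
proof (intro allI impI)
  fix X :: "nat \<Rightarrow> real" assume X: "\<forall>i. X i \<in> {0<..} - {0}" "X \<longlonglongrightarrow> 0"
  then have Xp: "0 < X i" for i by auto
  note [measurable] = u \<phi> newton_measurable[OF eta_NN[OF Xp]]
  show "(\<lambda>i. \<integral>x. eta (X i) x * pflux D ip p u \<phi> x \<partial>mu) \<longlonglongrightarrow> flux u \<phi>"
  proof (rule integral_dominated_convergence)
    show "integrable mu (\<lambda>x. \<bar>pflux D ip p u \<phi> x\<bar>)" using pflux_integrable[OF u \<phi>] by simp
    show "AE x in mu. (\<lambda>i. eta (X i) x * pflux D ip p u \<phi> x) \<longlonglongrightarrow> pflux D ip p u \<phi> x"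
      using AE_Omega
    proof eventually_elim
      case (elim x)
      have "infdist x bd \<noteq> 0" using in_closed_iff_infdist_zero[OF bd_closed ne, of x] elim by simp
      then have "0 < infdist x bd" using infdist_nonneg[of x bd] by linarith
      then have "\<forall>\<^sub>F i in sequentially. X i < infdist x bd" by (rule order_tendstoD(2)[OF X(2)])
      then have "\<forall>\<^sub>F i in sequentially. eta (X i) x * pflux D ip p u \<phi> x = pflux D ip p u \<phi> x"
      proof eventually_elim
        case (elim i)
        then have "1 \<le> infdist x bd / X i" using Xp[of i] by simp
        then show ?case by (simp add: eta_def)
      qed
      then show ?case by (rule tendsto_eventually)
    qed
    show "AE x in mu. norm (eta (X i) x * pflux D ip p u \<phi> x) \<le> \<bar>pflux D ip p u \<phi> x\<bar>" for i
      using eta_range[of "X i"] Xp[of i] by (intro AE_I2) (auto simp: abs_mult mult_left_le_one_le)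
  qed measurable
qed

text \<open>Since \<open>min (eta e) d = d * eta (d * e)\<close>, the function \<open>eta e - d * eta (d * e)\<close> is a cutoff that
  vanishes near the boundary.\<close>

lemma eta_cutoff_support:
  assumes e: "0 < e" and d: "0 < d" "d \<le> 1" and ne: "bd \<noteq> {}"
  shows "compact (closure {x \<in> S. \<phi> x * eta e x - d * (\<phi> x * eta (d * e) x) \<noteq> 0})"
    "closure {x \<in> S. \<phi> x * eta e x - d * (\<phi> x * eta (d * e) x) \<noteq> 0} \<subseteq> \<Omega>"
proof -
  let ?Z = "{x \<in> S. \<phi> x * eta e x - d * (\<phi> x * eta (d * e) x) \<noteq> 0}"
  let ?F = "S \<inter> {x. d * e \<le> infdist x bd}"
  have "?Z \<subseteq> ?F"
  proof
    fix x assume x: "x \<in> ?Z"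
    have "d * e \<le> infdist x bd"
    proof (rule ccontr)
      assume "\<not> d * e \<le> infdist x bd"
      then have i: "infdist x bd < d * e" by simp
      then have "infdist x bd / (d * e) \<le> 1" using e d by simp
      moreover have "infdist x bd / e \<le> d" using i e by (simp add: divide_le_eq)
      then have "infdist x bd / e \<le> 1" using d by linarith
      ultimately have "eta e x = d * eta (d * e) x" using d by (simp add: eta_def)
      then show False using x by simp
    qed
    then show "x \<in> ?F" using x by simp
  qed
  moreover have cF: "closed ?F"
    using compact_S by (intro closed_Int compact_imp_closed closed_Collect_le continuous_intros)
  ultimately have sub: "closure ?Z \<subseteq> ?F" by (rule closure_minimal)
  have eq: "S \<inter> closure ?Z = closure ?Z" using sub by blast
  show "compact (closure ?Z)" by (subst eq[symmetric]) (rule compact_Int_closed[OF compact_S closed_closure])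
  have "?F \<subseteq> \<Omega>"
  proof
    fix x assume x: "x \<in> ?F"
    have "0 < d * e" using e d by simp
    with x have "0 < infdist x bd" by (auto intro: less_le_trans)
    then have "x \<notin> bd" by (metis infdist_zero less_irrefl)
    then show "x \<in> \<Omega>" using x by blast
  qed
  then show "closure ?Z \<subseteq> \<Omega>" by (rule order.trans[OF sub])
qed

section \<open>The weak formulation against harmonicity and the boundary limit\<close>

lemma harmonic_iff:
  assumes u: "u \<in> NN"
  shows "cheeger_p_harmonic M p S D ip \<Omega> u \<longleftrightarrow>
    (\<forall>\<phi>\<in>NN. compact (closure {x \<in> S. \<phi> x \<noteq> 0}) \<and> closure {x \<in> S. \<phi> x \<noteq> 0} \<subseteq> \<Omega> \<longrightarrow> flux u \<phi> = 0)"
  unfolding cheeger_p_harmonic_def using set_integral_Omega[OF pflux_measurable[OF u]] by auto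

lemma data_zero_if_trace_zero:
  assumes "w \<in> NN" "\<And>x. x \<in> bd \<Longrightarrow> (w \<longlongrightarrow> w x) (at x within S)" "\<And>x. x \<in> bd \<Longrightarrow> w x = 0"
  shows "data w = 0"
proof -
  have "AE x in \<nu>. T w x * f x = 0"
  proof -
    have "AE x in \<nu>. T w x = w x" by (rule trace_eq[OF assms(1)]) (rule assms(2))
    then show ?thesis using AE_bd by eventually_elim (simp add: assms(3))
  qed
  then have "(\<integral>x. T w x * f x \<partial>\<nu>) = (\<integral>x. 0 \<partial>\<nu>)"
    using trace_meas[OF assms(1)] by (intro integral_cong_AE) auto
  then show ?thesis by (simp add: data_def)
qed

text \<open>A test function with support in \<Omega> vanishes near every boundary point, so its
  trace is zero and the data term drops out.\<close>

lemma weak_imp_harmonic: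
  assumes u: "u \<in> NN" and weak: "\<And>\<phi>. \<phi> \<in> NN \<Longrightarrow> flux u \<phi> = data \<phi>"
  shows "cheeger_p_harmonic M p S D ip \<Omega> u"
  unfolding harmonic_iff[OF u]
proof (intro ballI impI)
  fix \<phi> assume \<phi>: "\<phi> \<in> NN" and sup: "compact (closure {x \<in> S. \<phi> x \<noteq> 0}) \<and> closure {x \<in> S. \<phi> x \<noteq> 0} \<subseteq> \<Omega>"
  let ?C = "closure {x \<in> S. \<phi> x \<noteq> 0}"
  have zero: "\<phi> x = 0" if "x \<in> S" "x \<notin> ?C" for x
    using that closure_subset[of "{x \<in> S. \<phi> x \<noteq> 0}"] by blast
  have "data \<phi> = 0"
  proof (rule data_zero_if_trace_zero[OF \<phi>])
    fix x assume x: "x \<in> bd"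
    then have xC: "x \<notin> ?C" using sup by blast
    show z: "\<phi> x = 0" using x by (intro zero xC) blast
    have "\<forall>\<^sub>F y in at x within S. y \<in> - ?C"
      by (rule topological_tendstoD[OF tendsto_ident_at open_Compl[OF closed_closure]]) (unfold Compl_iff, rule xC)
    then have "\<forall>\<^sub>F y in at x within S. \<phi> y = \<phi> x"
      unfolding eventually_at_filter by (rule eventually_mono) (metis ComplD zero z)
    then show "(\<phi> \<longlongrightarrow> \<phi> x) (at x within S)" by (rule tendsto_eventually)
  qed
  then show "flux u \<phi> = 0" using weak[OF \<phi>] by simp
qed

definition boundary_flux_limit :: "('a \<Rightarrow> real) \<Rightarrow> ('a \<Rightarrow> real) \<Rightarrow> bool" where
  "boundary_flux_limit u \<phi> \<longleftrightarrow> ((\<lambda>e. \<integral>x. \<phi> x * pflux D ip p u (eta e) x \<partial>mu) \<longlongrightarrow> - data \<phi>) (at_right 0)"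

lemma flux_eta_split:
  assumes u: "u \<in> NN" and \<phi>: "L-lipschitz_on S \<phi>" and e: "0 < e"
  shows "flux u (\<lambda>x. \<phi> x * eta e x) = (\<integral>x. \<phi> x * pflux D ip p u (eta e) x \<partial>mu) + (\<integral>x. eta e x * pflux D ip p u \<phi> x \<partial>mu)"
  by (rule flux_product[OF u \<phi> eta_lipschitz[OF e]])

lemma eventually_pos: "\<forall>\<^sub>F e in at_right (0::real). 0 < e"
  by (simp add: eventually_at_filter)

lemma weak_imp_boundary_flux:
  assumes u: "u \<in> NN" and weak: "\<And>\<phi>. \<phi> \<in> NN \<Longrightarrow> flux u \<phi> = data \<phi>"
    and ne: "bd \<noteq> {}" and \<phi>: "L-lipschitz_on S \<phi>"
  shows "boundary_flux_limit u \<phi>"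
proof -
  have \<phi>N: "\<phi> \<in> NN" by (rule newton_lipschitz[OF \<phi>])
  have eq: "(\<integral>x. \<phi> x * pflux D ip p u (eta e) x \<partial>mu) = - (\<integral>x. eta e x * pflux D ip p u \<phi> x \<partial>mu)" if e: "0 < e" for e
  proof -
    obtain L' where L': "L'-lipschitz_on S (\<lambda>x. \<phi> x * eta e x)" using lipschitz_mult[OF \<phi> eta_lipschitz[OF e]] by blast
    have "data (\<lambda>x. \<phi> x * eta e x) = 0"
      by (rule data_zero_if_trace_zero[OF newton_lipschitz[OF L'] lipschitz_tendsto[OF L']])
        (auto simp: eta_boundary)
    then show ?thesis using weak[OF newton_lipschitz[OF L']] flux_eta_split[OF u \<phi> e] by simp
  qed
  have "((\<lambda>e. - (\<integral>x. eta e x * pflux D ip p u \<phi> x \<partial>mu)) \<longlongrightarrow> - flux u \<phi>) (at_right 0)"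
    by (intro tendsto_minus eta_flux_tendsto[OF u \<phi>N ne])
  moreover have "\<forall>\<^sub>F e in at_right 0. - (\<integral>x. eta e x * pflux D ip p u \<phi> x \<partial>mu) = (\<integral>x. \<phi> x * pflux D ip p u (eta e) x \<partial>mu)"
    using eventually_pos by eventually_elim (simp add: eq)
  ultimately show ?thesis unfolding boundary_flux_limit_def weak[OF \<phi>N, symmetric] by (rule Lim_transform_eventually)
qed

lemma boundary_flux_imp_lipschitz_weak:
  assumes u: "u \<in> NN" and harm: "cheeger_p_harmonic M p S D ip \<Omega> u"
    and ne: "bd \<noteq> {}" and \<phi>: "L-lipschitz_on S \<phi>" and lim: "boundary_flux_limit u \<phi>"
  shows "flux u \<phi> = data \<phi>"
proof -
  have \<phi>N: "\<phi> \<in> NN" by (rule newton_lipschitz[OF \<phi>])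
  define F where "F e = flux u (\<lambda>x. \<phi> x * eta e x)" for e
  have "((\<lambda>e. (\<integral>x. \<phi> x * pflux D ip p u (eta e) x \<partial>mu) + (\<integral>x. eta e x * pflux D ip p u \<phi> x \<partial>mu)) \<longlongrightarrow> - data \<phi> + flux u \<phi>) (at_right 0)"
    using lim unfolding boundary_flux_limit_def by (intro tendsto_add eta_flux_tendsto[OF u \<phi>N ne])
  moreover have "\<forall>\<^sub>F e in at_right 0. (\<integral>x. \<phi> x * pflux D ip p u (eta e) x \<partial>mu) + (\<integral>x. eta e x * pflux D ip p u \<phi> x \<partial>mu) = F e"
    using eventually_pos by eventually_elim (simp add: F_def flux_eta_split[OF u \<phi>])
  ultimately have Flim: "(F \<longlongrightarrow> - data \<phi> + flux u \<phi>) (at_right 0)" by (rule Lim_transform_eventually)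
  have scale: "F e = d * F (d * e)" if e: "0 < e" and d: "0 < d" "d \<le> 1" for e d
  proof -
    have de: "0 < d * e" using e d by simp
    obtain L1 where L1: "L1-lipschitz_on S (\<lambda>x. \<phi> x * eta e x)" using lipschitz_mult[OF \<phi> eta_lipschitz[OF e]] by blast
    obtain L2 where L2: "L2-lipschitz_on S (\<lambda>x. \<phi> x * eta (d * e) x)" using lipschitz_mult[OF \<phi> eta_lipschitz[OF de]] by blast
    note N = newton_lipschitz[OF L1] newton_lipschitz[OF L2]
    define g where "g = (\<lambda>x. 1 * (\<phi> x * eta e x) + (- d) * (\<phi> x * eta (d * e) x))"
    have gN: "g \<in> NN" unfolding g_def by (rule newton_lincomb[OF N])
    have eq: "{x \<in> S. g x \<noteq> 0} = {x \<in> S. \<phi> x * eta e x - d * (\<phi> x * eta (d * e) x) \<noteq> 0}"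
      by (simp add: g_def)
    note H = harm[unfolded harmonic_iff[OF u], rule_format, OF gN]
    have "flux u g = 0"
      by (rule H) (unfold eq, intro conjI eta_cutoff_support[OF e d ne])
    then show ?thesis using pflux_lincomb[OF u N, of 1 "- d"] by (simp add: F_def g_def)
  qed
  \<comment> \<open>Since \<open>F\<close> has a finite limit, \<open>d * F d\<close> tends to zero;
    by \<open>scale\<close> with \<open>e = 1\<close> it is constantly \<open>F 1\<close>.\<close>
  have "((\<lambda>d. d * F d) \<longlongrightarrow> 0 * (- data \<phi> + flux u \<phi>)) (at_right 0)"
    by (intro tendsto_mult Flim tendsto_ident_at)
  moreover have "\<forall>\<^sub>F d in at_right 0. d * F d = F 1"
  proof -
    have "\<forall>\<^sub>F d in at_right 0. d \<in> {0<..<1::real}" by (rule eventually_at_right_real) simp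
    then show ?thesis by eventually_elim (use scale[of 1] in auto)
  qed
  ultimately have "((\<lambda>d. F 1) \<longlongrightarrow> 0) (at_right (0::real))"
    by (auto intro: Lim_transform_eventually)
  then have F1: "F 1 = 0" by (simp add: tendsto_const_iff)
  \<comment> \<open>The relation \<open>scale\<close> at base point 1 with factor \<open>e\<close>
    reads \<open>F 1 = e * F e\<close>.\<close>
  have Fe: "F e = 0" if "0 < e" "e \<le> 1" for e using scale[of 1 e] that F1 by simp
  have "\<forall>\<^sub>F e in at_right 0. F e = 0"
  proof -
    have "\<forall>\<^sub>F d in at_right 0. d \<in> {0<..<1::real}" by (rule eventually_at_right_real) simp
    then show ?thesis by eventually_elim (use Fe in auto)
  qed
  then have "(F \<longlongrightarrow> 0) (at_right 0)" by (rule tendsto_eventually)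
  then have "- data \<phi> + flux u \<phi> = 0" using Flim by (rule tendsto_unique[OF trivial_limit_at_right_real, rotated])
  then show ?thesis by simp
qed

text \<open>Here \<open>infdist\<close> to the empty set is \<open>0\<close>, so \<open>eta e\<close> vanishes identically, and every test function is
  compactly supported in \<open>\<Omega>\<close>.\<close>

lemma empty_boundary:
  assumes u: "u \<in> NN" and emp: "bd = {}"
  shows "data \<phi> = 0" "cheeger_p_harmonic M p S D ip \<Omega> u \<longleftrightarrow> (\<forall>\<phi>\<in>NN. flux u \<phi> = 0)"
    "boundary_flux_limit u \<phi>"
proof -
  have sp: "space \<nu> = UNIV" using sets_eq_imp_space_eq[OF nu_sets] by simp
  have "emeasure \<nu> (space \<nu>) = 0" using nu_supp emp sp by simp
  then have ae: "AE x in \<nu>. P x" for P by (intro AE_I[of _ _ "space \<nu>"]) auto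
  show d0: "data \<phi> = 0" for \<phi>
    unfolding data_def using integral_eq_zero_AE[OF ae] by blast
  have sub: "closure {x \<in> S. \<phi> x \<noteq> 0} \<subseteq> S" for \<phi> :: "'a \<Rightarrow> real"
    using compact_S by (intro closure_minimal compact_imp_closed) auto
  moreover have "compact (closure {x \<in> S. \<phi> x \<noteq> 0})" for \<phi> :: "'a \<Rightarrow> real"
    using compact_Int_closed[OF compact_S closed_closure, of "{x \<in> S. \<phi> x \<noteq> 0}"] sub[of \<phi>]
    by (simp add: inf_absorb2)
  moreover have "S = \<Omega>" using emp Omega_sub by auto
  ultimately show "cheeger_p_harmonic M p S D ip \<Omega> u \<longleftrightarrow> (\<forall>\<phi>\<in>NN. flux u \<phi> = 0)"
    unfolding harmonic_iff[OF u] by metis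
  have "eta e = (\<lambda>_. 0)" for e unfolding eta_def emp by (auto simp: infdist_def)
  moreover have "AE x in mu. \<phi> x * pflux D ip p u (\<lambda>_. 0) x = 0"
    using D_const[of 0] AE_space
  proof eventually_elim
    case (elim x)
    then interpret inner_form "ip x" by (intro inner) simp
    show ?case using elim by (simp add: pflux_def)
  qed
  then have "(\<integral>x. \<phi> x * pflux D ip p u (\<lambda>_. 0) x \<partial>mu) = 0" by (rule integral_eq_zero_AE)
  ultimately show "boundary_flux_limit u \<phi>" unfolding boundary_flux_limit_def d0 by simp
qed

lemma weak_iff_boundary_flux:
  assumes u: "u \<in> NN"
  shows "(\<forall>\<phi>\<in>NN. flux u \<phi> = data \<phi>) \<longleftrightarrow>
    cheeger_p_harmonic M p S D ip \<Omega> u \<and> (\<forall>\<phi>. (\<exists>L. L-lipschitz_on S \<phi>) \<longrightarrow> boundary_flux_limit u \<phi>)"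
proof (cases "bd = {}")
  case True
  then show ?thesis using empty_boundary[OF u True] by simp
next
  case False
  then show ?thesis
    using weak_imp_harmonic[OF u] weak_imp_boundary_flux[OF u _ False]
      weak_solution_if_lipschitz[OF u] boundary_flux_imp_lipschitz_weak[OF u _ False] by blast
qed

lemma boundary_flux_limit_iff:
  assumes u: "u \<in> NN" and \<phi>: "L-lipschitz_on S \<phi>"
  shows "((\<lambda>\<epsilon>. LINT x:\<Omega>|M. \<phi> x * pflux D ip p u (\<lambda>y. min 1 (infdist y bd / \<epsilon>)) x) \<longlongrightarrow> - data \<phi>) (at_right 0)
    \<longleftrightarrow> boundary_flux_limit u \<phi>"
  unfolding boundary_flux_limit_def
proof (rule tendsto_cong)
  show "\<forall>\<^sub>F \<epsilon> in at_right 0. (LINT x:\<Omega>|M. \<phi> x * pflux D ip p u (\<lambda>y. min 1 (infdist y bd / \<epsilon>)) x)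
    = (\<integral>x. \<phi> x * pflux D ip p u (eta \<epsilon>) x \<partial>mu)"
    using eventually_pos
  proof eventually_elim
    case (elim e)
    note [measurable] = u eta_NN[OF elim] newton_measurable[OF newton_lipschitz[OF \<phi>]]
    have "(LINT x:\<Omega>|M. \<phi> x * pflux D ip p u (eta e) x) = (\<integral>x. \<phi> x * pflux D ip p u (eta e) x \<partial>mu)"
      by (rule set_integral_Omega) measurable
    then show ?case by (simp add: eta_def[abs_def])
  qed
qed

end

theorem theorem1p1:
  fixes M \<nu> :: "'a::complete_space measure"
    and \<Omega> :: "'a set" and p \<Theta> CJ :: real and x0 :: 'a
    and D :: "('a \<Rightarrow> real) \<Rightarrow> 'a \<Rightarrow> real^'n"
    and ip :: "'a \<Rightarrow> real^'n \<Rightarrow> real^'n \<Rightarrow> real"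
    and T :: "('a \<Rightarrow> real) \<Rightarrow> 'a \<Rightarrow> real"
    and f u :: "'a \<Rightarrow> real"
  assumes p: "1 < p"
    and M_radon: "radon_measure M"
    and \<Omega>_open: "open \<Omega>" and \<Omega>_conn: "connected \<Omega>"
    and H0: "john_domain \<Omega> x0 CJ"
    and H1_doubling: "doubling_on M (closure \<Omega>)"
    and H1_poincare: "poincare_on M p (closure \<Omega>)"
    and \<nu>_radon: "radon_measure \<nu>"
    and \<nu>_supp: "emeasure \<nu> (- (closure \<Omega> - \<Omega>)) = 0"
    and \<Theta>: "0 < \<Theta>" "\<Theta> < p"
    and H2: "\<exists>C \<ge> 1. \<forall>x \<in> closure \<Omega> - \<Omega>. \<forall>r. 0 < r \<and> r < 2 * diameter (closure \<Omega> - \<Omega>) \<longrightarrow>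
               ennreal (r powr (- \<Theta>)) * emeasure M (ball x r \<inter> \<Omega>) \<le> ennreal C * emeasure \<nu> (ball x r) \<and>
               emeasure \<nu> (ball x r) \<le> ennreal C * (ennreal (r powr (- \<Theta>)) * emeasure M (ball x r \<inter> \<Omega>))"
    and trace_meas: "\<forall>w \<in> newton_space M p (closure \<Omega>). T w \<in> borel_measurable \<nu>"
    and trace_lebesgue: "\<forall>w \<in> newton_space M p (closure \<Omega>). AE x in \<nu>.
           ((\<lambda>r. (\<integral>\<^sup>+ y \<in> ball x r \<inter> \<Omega>. ennreal \<bar>w y - T w x\<bar> \<partial>M) / emeasure M (ball x r \<inter> \<Omega>))
              \<longlongrightarrow> 0) (at_right 0)"
    and trace_linear: "\<forall>w \<in> newton_space M p (closure \<Omega>). \<forall>v \<in> newton_space M p (closure \<Omega>). \<forall>a b::real.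
           AE x in \<nu>. T (\<lambda>y. a * w y + b * v y) x = a * T w x + b * T v x"
    and trace_bounded: "\<exists>C. \<forall>w \<in> newton_space M p (closure \<Omega>). \<forall>g. upper_gradient (closure \<Omega>) w g \<longrightarrow>
           (\<integral>\<^sup>+ x. ennreal (\<bar>T w x\<bar> powr p) \<partial>\<nu>)
             \<le> ennreal C * ((\<integral>\<^sup>+ x \<in> closure \<Omega>. ennreal (\<bar>w x\<bar> powr p) \<partial>M)
                             + (\<integral>\<^sup>+ x \<in> closure \<Omega>. enn_powr (g x) p \<partial>M))"
    and cheeger: "cheeger_structure M p (closure \<Omega>) D ip"
    and f_meas: "f \<in> borel_measurable \<nu>"
    and f_Lp': "(\<integral>\<^sup>+ x. ennreal (\<bar>f x\<bar> powr (p / (p - 1))) \<partial>\<nu>) < \<infinity>"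
    and f_int: "integrable \<nu> f" and f_mean: "(\<integral>x. f x \<partial>\<nu>) = 0"
    and u: "u \<in> newton_space M p (closure \<Omega>)"
  shows "((\<forall>\<phi> \<in> newton_space M p (closure \<Omega>).
             (LINT x:\<Omega>|M. pflux D ip p u \<phi> x) = (\<integral>x. T \<phi> x * f x \<partial>\<nu>))
          \<longleftrightarrow>
          (\<forall>v \<in> newton_space M p (closure \<Omega>).
             (LINT x:closure \<Omega>|M. cnorm ip x (D u x) powr p) - p * (\<integral>x. T u x * f x \<partial>\<nu>)
               \<le> (LINT x:closure \<Omega>|M. cnorm ip x (D v x) powr p) - p * (\<integral>x. T v x * f x \<partial>\<nu>)))
       \<and>
       ((\<forall>\<phi> \<in> newton_space M p (closure \<Omega>).
             (LINT x:\<Omega>|M. pflux D ip p u \<phi> x) = (\<integral>x. T \<phi> x * f x \<partial>\<nu>))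
          \<longleftrightarrow>
          (cheeger_p_harmonic M p (closure \<Omega>) D ip \<Omega> u \<and>
           (\<forall>\<phi>. (\<exists>L. L-lipschitz_on (closure \<Omega>) \<phi>) \<longrightarrow>
              ((\<lambda>\<epsilon>. LINT x:\<Omega>|M. \<phi> x * pflux D ip p u (\<lambda>y. min 1 (infdist y (closure \<Omega> - \<Omega>) / \<epsilon>)) x)
                 \<longlongrightarrow> - (\<integral>x. T \<phi> x * f x \<partial>\<nu>)) (at_right 0))))"
proof -
  have sets_M: "sets M = sets borel" and sets_nu: "sets \<nu> = sets borel"
    using M_radon \<nu>_radon by (auto simp: radon_measure_def)
  note comp = john_doubling_compact[OF sets_M H0 H1_doubling]
  interpret pi_space M p "closure \<Omega>" D ip
    by unfold_locales (use p sets_M comp cheeger H1_doubling H1_poincare in auto)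
  \<comment> \<open>Interpreted separately because the null boundary is a theorem of
    \<open>pi_space\<close> and an assumption here.\<close>
  interpret neumann_space M p "closure \<Omega>" D ip \<Omega> \<nu> T f
  proof unfold_locales
    show "measure mu (closure \<Omega> - \<Omega>) = 0" by (rule boundary_null[OF refl \<Omega>_open H0])
  qed (use \<Omega>_open sets_nu \<nu>_supp trace_meas trace_lebesgue trace_linear trace_bounded f_meas f_Lp' in auto)
  have weak: "(\<forall>\<phi> \<in> NN. (LINT x:\<Omega>|M. pflux D ip p u \<phi> x) = data \<phi>) \<longleftrightarrow> (\<forall>\<phi>\<in>NN. flux u \<phi> = data \<phi>)"
    using set_integral_Omega[OF pflux_measurable[OF u]] by simp
  have energy: "(LINT x:closure \<Omega>|M. cnorm ip x (D v x) powr p) = en v" for v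
    unfolding en_def G_def set_integral_mu ..
  have bdry: "(\<forall>\<phi>. (\<exists>L. L-lipschitz_on (closure \<Omega>) \<phi>) \<longrightarrow>
      ((\<lambda>\<epsilon>. LINT x:\<Omega>|M. \<phi> x * pflux D ip p u (\<lambda>y. min 1 (infdist y (closure \<Omega> - \<Omega>) / \<epsilon>)) x)
                 \<longlongrightarrow> - data \<phi>) (at_right 0))
    \<longleftrightarrow> (\<forall>\<phi>. (\<exists>L. L-lipschitz_on (closure \<Omega>) \<phi>) \<longrightarrow> boundary_flux_limit u \<phi>)"
    using boundary_flux_limit_iff[OF u] by blast
  show ?thesis
    unfolding data_def[symmetric] energy weak bdry
    using weak_iff_minimizer[OF u] weak_iff_boundary_flux[OF u] by blast
qed

end
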